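(* Let $r \ge 2$, $m \ge 1$ and $t \ge 1$ be integers. Then the group $\mathrm{PU}_m(\mathbb{L}_r^{\otimes t})$ of positive unitary $m\times m$ matrices over $\mathbb{L}_r^{\otimes t}$ is isomorphic to the Brin-Higman-Thompson group $tV_{r,m}$.
   Context: **The ring $\mathbb{L}_r$.** For an integer $r\ge 2$, $\mathbb{L}_r$ is the associative unital ring (a $\mathbb{Z}$-algebra) generated by $x_1,\dots,x_r,y_1,\dots,y_r$ subject to the relations $x_i y_j = \delta_{i,j}$ for all $i,j\in\{1,\dots,r\}$ and $\sum_{i=1}^r y_i x_i = 1$. It has the involution $p\mapsto p^*$ which is the unique anti-automorphism with $x_i^*=y_i$ and $y_i^*=x_i$ for all $i$. A monomial of $\mathbb{L}_r$ is an element of the multiplicative submonoid generated by $x_1,\dots,x_r,y_1,\dots,y_r$. **Tensor powers and matrices.** $\mathbb{L}_r^{\otimes t}$ is the tensor product over $\mathbb{Z}$ of $t$ copies of $\mathbb{L}_r$, with the involution determined by $(p_1\otimes\cdots\otimes p_t)^* = p_1^*\otimes\cdots\otimes p_t^*$. $\mathrm{M}_m(\mathbb{L}_r^{\otimes t})$ is the ring of $m\times m$ matrices over $\mathbb{L}_r^{\otimes t}$, with involution $U\mapsto U^*$ the conjugate-transpose, $(U^* )_{i,j} = (U_{j,i})^*$. Let $e_{i,j}$ be the matrix unit with $1$ in position $(i,j)$ and $0$ elsewhere. The positive cone $\mathrm{P}_m(\mathbb{L}_r^{\otimes t})$ is the additive submonoid of $\mathrm{M}_m(\mathbb{L}_r^{\otimes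 t})$ generated by all elements $e_{i,j}\,(w_1\otimes\cdots\otimes w_t)$ with $i,j\in\{1,\dots,m\}$ and $w_1,\dots,w_t$ monomials of $\mathbb{L}_r$. Let $\mathrm{U}_m(\mathbb{L}_r^{\otimes t})$ be the group of all $U\in \mathrm{M}_m(\mathbb{L}_r^{\otimes t})$ with $UU^*=U^*U=\mathbf{I}_m$. Define $\mathrm{PU}_m(\mathbb{L}_r^{\otimes t}) = \mathrm{P}_m(\mathbb{L}_r^{\otimes t})\cap \mathrm{U}_m(\mathbb{L}_r^{\otimes t})$; this is a group under multiplication, with inversion given by $U\mapsto U^*$. **The Brin-Higman-Thompson group $tV_{r,m}$.** For $\ell\in\{1,\dots,t\}$ and $k\in\{1,\dots,r\}$ let $y_{\ell,k} = 1^{\otimes(\ell-1)}\otimes y_k\otimes 1^{\otimes(t-\ell)}\in\mathbb{L}_r^{\otimes t}$. Let $Y$ be the multiplicative submonoid of $\mathbb{L}_r^{\otimes t}$ generated by all the $y_{\ell,k}$ (it is the direct product of $t$ free monoids of rank $r$, the $\ell$-th being free on $y_{\ell,1},\dots,y_{\ell,r}$). Let $W=\{e_{i,1}w : 1\le i\le m,\ w\in Y\}\subseteq \mathrm{M}_m(\mathbb{L}_r^{\otimes t})$, which is identified with the Cartesian product $\{e_{1,1},\dots,e_{m,1}\}\times Y$. For a finite subset $A\subseteq W$, $a\in A$ and $\ell\in\{1,\dots,t\}$, the corresponding expansion of $A$ is $$\partial_{\ell,a}(A) = (A\setminus\{a\})\cup\{a y_{\ell,1},\dots,a y_{\ell,r}\}.$$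 Let $\mathfrak{B}_m^{(t)}$ be the smallest set of finite subsets of $W$ that contains $\{e_{1,1},e_{2,1},\dots,e_{m,1}\}$ and is closed under all expansions ($A\in\mathfrak{B}_m^{(t)}$, $a\in A$, $1\le \ell\le t$ imply $\partial_{\ell,a}(A)\in\mathfrak{B}_m^{(t)}$). Its elements are called bases. Let $\Phi$ be the set of all bijections $\phi\colon A\to B$, $a\mapsto a^\phi$, with $A,B\in\mathfrak{B}_m^{(t)}$. For $(\phi\colon A\to B)\in\Phi$, $a\in A$, $b=a^\phi$ and $\ell\in\{1,\dots,t\}$, the expansion $\partial_{\ell,a}(\phi)\colon\partial_{\ell,a}(A)\to\partial_{\ell,b}(B)$ is the bijection that agrees with $\phi$ on $A\setminus\{a\}$ and sends $ay_{\ell,s}$ to $by_{\ell,s}$ for $1\le s\le r$. As a set, $tV_{r,m}$ is the quotient of $\Phi$ by the smallest equivalence relation identifying each element of $\Phi$ with all of its expansions. Given two classes, one can choose representatives $\phi\colon A\to B$ and $\psi\colon B\to C$ (by taking successive expansions), and their product is the class of the composite $A\xrightarrow{\phi}B\xrightarrow{\psi}C$ (first $\phi$, then $\psi$); this is well defined and makes $tV_{r,m}$ a group. *)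

theory Defs
  imports "HOL-Algebra.QuotRing" "HOL-Algebra.Generated_Groups"
    "HOL-Algebra.Product_Groups" "HOL-Algebra.Free_Abelian_Groups"
begin

section \<open>Integral monoid rings and generated submonoids\<close>

text \<open>The monoid ring \<open>\<int>[M]\<close>: its additive group is \<^const>\<open>free_Abelian_group\<close> on the carrier
  of \<open>M\<close>, and the multiplication extends that of \<open>M\<close> bilinearly.\<close>

definition monoid_ring :: "('a, 'b) monoid_scheme \<Rightarrow> ('a \<Rightarrow>\<^sub>0 int) ring" where
  "monoid_ring M =
     \<lparr>carrier = carrier (free_Abelian_group (carrier M)),
      mult = (\<lambda>p q. frag_extend (\<lambda>a. frag_extend (\<lambda>b. frag_of (a \<otimes>\<^bsub>M\<^esub> b)) q) p),
      one = frag_of \<one>\<^bsub>M\<^esub>,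
      ring.zero = 0,
      ring.add = (+)\<rparr>"

definition free_monoid :: "'a set \<Rightarrow> 'a list monoid" where
  "free_monoid S = \<lparr>carrier = lists S, mult = (@), one = []\<rparr>"

inductive_set submonoid_generated :: "('a, 'b) monoid_scheme \<Rightarrow> 'a set \<Rightarrow> 'a set"
  for M and S where
  one: "\<one>\<^bsub>M\<^esub> \<in> submonoid_generated M S"
| incl: "s \<in> S \<Longrightarrow> s \<in> submonoid_generated M S"
| mult: "a \<in> submonoid_generated M S \<Longrightarrow> b \<in> submonoid_generated M S \<Longrightarrow>
    a \<otimes>\<^bsub>M\<^esub> b \<in> submonoid_generated M S"


section \<open>The ring \<open>\<bbbL>\<^sub>r\<close>\<close>

datatype leavitt_gen = GenX nat | GenY nat

type_synonym leavitt = "(leavitt_gen list \<Rightarrow>\<^sub>0 int) set"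

definition leavitt_gens :: "nat \<Rightarrow> leavitt_gen set" where
  "leavitt_gens r = GenX ` {1..r} \<union> GenY ` {1..r}"

definition leavitt_free :: "nat \<Rightarrow> (leavitt_gen list \<Rightarrow>\<^sub>0 int) ring" where
  "leavitt_free r = monoid_ring (free_monoid (leavitt_gens r))"

definition leavitt_relators :: "nat \<Rightarrow> (leavitt_gen list \<Rightarrow>\<^sub>0 int) set" where
  "leavitt_relators r =
     {frag_of [GenX i, GenY j] - (if i = j then frag_of [] else 0) | i j. i \<in> {1..r} \<and> j \<in> {1..r}}
     \<union> {(\<Sum>i\<in>{1..r}. frag_of [GenY i, GenX i]) - frag_of []}"

definition leavitt_ideal :: "nat \<Rightarrow> (leavitt_gen list \<Rightarrow>\<^sub>0 int) set" where
  "leavitt_ideal r = Idl\<^bsub>leavitt_free r\<^esub> (leavitt_relators r)"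

definition leavitt_ring :: "nat \<Rightarrow> leavitt ring" where
  "leavitt_ring r = leavitt_free r Quot leavitt_ideal r"

definition leavitt_x :: "nat \<Rightarrow> nat \<Rightarrow> leavitt" where
  "leavitt_x r i = leavitt_ideal r +>\<^bsub>leavitt_free r\<^esub> frag_of [GenX i]"

definition leavitt_y :: "nat \<Rightarrow> nat \<Rightarrow> leavitt" where
  "leavitt_y r i = leavitt_ideal r +>\<^bsub>leavitt_free r\<^esub> frag_of [GenY i]"

definition leavitt_monomials :: "nat \<Rightarrow> leavitt set" where
  "leavitt_monomials r =
     submonoid_generated (leavitt_ring r) (leavitt_x r ` {1..r} \<union> leavitt_y r ` {1..r})"

fun swap_gen :: "leavitt_gen \<Rightarrow> leavitt_gen" where
  "swap_gen (GenX i) = GenY i"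
| "swap_gen (GenY i) = GenX i"

text \<open>The involution of \<open>\<bbbL>\<^sub>r\<close> is induced by the anti-automorphism of the free ring that reverses
  words and exchanges \<open>x\<^sub>i\<close> with \<open>y\<^sub>i\<close>. The latter permutes the relators, hence preserves the
  ideal, so the image of a coset is again a coset.\<close>

definition leavitt_star :: "leavitt \<Rightarrow> leavitt" where
  "leavitt_star C = frag_extend (\<lambda>w. frag_of (rev (map swap_gen w))) ` C"


section \<open>Tensor powers over \<open>\<int>\<close>\<close>

text \<open>The \<open>t\<close>-th tensor power of a ring \<open>R\<close> is the free abelian group on the \<open>t\<close>-tuples over \<open>R\<close>
  modulo the subgroup generated by the multilinearity relators. (Compatibility with integer
  scalars follows from additivity in each slot.) The factorwise product of tuples makes the free
  abelian group a monoid ring. A relator times a tuple, on either side, is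
  again a relator, so the subgroup is an ideal and \<open>Quot\<close> carries the product
  \<open>(p\<^sub>1 \<otimes> \<dots> \<otimes> p\<^sub>t) (q\<^sub>1 \<otimes> \<dots> \<otimes> q\<^sub>t) = p\<^sub>1 q\<^sub>1 \<otimes> \<dots> \<otimes> p\<^sub>t q\<^sub>t\<close>.\<close>

definition tuple_ring :: "nat \<Rightarrow> ('a, 'b) ring_scheme \<Rightarrow> ((nat \<Rightarrow> 'a) \<Rightarrow>\<^sub>0 int) ring" where
  "tuple_ring t R = monoid_ring (product_group {1..t} (\<lambda>_. R))"

definition multilinear_relators ::
  "nat \<Rightarrow> ('a, 'b) ring_scheme \<Rightarrow> ((nat \<Rightarrow> 'a) \<Rightarrow>\<^sub>0 int) set" where
  "multilinear_relators t R =
     {frag_of (p(l := a \<oplus>\<^bsub>R\<^esub> b)) - frag_of (p(l := a)) - frag_of (p(l := b)) | p l a b.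
        p \<in> {1..t} \<rightarrow>\<^sub>E carrier R \<and> l \<in> {1..t} \<and> a \<in> carrier R \<and> b \<in> carrier R}"

definition tensor_subgroup :: "nat \<Rightarrow> ('a, 'b) ring_scheme \<Rightarrow> ((nat \<Rightarrow> 'a) \<Rightarrow>\<^sub>0 int) set" where
  "tensor_subgroup t R = generate (add_monoid (tuple_ring t R)) (multilinear_relators t R)"

definition tensor_power ::
  "nat \<Rightarrow> ('a, 'b) ring_scheme \<Rightarrow> ((nat \<Rightarrow> 'a) \<Rightarrow>\<^sub>0 int) set ring" where
  "tensor_power t R = tuple_ring t R Quot tensor_subgroup t R"

definition pure_tensor ::
  "nat \<Rightarrow> ('a, 'b) ring_scheme \<Rightarrow> (nat \<Rightarrow> 'a) \<Rightarrow> ((nat \<Rightarrow> 'a) \<Rightarrow>\<^sub>0 int) set" where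
  "pure_tensor t R p =
     tensor_subgroup t R +>\<^bsub>tuple_ring t R\<^esub> frag_of (restrict p {1..t})"

text \<open>The map induced on the tensor power by \<open>p\<^sub>1 \<otimes> \<dots> \<otimes> p\<^sub>t \<mapsto> s p\<^sub>1 \<otimes> \<dots> \<otimes> s p\<^sub>t\<close>; for an additive
  bijection \<open>s\<close> of \<open>R\<close> the image of a coset is a coset.\<close>

definition tensor_map ::
  "nat \<Rightarrow> ('a \<Rightarrow> 'a) \<Rightarrow> ((nat \<Rightarrow> 'a) \<Rightarrow>\<^sub>0 int) set \<Rightarrow> ((nat \<Rightarrow> 'a) \<Rightarrow>\<^sub>0 int) set" where
  "tensor_map t s C = frag_extend (\<lambda>p. frag_of (\<lambda>l\<in>{1..t}. s (p l))) ` C"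


section \<open>Matrices\<close>

text \<open>An \<open>m \<times> m\<close> matrix is an extensional function on \<open>{1..m} \<times> {1..m}\<close>.\<close>

definition matrix_ring :: "nat \<Rightarrow> ('a, 'b) ring_scheme \<Rightarrow> (nat \<times> nat \<Rightarrow> 'a) ring" where
  "matrix_ring m R =
     \<lparr>carrier = {1..m} \<times> {1..m} \<rightarrow>\<^sub>E carrier R,
      mult = (\<lambda>U V. \<lambda>(i, j)\<in>{1..m} \<times> {1..m}. \<Oplus>\<^bsub>R\<^esub>k\<in>{1..m}. U (i, k) \<otimes>\<^bsub>R\<^esub> V (k, j)),
      one = (\<lambda>(i, j)\<in>{1..m} \<times> {1..m}. if i = j then \<one>\<^bsub>R\<^esub> else \<zero>\<^bsub>R\<^esub>),
      ring.zero = (\<lambda>_\<in>{1..m} \<times> {1..m}. \<zero>\<^bsub>R\<^esub>),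
      ring.add = (\<lambda>U V. \<lambda>ij\<in>{1..m} \<times> {1..m}. U ij \<oplus>\<^bsub>R\<^esub> V ij)\<rparr>"

text \<open>\<open>matrix_unit m R i j c\<close> is \<open>e\<^sub>i\<^sub>,\<^sub>j c\<close>.\<close>

definition matrix_unit ::
  "nat \<Rightarrow> ('a, 'b) ring_scheme \<Rightarrow> nat \<Rightarrow> nat \<Rightarrow> 'a \<Rightarrow> (nat \<times> nat \<Rightarrow> 'a)" where
  "matrix_unit m R i j c =
     (\<lambda>(k, l)\<in>{1..m} \<times> {1..m}. if k = i \<and> l = j then c else \<zero>\<^bsub>R\<^esub>)"

definition matrix_scale_right ::
  "nat \<Rightarrow> ('a, 'b) ring_scheme \<Rightarrow> (nat \<times> nat \<Rightarrow> 'a) \<Rightarrow> 'a \<Rightarrow> (nat \<times> nat \<Rightarrow> 'a)" where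
  "matrix_scale_right m R U c = (\<lambda>ij\<in>{1..m} \<times> {1..m}. U ij \<otimes>\<^bsub>R\<^esub> c)"

definition conj_transpose :: "nat \<Rightarrow> ('a \<Rightarrow> 'a) \<Rightarrow> (nat \<times> nat \<Rightarrow> 'a) \<Rightarrow> (nat \<times> nat \<Rightarrow> 'a)" where
  "conj_transpose m s U = (\<lambda>(i, j)\<in>{1..m} \<times> {1..m}. s (U (j, i)))"


section \<open>Positive unitary matrices over \<open>\<bbbL>\<^sub>r\<^sup>\<otimes>\<^sup>t\<close>\<close>

type_synonym leavitt_tensor = "((nat \<Rightarrow> leavitt) \<Rightarrow>\<^sub>0 int) set"
type_synonym leavitt_matrix = "nat \<times> nat \<Rightarrow> leavitt_tensor"

definition leavitt_tensor :: "nat \<Rightarrow> nat \<Rightarrow> leavitt_tensor ring" where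
  "leavitt_tensor r t = tensor_power t (leavitt_ring r)"

definition leavitt_matrices :: "nat \<Rightarrow> nat \<Rightarrow> nat \<Rightarrow> leavitt_matrix ring" where
  "leavitt_matrices r t m = matrix_ring m (leavitt_tensor r t)"

definition leavitt_adjoint :: "nat \<Rightarrow> nat \<Rightarrow> leavitt_matrix \<Rightarrow> leavitt_matrix" where
  "leavitt_adjoint t m = conj_transpose m (tensor_map t leavitt_star)"

definition positive_cone :: "nat \<Rightarrow> nat \<Rightarrow> nat \<Rightarrow> leavitt_matrix set" where
  "positive_cone r t m =
     submonoid_generated (add_monoid (leavitt_matrices r t m))
       {matrix_unit m (leavitt_tensor r t) i j (pure_tensor t (leavitt_ring r) w) | i j w.
          i \<in> {1..m} \<and> j \<in> {1..m} \<and> w \<in> {1..t} \<rightarrow> leavitt_monomials r}"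

definition unitaries :: "nat \<Rightarrow> nat \<Rightarrow> nat \<Rightarrow> leavitt_matrix set" where
  "unitaries r t m =
     {U \<in> carrier (leavitt_matrices r t m).
        U \<otimes>\<^bsub>leavitt_matrices r t m\<^esub> leavitt_adjoint t m U = \<one>\<^bsub>leavitt_matrices r t m\<^esub> \<and>
        leavitt_adjoint t m U \<otimes>\<^bsub>leavitt_matrices r t m\<^esub> U = \<one>\<^bsub>leavitt_matrices r t m\<^esub>}"

definition positive_unitary_group :: "nat \<Rightarrow> nat \<Rightarrow> nat \<Rightarrow> leavitt_matrix monoid" where
  "positive_unitary_group r t m =
     \<lparr>carrier = positive_cone r t m \<inter> unitaries r t m,
      mult = mult (leavitt_matrices r t m),
      one = \<one>\<^bsub>leavitt_matrices r t m\<^esub>\<rparr>"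


section \<open>The Brin-Higman-Thompson group \<open>tV\<^sub>r\<^sub>,\<^sub>m\<close>\<close>

text \<open>\<open>y\<^sub>l\<^sub>,\<^sub>k\<close>, with \<open>y\<^sub>k\<close> in the \<open>l\<close>-th tensor factor.\<close>

definition tensor_y :: "nat \<Rightarrow> nat \<Rightarrow> nat \<Rightarrow> nat \<Rightarrow> leavitt_tensor" where
  "tensor_y r t l k =
     pure_tensor t (leavitt_ring r) (\<lambda>n. if n = l then leavitt_y r k else \<one>\<^bsub>leavitt_ring r\<^esub>)"

definition words_Y :: "nat \<Rightarrow> nat \<Rightarrow> leavitt_tensor set" where
  "words_Y r t = submonoid_generated (leavitt_tensor r t)
     {tensor_y r t l k | l k. l \<in> {1..t} \<and> k \<in> {1..r}}"

definition words_W :: "nat \<Rightarrow> nat \<Rightarrow> nat \<Rightarrow> leavitt_matrix set" where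
  "words_W r t m = {matrix_unit m (leavitt_tensor r t) i 1 w | i w. i \<in> {1..m} \<and> w \<in> words_Y r t}"

definition child :: "nat \<Rightarrow> nat \<Rightarrow> nat \<Rightarrow> nat \<Rightarrow> leavitt_matrix \<Rightarrow> nat \<Rightarrow> leavitt_matrix" where
  "child r t m l a s = matrix_scale_right m (leavitt_tensor r t) a (tensor_y r t l s)"

definition expansion ::
  "nat \<Rightarrow> nat \<Rightarrow> nat \<Rightarrow> nat \<Rightarrow> leavitt_matrix \<Rightarrow> leavitt_matrix set \<Rightarrow> leavitt_matrix set" where
  "expansion r t m l a A = (A - {a}) \<union> child r t m l a ` {1..r}"

definition initial_basis :: "nat \<Rightarrow> nat \<Rightarrow> nat \<Rightarrow> leavitt_matrix set" where
  "initial_basis r t m =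
     (\<lambda>i. matrix_unit m (leavitt_tensor r t) i 1 \<one>\<^bsub>leavitt_tensor r t\<^esub>) ` {1..m}"

definition expansion_closed :: "nat \<Rightarrow> nat \<Rightarrow> nat \<Rightarrow> leavitt_matrix set set \<Rightarrow> bool" where
  "expansion_closed r t m \<BB> \<longleftrightarrow>
     (\<forall>A\<in>\<BB>. \<forall>a\<in>A. \<forall>l\<in>{1..t}. expansion r t m l a A \<in> \<BB>)"

definition bases :: "nat \<Rightarrow> nat \<Rightarrow> nat \<Rightarrow> leavitt_matrix set set" where
  "bases r t m = \<Inter>{\<BB>. \<BB> \<subseteq> {A. finite A \<and> A \<subseteq> words_W r t m} \<and>
     initial_basis r t m \<in> \<BB> \<and> expansion_closed r t m \<BB>}"

text \<open>A bijection between bases is represented by its graph, so that its domain and range are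
  recovered by \<^const>\<open>Domain\<close> and \<^const>\<open>Range\<close>, and the composite "first \<open>\<phi>\<close>, then \<open>\<psi>\<close>" is the
  relational composition \<open>\<phi> O \<psi>\<close>.\<close>

type_synonym basis_bij = "(leavitt_matrix \<times> leavitt_matrix) set"

definition basis_bijections :: "nat \<Rightarrow> nat \<Rightarrow> nat \<Rightarrow> basis_bij set" where
  "basis_bijections r t m =
     {(\<lambda>a. (a, f a)) ` A | f A B. A \<in> bases r t m \<and> B \<in> bases r t m \<and> bij_betw f A B}"

definition expand_bij ::
  "nat \<Rightarrow> nat \<Rightarrow> nat \<Rightarrow> nat \<Rightarrow> leavitt_matrix \<Rightarrow> leavitt_matrix \<Rightarrow> basis_bij \<Rightarrow> basis_bij" where
  "expand_bij r t m l a b \<phi> =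
     (\<phi> - {(a, b)}) \<union> (\<lambda>s. (child r t m l a s, child r t m l b s)) ` {1..r}"

definition expands_to :: "nat \<Rightarrow> nat \<Rightarrow> nat \<Rightarrow> basis_bij \<Rightarrow> basis_bij \<Rightarrow> bool" where
  "expands_to r t m \<phi> \<psi> \<longleftrightarrow> \<phi> \<in> basis_bijections r t m \<and>
     (\<exists>(a, b)\<in>\<phi>. \<exists>l\<in>{1..t}. \<psi> = expand_bij r t m l a b \<phi>)"

definition expansion_equiv :: "nat \<Rightarrow> nat \<Rightarrow> nat \<Rightarrow> (basis_bij \<times> basis_bij) set" where
  "expansion_equiv r t m = {(\<phi>, \<psi>). equivclp (expands_to r t m) \<phi> \<psi>}"

text \<open>The product of two classes collects the classes of all composites of composable
  representatives; these classes all coincide.\<close>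

definition brin_higman_thompson_group :: "nat \<Rightarrow> nat \<Rightarrow> nat \<Rightarrow> basis_bij set monoid" where
  "brin_higman_thompson_group r t m =
     \<lparr>carrier = basis_bijections r t m // expansion_equiv r t m,
      mult = (\<lambda>C D. \<Union>\<phi>\<in>C. \<Union>\<psi>\<in>{\<psi>\<in>D. Range \<phi> = Domain \<psi>}.
        expansion_equiv r t m `` {\<phi> O \<psi>}),
      one = expansion_equiv r t m `` {Id_on (initial_basis r t m)}\<rparr>"

end

theory Submission
  imports Defs
begin

text \<open>Write \<open>U \<mapsto> U\<^sup>*\<close> for the conjugate transpose. Elements of a basis \<open>A\<close> satisfy
  \<open>a\<^sup>* b = \<delta>\<^sub>a\<^sub>,\<^sub>b e\<^sub>1\<^sub>,\<^sub>1\<close> and \<open>\<Sum>a\<in>A. a a\<^sup>* = 1\<close>; call a finite set of words with these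
  properties a frame. A bijection \<open>\<phi> : A \<rightarrow> B\<close> of bases is sent to the matrix
  \<open>\<Theta>(\<phi>) = \<Sum>a\<in>A. a (a\<^sup>\<phi>)\<^sup>*\<close>, which is positive, unitary, multiplicative in \<open>\<phi>\<close> and unchanged by
  expansions. The words of length \<open>N\<close> in every coordinate form a basis, every frame can be expanded
  to it once \<open>N\<close> is large, and \<open>\<phi>\<close> can be read off from \<open>a\<^sup>* \<Theta>(\<phi>) = (a\<^sup>\<phi>)\<^sup>*\<close>; hence
  \<open>\<Theta>(\<phi>) = \<Theta>(\<psi>)\<close> exactly when \<open>\<phi>\<close> and \<open>\<psi>\<close> are equivalent.

  For surjectivity, expand a positive unitary as a sum of terms \<open>a c\<^sup>*\<close> with \<open>c\<close> in such a basis
  \<open>C\<close>. Then \<open>U c\<close> is a sum of words with \<open>(U c)\<^sup>* (U c) = e\<^sub>1\<^sub>,\<^sub>1\<close>. An additive functional that is \<open>1\<close> at \<open>1\<close>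
  and non-negative on monomials, obtained from the action of \<open>\<bbbL>\<^sub>r\<close> on base \<open>r\<close> expansions, shows
  that the sum has one term. So \<open>U\<close> comes from a bijection from a frame onto \<open>C\<close>, and expanding it
  turns the frame into a basis.\<close>


section \<open>Monoid rings\<close>

text \<open>The rings are iterated quotients, so nothing is known at the start about which elements
  differ, not even whether 1 is nonzero. No faithful model of the tensor power is built. All
  separation comes from one integer functional: in the representation of the Leavitt ring on the
  integer span of the naturals, the coefficient at the point 0 is 0 or 1 on words and 1 at the unit.
  Additivity in each slot is enough for a product of such functionals to descend to the tensor
  power. It gives \<open>e \<noteq> 0\<close>, and orthogonality relations then distinguish words,
  so the freeness of the monoid Y is never established.

  Two further points shape the argument. Expansions are unions of sets of matrices, where a child
  could coincide with an old element; the orthogonality in a frame excludes this, and a frame is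
  also what the image of a basis under a positive unitary is first seen to be. Common refinements
  are not sought by confluence: at a uniform level orthogonality and completeness leave room for one
  frame only, so any chain of expansions that reaches the level ends in the same set.\<close>

lemma frag_extend_fun_add:
  "frag_extend (\<lambda>a. f a + g a) c = frag_extend f c + frag_extend g c"
  by (simp add: frag_extend_def frag_cmul_distrib2 sum.distrib)

lemma frag_extend_fun_zero [simp]: "frag_extend (\<lambda>a. 0) c = 0"
  by (simp add: frag_extend_def)

text \<open>Carrying the support condition through the induction lets the difference case assume
  that both parts lie over \<open>S\<close>.\<close>

lemma frag_induct [consumes 1, case_names of diff]:
  assumes "Poly_Mapping.keys c \<subseteq> S" "\<And>x. x \<in> S \<Longrightarrow> P (frag_of x)"
    "\<And>a b. Poly_Mapping.keys a \<subseteq> S \<Longrightarrow> Poly_Mapping.keys b \<subseteq> S \<Longrightarrow> P a \<Longrightarrow> P b \<Longrightarrow> P (a - b)"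
    "P 0"
  shows "P c"
proof -
  have "Poly_Mapping.keys c \<subseteq> S \<and> P c"
    using assms(1)
  proof (induction c rule: frag_induction)
    case (diff a b)
    then show ?case
      using assms(3) keys_diff[of a b] by blast
  qed (use assms in auto)
  then show ?thesis ..
qed

text \<open>The free abelian group on the one point \<open>()\<close> stands in for the integers, so
  additivity comes from the laws of \<open>frag_extend\<close>.\<close>

definition frag_eval :: "('a \<Rightarrow> int) \<Rightarrow> ('a \<Rightarrow>\<^sub>0 int) \<Rightarrow> int" where
  "frag_eval g c = poly_mapping.lookup (frag_extend (\<lambda>k. frag_cmul (g k) (frag_of ())) c) ()"

lemma frag_eval_simps [simp]:
  "frag_eval g (frag_of a) = g a" "frag_eval g 0 = 0"
  "frag_eval g (c + d) = frag_eval g c + frag_eval g d"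
  "frag_eval g (c - d) = frag_eval g c - frag_eval g d"
  by (simp_all add: frag_eval_def frag_extend_add frag_extend_diff lookup_add lookup_minus)

lemma frag_eval_sum: "frag_eval g (\<Sum>i\<in>I. c i) = (\<Sum>i\<in>I. frag_eval g (c i))"
  by (induction I rule: infinite_finite_induct) auto

text \<open>The value at an arbitrary representative; it is meaningful when the extension of
  \<open>g\<close> vanishes on the ideal, as \<open>coset_eval_eq\<close> demands.\<close>

definition coset_eval :: "('a \<Rightarrow> int) \<Rightarrow> ('a \<Rightarrow>\<^sub>0 int) set \<Rightarrow> int" where
  "coset_eval g C = frag_eval g (SOME c. c \<in> C)"

locale monoid_algebra = M: monoid M for M :: "('a, 'b) monoid_scheme" (structure)
begin

abbreviation "\<A> \<equiv> monoid_ring M"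

lemma carrier_iff: "c \<in> carrier \<A> \<longleftrightarrow> Poly_Mapping.keys c \<subseteq> carrier M"
  by (simp add: monoid_ring_def free_Abelian_group_def)

lemma zero_eq [simp]: "\<zero>\<^bsub>\<A>\<^esub> = 0" and add_eq [simp]: "a \<oplus>\<^bsub>\<A>\<^esub> b = a + b"
  and one_eq [simp]: "\<one>\<^bsub>\<A>\<^esub> = frag_of \<one>"
  by (simp_all add: monoid_ring_def)

lemma of_closed [simp]: "frag_of a \<in> carrier \<A> \<longleftrightarrow> a \<in> carrier M"
  by (simp add: carrier_iff)

lemma diff_closed [simp]: "a \<in> carrier \<A> \<Longrightarrow> b \<in> carrier \<A> \<Longrightarrow> a - b \<in> carrier \<A>"
  using keys_diff[of a b] by (auto simp: carrier_iff)

lemma plus_closed [simp]: "a \<in> carrier \<A> \<Longrightarrow> b \<in> carrier \<A> \<Longrightarrow> a + b \<in> carrier \<A>"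
  using Poly_Mapping.keys_add[of a b] by (auto simp: carrier_iff)

lemma null_closed [simp]: "0 \<in> carrier \<A>"
  by (simp add: carrier_iff)

lemma sum_closed: "(\<And>i. i \<in> I \<Longrightarrow> f i \<in> carrier \<A>) \<Longrightarrow> (\<Sum>i\<in>I. f i) \<in> carrier \<A>"
  by (induction I rule: infinite_finite_induct) auto

lemma mult_of [simp]: "frag_of a \<otimes>\<^bsub>\<A>\<^esub> frag_of b = frag_of (a \<otimes> b)"
  by (simp add: monoid_ring_def)

lemma mult_bilinear:
  "(a + b) \<otimes>\<^bsub>\<A>\<^esub> c = a \<otimes>\<^bsub>\<A>\<^esub> c + b \<otimes>\<^bsub>\<A>\<^esub> c" "c \<otimes>\<^bsub>\<A>\<^esub> (a + b) = c \<otimes>\<^bsub>\<A>\<^esub> a + c \<otimes>\<^bsub>\<A>\<^esub> b"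
  "0 \<otimes>\<^bsub>\<A>\<^esub> c = 0" "c \<otimes>\<^bsub>\<A>\<^esub> 0 = 0"
  by (simp_all add: monoid_ring_def frag_extend_add frag_extend_fun_add)

lemma mult_bilinear_diff:
  "(a - b) \<otimes>\<^bsub>\<A>\<^esub> c = a \<otimes>\<^bsub>\<A>\<^esub> c - b \<otimes>\<^bsub>\<A>\<^esub> c" "c \<otimes>\<^bsub>\<A>\<^esub> (a - b) = c \<otimes>\<^bsub>\<A>\<^esub> a - c \<otimes>\<^bsub>\<A>\<^esub> b"
  using mult_bilinear(1)[of "a - b" b c] mult_bilinear(2)[of c "a - b" b] by auto

lemma mult_sum:
  "(\<Sum>i\<in>I. f i) \<otimes>\<^bsub>\<A>\<^esub> c = (\<Sum>i\<in>I. f i \<otimes>\<^bsub>\<A>\<^esub> c)" "c \<otimes>\<^bsub>\<A>\<^esub> (\<Sum>i\<in>I. f i) = (\<Sum>i\<in>I. c \<otimes>\<^bsub>\<A>\<^esub> f i)"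
  by (induction I rule: infinite_finite_induct) (auto simp: mult_bilinear)

lemma carrier_induct [consumes 1, case_names of diff zero]:
  assumes "c \<in> carrier \<A>" "\<And>x. x \<in> carrier M \<Longrightarrow> P (frag_of x)"
    "\<And>a b. a \<in> carrier \<A> \<Longrightarrow> b \<in> carrier \<A> \<Longrightarrow> P a \<Longrightarrow> P b \<Longrightarrow> P (a - b)"
    "P 0"
  shows "P c"
  using assms(1)[unfolded carrier_iff]
  by (rule frag_induct) (use assms in \<open>auto simp: carrier_iff\<close>)

lemma mult_closed:
  assumes "a \<in> carrier \<A>" "b \<in> carrier \<A>" shows "a \<otimes>\<^bsub>\<A>\<^esub> b \<in> carrier \<A>"
  using assms(1)
proof (induction rule: carrier_induct)
  case (of x)
  show ?case
    using assms(2) by (induction rule: carrier_induct) (use of in \<open>auto simp: mult_bilinear mult_bilinear_diff\<close>)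
qed (auto simp: mult_bilinear mult_bilinear_diff)

lemma mult_assoc:
  assumes "a \<in> carrier \<A>" "b \<in> carrier \<A>" "c \<in> carrier \<A>"
  shows "a \<otimes>\<^bsub>\<A>\<^esub> b \<otimes>\<^bsub>\<A>\<^esub> c = a \<otimes>\<^bsub>\<A>\<^esub> (b \<otimes>\<^bsub>\<A>\<^esub> c)"
  using assms(1)
proof (induction rule: carrier_induct)
  case x: (of x)
  show ?case
    using assms(2)
  proof (induction rule: carrier_induct)
    case y: (of y)
    show ?case
      using assms(3)
      by (induction rule: carrier_induct)
        (use x y in \<open>auto simp: mult_bilinear mult_bilinear_diff M.m_assoc\<close>)
  qed (auto simp: mult_bilinear mult_bilinear_diff)
qed (auto simp: mult_bilinear mult_bilinear_diff)

lemma mult_one: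
  assumes "a \<in> carrier \<A>"
  shows "frag_of \<one> \<otimes>\<^bsub>\<A>\<^esub> a = a" "a \<otimes>\<^bsub>\<A>\<^esub> frag_of \<one> = a"
  using assms by (induction rule: carrier_induct) (auto simp: mult_bilinear mult_bilinear_diff)

sublocale ring \<A>
proof (rule ringI)
  show "abelian_group \<A>"
  proof (rule abelian_groupI)
    fix x assume "x \<in> carrier \<A>"
    \<comment> \<open>The inverse is kept as the difference \<open>0 - x\<close>, since closure is
      known for differences.\<close>
    then show "\<exists>y\<in>carrier \<A>. y \<oplus>\<^bsub>\<A>\<^esub> x = \<zero>\<^bsub>\<A>\<^esub>"
      by (intro bexI[of _ "0 - x"]) (auto simp del: diff_0)
  qed (auto simp: add.assoc add.commute)
  show "monoid \<A>"
    by (rule monoidI) (auto simp: mult_closed mult_assoc mult_one)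
qed (auto simp: mult_bilinear)

lemma minus_eq_uminus [simp]: "x \<in> carrier \<A> \<Longrightarrow> \<ominus>\<^bsub>\<A>\<^esub> x = - x"
  by (rule minus_equality) (auto simp: carrier_iff)

lemma rcos_eq: "I +>\<^bsub>\<A>\<^esub> x = (\<lambda>h. h + x) ` I"
  by (auto simp: a_r_coset_def r_coset_def)

end

section \<open>Quotients of monoid rings by ideals\<close>

locale monoid_algebra_quotient = monoid_algebra M + ideal I "monoid_ring M"
  for M :: "('a, 'b) monoid_scheme" (structure) and I
begin

abbreviation "\<Q> \<equiv> \<A> Quot I"
abbreviation "cs x \<equiv> I +>\<^bsub>\<A>\<^esub> x"

lemma Q_ring: "ring \<Q>"
  by (rule quotient_is_ring)

lemma cs_closed: "x \<in> carrier \<A> \<Longrightarrow> cs x \<in> carrier \<Q>"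
  using rcos_ring_hom by (rule ring_hom_closed)

lemma cs_add: "x \<in> carrier \<A> \<Longrightarrow> y \<in> carrier \<A> \<Longrightarrow> cs (x + y) = cs x \<oplus>\<^bsub>\<Q>\<^esub> cs y"
  using ring_hom_add[OF rcos_ring_hom, of x y] by simp

lemma cs_mult: "x \<in> carrier \<A> \<Longrightarrow> y \<in> carrier \<A> \<Longrightarrow> cs (x \<otimes>\<^bsub>\<A>\<^esub> y) = cs x \<otimes>\<^bsub>\<Q>\<^esub> cs y"
  using ring_hom_mult[OF rcos_ring_hom, of x y] by simp

lemma cs_one: "\<one>\<^bsub>\<Q>\<^esub> = cs (frag_of \<one>)"
  using ring_hom_one[OF rcos_ring_hom] by simp

lemma cs_zero: "\<zero>\<^bsub>\<Q>\<^esub> = cs 0"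
  by (simp add: rcos_eq FactRing_def)

lemma cs_eqI:
  assumes "x - y \<in> I" "y \<in> carrier \<A>" shows "cs x = cs y"
proof -
  have "x = (x - y) + y" by simp
  moreover have "cs (x - y) = I" using assms by (intro a_rcos_zero is_ideal)
  ultimately have "cs x = cs (x - y) \<oplus>\<^bsub>\<Q>\<^esub> cs y"
    using cs_add[of "x - y" y] assms a_Hcarr by metis
  also have "cs (x - y) = \<zero>\<^bsub>\<Q>\<^esub>"
    using \<open>cs (x - y) = I\<close> by (simp add: FactRing_def)
  finally show ?thesis
    using cs_closed[OF assms(2)] Q_ring by (simp add: ring.ring_simprules)
qed

lemma cs_cases:
  assumes "C \<in> carrier \<Q>" obtains x where "x \<in> carrier \<A>" "C = cs x"
  using assms by (auto simp: FactRing_def A_RCOSETS_def')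

lemma cs_sum:
  assumes "\<And>i. i \<in> J \<Longrightarrow> f i \<in> carrier \<A>"
  shows "cs (\<Sum>i\<in>J. f i) = finsum \<Q> (\<lambda>i. cs (f i)) J"
proof -
  interpret Q: ring \<Q> by (rule Q_ring)
  show ?thesis using assms
  proof (induction J rule: infinite_finite_induct)
    case (insert j J)
    then have "finsum \<Q> (\<lambda>i. cs (f i)) (insert j J) = cs (f j) \<oplus>\<^bsub>\<Q>\<^esub> finsum \<Q> (\<lambda>i. cs (f i)) J"
      by (intro Q.finsum_insert) (auto intro: cs_closed)
    then show ?case using insert by (simp add: cs_add sum_closed)
  qed (auto simp: cs_zero)
qed

lemma coset_eval_eq:
  assumes "\<And>h. h \<in> I \<Longrightarrow> frag_eval g h = 0" "x \<in> carrier \<A>"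
  shows "coset_eval g (cs x) = frag_eval g x"
proof -
  have "x \<in> cs x" using assms(2) by (rule a_rcos_self)
  then have "(SOME c. c \<in> cs x) \<in> cs x" by (rule someI)
  then show ?thesis
    using assms(1) by (auto simp: coset_eval_def rcos_eq)
qed

text \<open>Justifies defining involutions as images of cosets: \<open>leavitt_star\<close> and
  \<open>tensor_map\<close> thereby act through representatives.\<close>

lemma image_cs:
  assumes "\<And>a b. f (a + b) = f a + f b" "f ` I = I"
  shows "f ` cs x = cs (f x)"
proof -
  have "f ` cs x = (\<lambda>h. h + f x) ` (f ` I)"
    by (simp add: rcos_eq image_image assms(1))
  then show ?thesis by (simp only: assms(2) rcos_eq)
qed

end


section \<open>The ring \<open>\<bbbL>\<^sub>r\<close>\<close>

definition star_word :: "leavitt_gen list \<Rightarrow> leavitt_gen list" where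
  "star_word w = rev (map swap_gen w)"

lemma swap_swap [simp]: "swap_gen (swap_gen g) = g"
  by (cases g) auto

lemma star_word_simps [simp]:
  "star_word [] = []" "star_word (u @ v) = star_word v @ star_word u"
  "star_word (star_word u) = u" "star_word (g # u) = star_word u @ [swap_gen g]"
  by (simp_all add: star_word_def rev_map comp_def)

definition star_free :: "(leavitt_gen list \<Rightarrow>\<^sub>0 int) \<Rightarrow> leavitt_gen list \<Rightarrow>\<^sub>0 int" where
  "star_free = frag_extend (\<lambda>w. frag_of (star_word w))"

lemma star_free_simps [simp]:
  "star_free 0 = 0" "star_free (frag_of w) = frag_of (star_word w)"
  "star_free (a + b) = star_free a + star_free b" "star_free (a - b) = star_free a - star_free b"
  by (simp_all add: star_free_def frag_extend_add frag_extend_diff)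

lemma star_free_sum: "star_free (\<Sum>i\<in>I. f i) = (\<Sum>i\<in>I. star_free (f i))"
  by (induction I rule: infinite_finite_induct) auto

text \<open>The generators act on \<open>\<nat>\<close>, written in base \<open>r\<close>: \<open>y\<^sub>k\<close> appends the digit \<open>k - 1\<close>, and \<open>x\<^sub>k\<close>
  is its partial inverse.\<close>

fun gen_act :: "nat \<Rightarrow> leavitt_gen \<Rightarrow> nat \<Rightarrow> nat option" where
  "gen_act r (GenY k) n = Some (r * n + (k - 1))"
| "gen_act r (GenX k) n = (if n mod r = k - 1 then Some (n div r) else None)"

text \<open>Letters act as operators, so the rightmost one acts first; \<open>None\<close> plays the
  part of the zero vector.\<close>

definition word_act :: "nat \<Rightarrow> leavitt_gen list \<Rightarrow> nat option \<Rightarrow> nat option" where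
  "word_act r w a = foldr (\<lambda>g a. Option.bind a (gen_act r g)) w a"

lemma word_act_simps [simp]:
  "word_act r [] a = a" "word_act r (g # w) a = Option.bind (word_act r w a) (gen_act r g)"
  "word_act r (u @ v) a = word_act r u (word_act r v a)"
  by (simp_all add: word_act_def)

lemma word_act_None [simp]: "word_act r w None = None"
  by (induction w) auto

text \<open>The diagonal matrix coefficient, at the basis vector 0, of the representation on the
  span of the naturals. The point 0 is an arbitrary choice; what counts is that the values are 0 or
  1, with 1 on the empty word.\<close>

definition word_weight :: "nat \<Rightarrow> leavitt_gen list \<Rightarrow> int" where
  "word_weight r w = (if word_act r w (Some 0) = Some 0 then 1 else 0)"

definition leavitt_weight :: "nat \<Rightarrow> leavitt \<Rightarrow> int" where
  "leavitt_weight r = coset_eval (word_weight r)"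

locale leavitt_algebra =
  fixes r :: nat
  assumes r_pos: "1 \<le> r"
begin

abbreviation "gens \<equiv> leavitt_gens r"
abbreviation "FM \<equiv> free_monoid gens"
abbreviation "L \<equiv> leavitt_ring r"

sublocale F: monoid_algebra FM
  unfolding monoid_algebra_def
  by (rule monoidI) (auto simp: free_monoid_def)

lemma FM_simps [simp]: "carrier FM = lists gens" "u \<otimes>\<^bsub>FM\<^esub> v = u @ v" "\<one>\<^bsub>FM\<^esub> = []"
  by (simp_all add: free_monoid_def)

lemma gens_simps [simp]: "GenX i \<in> gens \<longleftrightarrow> i \<in> {1..r}" "GenY i \<in> gens \<longleftrightarrow> i \<in> {1..r}"
  by (auto simp: leavitt_gens_def)

lemma swap_gen_in [simp]: "swap_gen g \<in> gens \<longleftrightarrow> g \<in> gens"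
  by (cases g) auto

lemma star_word_in [simp]: "star_word w \<in> lists gens \<longleftrightarrow> w \<in> lists gens"
  by (induction w) auto

lemma relators_closed: "leavitt_relators r \<subseteq> carrier F.\<A>"
  by (auto simp: leavitt_relators_def intro!: F.diff_closed F.sum_closed)

sublocale FQ: monoid_algebra_quotient FM "leavitt_ideal r"
  unfolding monoid_algebra_quotient_def
proof (intro conjI F.monoid_algebra_axioms)
  show "ideal (leavitt_ideal r) F.\<A>"
    unfolding leavitt_ideal_def leavitt_free_def
    by (rule F.genideal_ideal[OF relators_closed])
qed

lemma L_eq: "L = FQ.\<Q>"
  by (simp add: leavitt_ring_def leavitt_free_def)

lemma leavitt_ideal_minimal:
  "ideal J F.\<A> \<Longrightarrow> leavitt_relators r \<subseteq> J \<Longrightarrow> leavitt_ideal r \<subseteq> J"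
  unfolding leavitt_ideal_def leavitt_free_def by (rule F.genideal_minimal)

lemma relators_in: "leavitt_relators r \<subseteq> leavitt_ideal r"
  unfolding leavitt_ideal_def leavitt_free_def by (rule F.genideal_self[OF relators_closed])

definition wd :: "leavitt_gen list \<Rightarrow> leavitt" where
  "wd w = leavitt_ideal r +>\<^bsub>F.\<A>\<^esub> frag_of w"

sublocale L: ring L
  unfolding L_eq by (rule FQ.Q_ring)

lemma wd_closed [simp]: "w \<in> lists gens \<Longrightarrow> wd w \<in> carrier L"
  unfolding wd_def L_eq by (rule FQ.cs_closed) simp

lemma wd_append: "u \<in> lists gens \<Longrightarrow> v \<in> lists gens \<Longrightarrow> wd (u @ v) = wd u \<otimes>\<^bsub>L\<^esub> wd v"
  unfolding wd_def L_eq using FQ.cs_mult[of "frag_of u" "frag_of v"] by simp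

lemma wd_Nil: "wd [] = \<one>\<^bsub>L\<^esub>"
  unfolding wd_def L_eq by (simp add: FQ.cs_one)

lemma leavitt_x_eq: "leavitt_x r i = wd [GenX i]" and leavitt_y_eq: "leavitt_y r i = wd [GenY i]"
  by (simp_all add: leavitt_x_def leavitt_y_def wd_def leavitt_free_def)

lemma wd_xy:
  assumes "i \<in> {1..r}" "j \<in> {1..r}"
  shows "wd [GenX i] \<otimes>\<^bsub>L\<^esub> wd [GenY j] = (if i = j then \<one>\<^bsub>L\<^esub> else \<zero>\<^bsub>L\<^esub>)"
proof -
  have "wd [GenX i] \<otimes>\<^bsub>L\<^esub> wd [GenY j] = wd [GenX i, GenY j]"
    using wd_append[of "[GenX i]" "[GenY j]"] assms by simp
  also have "\<dots> = FQ.cs (if i = j then frag_of [] else 0)"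
    unfolding wd_def
  proof (rule FQ.cs_eqI)
    show "frag_of [GenX i, GenY j] - (if i = j then frag_of [] else 0) \<in> leavitt_ideal r"
      using assms by (intro subsetD[OF relators_in]) (auto simp: leavitt_relators_def)
  qed simp
  also have "\<dots> = (if i = j then \<one>\<^bsub>L\<^esub> else \<zero>\<^bsub>L\<^esub>)"
    by (simp add: L_eq FQ.cs_one FQ.cs_zero)
  finally show ?thesis .
qed

lemma wd_yx_sum: "(\<Oplus>\<^bsub>L\<^esub>i\<in>{1..r}. wd [GenY i] \<otimes>\<^bsub>L\<^esub> wd [GenX i]) = \<one>\<^bsub>L\<^esub>"
proof -
  have "(\<Oplus>\<^bsub>L\<^esub>i\<in>{1..r}. wd [GenY i] \<otimes>\<^bsub>L\<^esub> wd [GenX i]) = (\<Oplus>\<^bsub>L\<^esub>i\<in>{1..r}. wd [GenY i, GenX i])"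
  proof (rule L.finsum_cong')
    fix i assume "i \<in> {1..r}"
    then show "wd [GenY i] \<otimes>\<^bsub>L\<^esub> wd [GenX i] = wd [GenY i, GenX i]"
      using wd_append[of "[GenY i]" "[GenX i]"] by simp
  qed auto
  also have "\<dots> = FQ.cs (\<Sum>i\<in>{1..r}. frag_of [GenY i, GenX i])"
    unfolding wd_def L_eq by (rule FQ.cs_sum[symmetric]) auto
  also have "\<dots> = FQ.cs (frag_of [])"
    by (rule FQ.cs_eqI) (auto simp: leavitt_relators_def intro: subsetD[OF relators_in])
  finally show ?thesis by (simp add: L_eq FQ.cs_one)
qed

section \<open>The involution on cosets\<close>

lemma star_free_closed: "c \<in> carrier F.\<A> \<Longrightarrow> star_free c \<in> carrier F.\<A>"
  by (induction rule: F.carrier_induct) auto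

lemma star_free_star: "c \<in> carrier F.\<A> \<Longrightarrow> star_free (star_free c) = c"
  by (induction rule: F.carrier_induct) auto

lemma star_free_mult:
  assumes "a \<in> carrier F.\<A>" "b \<in> carrier F.\<A>"
  shows "star_free (a \<otimes>\<^bsub>F.\<A>\<^esub> b) = star_free b \<otimes>\<^bsub>F.\<A>\<^esub> star_free a"
  using assms(1)
proof (induction rule: F.carrier_induct)
  case (of u)
  show ?case
    using assms(2)
    by (induction rule: F.carrier_induct) (use of in \<open>auto simp: F.mult_bilinear F.mult_bilinear_diff\<close>)
qed (auto simp: F.mult_bilinear F.mult_bilinear_diff)

text \<open>The elements with image in the ideal form an ideal, and it contains the relators because
  the involution permutes them: \<open>x_i y_j\<close> goes to \<open>x_j y_i\<close>, and each
  \<open>y_i x_i\<close> is fixed. Minimality gives one inclusion, applying the involution twice the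
  other.\<close>

lemma star_free_ideal: "star_free ` leavitt_ideal r = leavitt_ideal r"
proof -
  let ?J = "{c \<in> carrier F.\<A>. star_free c \<in> leavitt_ideal r}"
  have zero: "0 \<in> leavitt_ideal r" using FQ.zero_closed by simp
  have minus: "a \<in> leavitt_ideal r \<Longrightarrow> - a \<in> leavitt_ideal r" for a
    using FQ.a_inv_closed[of a] FQ.a_Hcarr[of a] by simp
  have add: "a \<in> leavitt_ideal r \<Longrightarrow> b \<in> leavitt_ideal r \<Longrightarrow> a + b \<in> leavitt_ideal r" for a b
    using FQ.a_closed[of a b] by simp
  have "ideal ?J F.\<A>"
  proof (rule idealI)
    show "subgroup ?J (add_monoid F.\<A>)"
    proof (rule F.add.subgroupI)
      show "?J \<noteq> {}" using zero by (auto intro: exI[of _ 0])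
      show "\<ominus>\<^bsub>F.\<A>\<^esub> a \<in> ?J" if "a \<in> ?J" for a
        using that F.a_inv_closed[of a] minus[of "star_free a"] star_free_simps(4)[of 0 a] by simp
    qed (use add in auto)
  qed (auto simp: F.ring_axioms star_free_mult star_free_closed FQ.I_l_closed FQ.I_r_closed)
  moreover have "leavitt_relators r \<subseteq> ?J"
  proof
    fix c assume c: "c \<in> leavitt_relators r"
    then consider i j where "i \<in> {1..r}" "j \<in> {1..r}"
        "c = frag_of [GenX i, GenY j] - (if i = j then frag_of [] else 0)"
      | "c = (\<Sum>i\<in>{1..r}. frag_of [GenY i, GenX i]) - frag_of []"
      unfolding leavitt_relators_def by blast
    then have "star_free c \<in> leavitt_relators r"
    proof cases
      case 1
      then have "star_free c = frag_of [GenX j, GenY i] - (if j = i then frag_of [] else 0)"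
        by simp
      then show ?thesis using 1 unfolding leavitt_relators_def by blast
    qed (simp add: leavitt_relators_def star_free_sum)
    then show "c \<in> ?J" using c relators_closed relators_in by blast
  qed
  ultimately have sub: "leavitt_ideal r \<subseteq> ?J" by (rule leavitt_ideal_minimal)
  then have "star_free ` leavitt_ideal r \<subseteq> leavitt_ideal r" by auto
  moreover have "leavitt_ideal r \<subseteq> star_free ` leavitt_ideal r"
  proof
    fix c assume "c \<in> leavitt_ideal r"
    then show "c \<in> star_free ` leavitt_ideal r"
      using sub star_free_star by (intro image_eqI[of _ _ "star_free c"]) auto
  qed
  ultimately show ?thesis ..
qed

lemma leavitt_star_cs: "leavitt_star (FQ.cs c) = FQ.cs (star_free c)"
proof -
  have "leavitt_star C = star_free ` C" for C
    by (simp add: leavitt_star_def star_free_def star_word_def)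
  then show ?thesis
    using FQ.image_cs[of star_free c] star_free_ideal by simp
qed

lemma leavitt_star_wd: "leavitt_star (wd w) = wd (star_word w)"
  by (simp add: wd_def leavitt_star_cs)

lemma leavitt_star_closed: "a \<in> carrier L \<Longrightarrow> leavitt_star a \<in> carrier L"
  unfolding L_eq
  by (erule FQ.cs_cases) (auto simp: leavitt_star_cs intro!: FQ.cs_closed star_free_closed)

lemma leavitt_star_star: "a \<in> carrier L \<Longrightarrow> leavitt_star (leavitt_star a) = a"
  unfolding L_eq by (erule FQ.cs_cases) (simp add: leavitt_star_cs star_free_star)

lemma leavitt_star_add:
  assumes "a \<in> carrier L" "b \<in> carrier L"
  shows "leavitt_star (a \<oplus>\<^bsub>L\<^esub> b) = leavitt_star a \<oplus>\<^bsub>L\<^esub> leavitt_star b"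
  using assms unfolding L_eq
  by (elim FQ.cs_cases)
    (auto simp: FQ.cs_add[symmetric] leavitt_star_cs star_free_closed)

section \<open>A functional that is non-negative on monomials\<close>

lemma word_weight_nonneg: "0 \<le> word_weight r w"
  by (simp add: word_weight_def)

text \<open>Appending a digit below \<open>r\<close> and splitting off the last digit again returns
  that digit and the old number.\<close>

lemma word_weight_xy:
  assumes "i \<in> {1..r}" "j \<in> {1..r}"
  shows "word_weight r (u @ GenX i # GenY j # v) = (if i = j then word_weight r (u @ v) else 0)"
proof (cases "word_act r v (Some 0)")
  case (Some n)
  have "j - 1 < r" using assms by auto
  then have "(r * n + (j - 1)) mod r = j - 1" "(r * n + (j - 1)) div r = n"
    by (simp_all del: One_nat_def Nat.add_diff_assoc)
  \<comment> \<open>Truncated subtraction loses nothing because indices start at 1.\<close>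
  moreover have "j - 1 = i - 1 \<longleftrightarrow> i = j"
    using assms by auto
  ultimately show ?thesis
    using Some by (simp add: word_weight_def)
qed (simp add: word_weight_def)

text \<open>Exactly one \<open>x_i\<close> is defined at a given number, the one matching its last
  digit, and \<open>y_i\<close> then restores that digit.\<close>

lemma word_weight_yx:
  "(\<Sum>i\<in>{1..r}. word_weight r (u @ GenY i # GenX i # v)) = word_weight r (u @ v)"
proof (cases "word_act r v (Some 0)")
  case (Some n)
  \<comment> \<open>Generators are numbered from 1, digits from 0.\<close>
  define k where "k = n mod r + 1"
  have k: "k \<in> {1..r}" using r_pos by (simp add: k_def Suc_le_eq)
  have "word_weight r (u @ GenY i # GenX i # v) = (if i = k then word_weight r (u @ v) else 0)"
    if "i \<in> {1..r}" for i
    using that Some by (auto simp: word_weight_def k_def)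
  then show ?thesis using k by simp
qed (simp add: word_weight_def)

text \<open>The kernel of the functional need not be an ideal. Asking that the value vanish in every
  two-sided context of words makes it one: a further factor is absorbed into the context. The
  relators lie in this ideal since the two previous lemmas allow arbitrary \<open>u\<close> and
  \<open>v\<close>.\<close>

lemma word_weight_ideal:
  assumes "c \<in> leavitt_ideal r" shows "frag_eval (word_weight r) c = 0"
proof -
  let ?e = "frag_eval (word_weight r)"
  let ?J = "{c \<in> carrier F.\<A>. \<forall>u\<in>lists gens. \<forall>v\<in>lists gens.
    ?e (frag_of u \<otimes>\<^bsub>F.\<A>\<^esub> c \<otimes>\<^bsub>F.\<A>\<^esub> frag_of v) = 0}"
  have "ideal ?J F.\<A>"
  proof (rule idealI)
    show "subgroup ?J (add_monoid F.\<A>)"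
    proof (rule F.add.subgroupI)
      show "?J \<noteq> {}" by (auto intro!: exI[of _ 0] simp: F.mult_bilinear)
      show "\<ominus>\<^bsub>F.\<A>\<^esub> a \<in> ?J" if "a \<in> ?J" for a
      proof -
        have "\<ominus>\<^bsub>F.\<A>\<^esub> a = 0 - a" using that by simp
        moreover have "0 - a \<in> carrier F.\<A>"
          using that by (intro F.diff_closed) auto
        ultimately show ?thesis
          using that by (simp only: F.mult_bilinear F.mult_bilinear_diff frag_eval_simps mem_Collect_eq) simp
      qed
    qed (auto simp: F.mult_bilinear)
  next
    fix a x assume a: "a \<in> ?J" and x: "x \<in> carrier F.\<A>"
    show "x \<otimes>\<^bsub>F.\<A>\<^esub> a \<in> ?J"
    proof (intro CollectI conjI ballI)
      fix u v assume uv: "u \<in> lists gens" "v \<in> lists gens"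
      show "?e (frag_of u \<otimes>\<^bsub>F.\<A>\<^esub> (x \<otimes>\<^bsub>F.\<A>\<^esub> a) \<otimes>\<^bsub>F.\<A>\<^esub> frag_of v) = 0"
        using x
      proof (induction rule: F.carrier_induct)
        case (of w)
        then have "frag_of u \<otimes>\<^bsub>F.\<A>\<^esub> (frag_of w \<otimes>\<^bsub>F.\<A>\<^esub> a) = frag_of (u @ w) \<otimes>\<^bsub>F.\<A>\<^esub> a"
          using uv a F.m_assoc[of "frag_of u" "frag_of w" a] by auto
        moreover have "u @ w \<in> lists gens" using uv of by simp
        ultimately show ?case using a uv by (simp del: append_in_lists_conv)
      qed (auto simp: F.mult_bilinear F.mult_bilinear_diff)
    qed (use a x in auto)
    show "a \<otimes>\<^bsub>F.\<A>\<^esub> x \<in> ?J"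
    proof (intro CollectI conjI ballI)
      fix u v assume uv: "u \<in> lists gens" "v \<in> lists gens"
      show "?e (frag_of u \<otimes>\<^bsub>F.\<A>\<^esub> (a \<otimes>\<^bsub>F.\<A>\<^esub> x) \<otimes>\<^bsub>F.\<A>\<^esub> frag_of v) = 0"
        using x
      proof (induction rule: F.carrier_induct)
        case (of w)
        then have "frag_of u \<otimes>\<^bsub>F.\<A>\<^esub> (a \<otimes>\<^bsub>F.\<A>\<^esub> frag_of w) \<otimes>\<^bsub>F.\<A>\<^esub> frag_of v
            = frag_of u \<otimes>\<^bsub>F.\<A>\<^esub> a \<otimes>\<^bsub>F.\<A>\<^esub> (frag_of w \<otimes>\<^bsub>F.\<A>\<^esub> frag_of v)"
          using uv a by (simp add: F.m_assoc del: F.mult_of)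
        also have "\<dots> = frag_of u \<otimes>\<^bsub>F.\<A>\<^esub> a \<otimes>\<^bsub>F.\<A>\<^esub> frag_of (w @ v)" by simp
        finally show ?case using a uv of by auto
      qed (auto simp: F.mult_bilinear F.mult_bilinear_diff)
    qed (use a x in auto)
  qed (rule F.ring_axioms)
  moreover have "leavitt_relators r \<subseteq> ?J"
  proof
    fix c assume c: "c \<in> leavitt_relators r"
    have "?e (frag_of u \<otimes>\<^bsub>F.\<A>\<^esub> c \<otimes>\<^bsub>F.\<A>\<^esub> frag_of v) = 0" for u v
      using c unfolding leavitt_relators_def
      by (auto simp: F.mult_bilinear F.mult_bilinear_diff F.mult_sum frag_eval_sum
          word_weight_xy word_weight_yx simp del: One_nat_def)
    then show "c \<in> ?J" using c relators_closed by auto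
  qed
  ultimately have "leavitt_ideal r \<subseteq> ?J" by (rule leavitt_ideal_minimal)
  \<comment> \<open>The empty context recovers the functional itself.\<close>
  then have "?e (frag_of [] \<otimes>\<^bsub>F.\<A>\<^esub> c \<otimes>\<^bsub>F.\<A>\<^esub> frag_of []) = 0" and "c \<in> carrier F.\<A>"
    using assms by auto
  then show ?thesis using F.mult_one by simp
qed

lemma leavitt_weight_cs: "c \<in> carrier F.\<A> \<Longrightarrow> leavitt_weight r (FQ.cs c) = frag_eval (word_weight r) c"
  unfolding leavitt_weight_def by (rule FQ.coset_eval_eq) (rule word_weight_ideal)

lemma leavitt_weight_add:
  assumes "a \<in> carrier L" "b \<in> carrier L"
  shows "leavitt_weight r (a \<oplus>\<^bsub>L\<^esub> b) = leavitt_weight r a + leavitt_weight r b"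
  using assms unfolding L_eq
  by (elim FQ.cs_cases) (auto simp: FQ.cs_add[symmetric] leavitt_weight_cs)

lemma leavitt_weight_wd: "w \<in> lists gens \<Longrightarrow> leavitt_weight r (wd w) = word_weight r w"
  unfolding wd_def by (subst leavitt_weight_cs) auto

lemma leavitt_weight_one: "leavitt_weight r \<one>\<^bsub>L\<^esub> = 1"
  using leavitt_weight_wd[of "[]"] by (simp add: wd_Nil word_weight_def)

section \<open>Monomials and their normal form\<close>

lemma leavitt_monomials_eq: "leavitt_monomials r = wd ` lists gens"
proof
  show "leavitt_monomials r \<subseteq> wd ` lists gens"
  proof
    fix a assume "a \<in> leavitt_monomials r"
    then show "a \<in> wd ` lists gens"
      unfolding leavitt_monomials_def
    proof (induction rule: submonoid_generated.induct)
      case one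
      then show ?case by (auto simp: wd_Nil[symmetric])
    next
      case (incl s)
      then show ?case by (auto simp: leavitt_x_eq leavitt_y_eq)
    next
      case (mult a b)
      then obtain u v where "u \<in> lists gens" "v \<in> lists gens" "a = wd u" "b = wd v" by auto
      then show ?case by (intro image_eqI[of _ _ "u @ v"]) (auto simp: wd_append)
    qed
  qed
next
  have "wd w \<in> leavitt_monomials r" if "w \<in> lists gens" for w
    using that
  proof (induction w)
    case Nil
    then show ?case by (auto simp: wd_Nil leavitt_monomials_def intro: submonoid_generated.one)
  next
    case (Cons g w)
    have "wd [g] \<in> leavitt_x r ` {1..r} \<union> leavitt_y r ` {1..r}"
      using Cons(1) by (cases g) (auto simp: leavitt_x_eq leavitt_y_eq)
    then have "wd [g] \<in> leavitt_monomials r"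
      unfolding leavitt_monomials_def by (rule submonoid_generated.incl)
    then show ?case
      using wd_append[of "[g]" w] Cons by (auto simp: leavitt_monomials_def intro: submonoid_generated.mult)
  qed
  then show "wd ` lists gens \<subseteq> leavitt_monomials r" by auto
qed

text \<open>The reversal in \<open>xw\<close> makes \<open>xw \<alpha>\<close> the adjoint of
  \<open>yw \<alpha>\<close>, so indices of words can be compared without reversing them.\<close>

definition yw :: "nat list \<Rightarrow> leavitt" where "yw \<alpha> = wd (map GenY \<alpha>)"
definition xw :: "nat list \<Rightarrow> leavitt" where "xw \<alpha> = wd (rev (map GenX \<alpha>))"

lemma map_gens [simp]: "map GenY \<alpha> \<in> lists gens \<longleftrightarrow> \<alpha> \<in> lists {1..r}"
  "map GenX \<alpha> \<in> lists gens \<longleftrightarrow> \<alpha> \<in> lists {1..r}"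
  by (induction \<alpha>) auto

lemma rev_in_lists [simp]: "rev w \<in> lists S \<longleftrightarrow> w \<in> lists S"
  by (auto simp: in_lists_conv_set)

lemma yw_closed [simp]: "\<alpha> \<in> lists {1..r} \<Longrightarrow> yw \<alpha> \<in> carrier L"
  and xw_closed [simp]: "\<alpha> \<in> lists {1..r} \<Longrightarrow> xw \<alpha> \<in> carrier L"
  unfolding yw_def xw_def by (auto intro!: wd_closed simp del: in_listsI in_listsD)

lemma yw_append: "\<alpha> \<in> lists {1..r} \<Longrightarrow> \<beta> \<in> lists {1..r} \<Longrightarrow> yw (\<alpha> @ \<beta>) = yw \<alpha> \<otimes>\<^bsub>L\<^esub> yw \<beta>"
  unfolding yw_def by (simp only: map_append wd_append map_gens)

lemma xw_append: "\<alpha> \<in> lists {1..r} \<Longrightarrow> \<beta> \<in> lists {1..r} \<Longrightarrow> xw (\<alpha> @ \<beta>) = xw \<beta> \<otimes>\<^bsub>L\<^esub> xw \<alpha>"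
  unfolding xw_def by (simp only: map_append rev_append wd_append map_gens rev_in_lists)

lemma yw_Nil [simp]: "yw [] = \<one>\<^bsub>L\<^esub>" and xw_Nil [simp]: "xw [] = \<one>\<^bsub>L\<^esub>"
  by (simp_all add: yw_def xw_def wd_Nil)

lemma leavitt_star_yw_xw:
  assumes "\<alpha> \<in> lists {1..r}" "\<beta> \<in> lists {1..r}"
  shows "leavitt_star (yw \<alpha> \<otimes>\<^bsub>L\<^esub> xw \<beta>) = yw \<beta> \<otimes>\<^bsub>L\<^esub> xw \<alpha>"
proof -
  have *: "yw \<alpha> \<otimes>\<^bsub>L\<^esub> xw \<beta> = wd (map GenY \<alpha> @ rev (map GenX \<beta>))"
    if "\<alpha> \<in> lists {1..r}" "\<beta> \<in> lists {1..r}" for \<alpha> \<beta>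
    using that unfolding yw_def xw_def by (subst wd_append) (simp_all only: map_gens rev_in_lists)
  have "star_word (map GenY \<alpha> @ rev (map GenX \<beta>)) = map GenY \<beta> @ rev (map GenX \<alpha>)"
    by (simp add: star_word_def rev_map comp_def)
  then show ?thesis using assms by (simp only: * leavitt_star_wd)
qed

text \<open>Cancellation happens at the junction, between the first letters of both indices. Equal
  lengths ensure that no remainder survives on either side.\<close>

lemma xw_yw:
  assumes "\<alpha> \<in> lists {1..r}" "\<beta> \<in> lists {1..r}" "length \<alpha> = length \<beta>"
  shows "xw \<alpha> \<otimes>\<^bsub>L\<^esub> yw \<beta> = (if \<alpha> = \<beta> then \<one>\<^bsub>L\<^esub> else \<zero>\<^bsub>L\<^esub>)"
  using assms(3,1,2)
proof (induction \<alpha> \<beta> rule: list_induct2)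
  case (Cons i \<alpha> j \<beta>)
  then have c: "\<alpha> \<in> lists {1..r}" "\<beta> \<in> lists {1..r}" "i \<in> {1..r}" "j \<in> {1..r}" by auto
  have "xw (i # \<alpha>) = xw \<alpha> \<otimes>\<^bsub>L\<^esub> wd [GenX i]" "yw (j # \<beta>) = wd [GenY j] \<otimes>\<^bsub>L\<^esub> yw \<beta>"
    using xw_append[of "[i]" \<alpha>] yw_append[of "[j]" \<beta>] c by (auto simp: xw_def yw_def)
  then have "xw (i # \<alpha>) \<otimes>\<^bsub>L\<^esub> yw (j # \<beta>) = xw \<alpha> \<otimes>\<^bsub>L\<^esub> (wd [GenX i] \<otimes>\<^bsub>L\<^esub> wd [GenY j]) \<otimes>\<^bsub>L\<^esub> yw \<beta>"
    using c by (simp add: L.m_assoc)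
  also have "\<dots> = (if i # \<alpha> = j # \<beta> then \<one>\<^bsub>L\<^esub> else \<zero>\<^bsub>L\<^esub>)"
    using Cons.IH c by (auto simp: wd_xy)
  finally show ?case .
qed simp

text \<open>Induction from the right end of the word: a new \<open>y\<close> extends \<alpha> at the
  front; a new \<open>x\<close> meets the first letter of \<alpha> and cancels or annihilates, and
  if \<alpha> is empty it joins \<beta> at the end, since \<open>xw\<close> reverses.\<close>

lemma wd_normal_form:
  assumes "w \<in> lists gens"
  shows "wd w = \<zero>\<^bsub>L\<^esub> \<or> (\<exists>\<alpha>\<in>lists {1..r}. \<exists>\<beta>\<in>lists {1..r}. wd w = yw \<alpha> \<otimes>\<^bsub>L\<^esub> xw \<beta>)"
  using assms
proof (induction w)
  case Nil
  then show ?case by (intro disjI2 bexI[of _ "[]"]) (auto simp: wd_Nil)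
next
  case (Cons g w)
  have g: "wd (g # w) = wd [g] \<otimes>\<^bsub>L\<^esub> wd w" "wd [g] \<in> carrier L"
    using wd_append[of "[g]" w] Cons.hyps by auto
  consider "wd w = \<zero>\<^bsub>L\<^esub>" | \<alpha> \<beta> where "\<alpha> \<in> lists {1..r}" "\<beta> \<in> lists {1..r}" "wd w = yw \<alpha> \<otimes>\<^bsub>L\<^esub> xw \<beta>"
    using Cons by blast
  then show ?case
  proof cases
    case 1
    then show ?thesis using g by simp
  next
    case ab: 2
    show ?thesis
    proof (cases g)
      case (GenY k)
      then have "wd (g # w) = yw (k # \<alpha>) \<otimes>\<^bsub>L\<^esub> xw \<beta>"
        using g ab yw_append[of "[k]" \<alpha>] Cons.hyps by (auto simp: L.m_assoc yw_def)
      then show ?thesis using ab GenY Cons.hyps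
        by (intro disjI2 bexI[of _ "k # \<alpha>"] bexI[of _ \<beta>]) auto
    next
      case (GenX k)
      show ?thesis
      proof (cases \<alpha>)
        case Nil
        then have "wd (g # w) = yw [] \<otimes>\<^bsub>L\<^esub> xw (\<beta> @ [k])"
          using g ab xw_append[of \<beta> "[k]"] Cons.hyps GenX by (auto simp: xw_def)
        then show ?thesis using ab GenX Cons.hyps
          by (intro disjI2 bexI[of _ "[]"] bexI[of _ "\<beta> @ [k]"]) auto
      next
        case (Cons j \<alpha>')
        then have j: "j \<in> {1..r}" "\<alpha>' \<in> lists {1..r}" "k \<in> {1..r}"
          using ab GenX Cons.hyps \<open>g \<in> gens\<close> by auto
        have "yw \<alpha> = wd [GenY j] \<otimes>\<^bsub>L\<^esub> yw \<alpha>'"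
          using yw_append[of "[j]" \<alpha>'] j Cons by (simp add: yw_def)
        then have "wd (g # w) = wd [GenX k] \<otimes>\<^bsub>L\<^esub> wd [GenY j] \<otimes>\<^bsub>L\<^esub> (yw \<alpha>' \<otimes>\<^bsub>L\<^esub> xw \<beta>)"
          using g ab j GenX by (simp add: L.m_assoc)
        then show ?thesis using j ab by (auto simp: wd_xy)
      qed
    qed
  qed
qed

lemma leavitt_weight_nonneg: "a \<in> leavitt_monomials r \<Longrightarrow> 0 \<le> leavitt_weight r a"
  unfolding leavitt_monomials_eq by (elim imageE) (simp only: leavitt_weight_wd word_weight_nonneg)

lemma yw_xw_monomial:
  assumes "\<alpha> \<in> lists {1..r}" "\<beta> \<in> lists {1..r}"
  shows "yw \<alpha> \<otimes>\<^bsub>L\<^esub> xw \<beta> \<in> leavitt_monomials r"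
  unfolding leavitt_monomials_eq yw_def xw_def using assms
  by (intro image_eqI[of _ _ "map GenY \<alpha> @ rev (map GenX \<beta>)"])
    (simp_all only: wd_append map_gens rev_in_lists append_in_lists_conv)

end


section \<open>Tensor powers\<close>

declare One_nat_def [simp del]

definition star_tuple :: "nat \<Rightarrow> ('a \<Rightarrow> 'a) \<Rightarrow> ((nat \<Rightarrow> 'a) \<Rightarrow>\<^sub>0 int) \<Rightarrow> (nat \<Rightarrow> 'a) \<Rightarrow>\<^sub>0 int" where
  "star_tuple t s = frag_extend (\<lambda>p. frag_of (\<lambda>l\<in>{1..t}. s (p l)))"

lemma star_tuple_simps [simp]:
  "star_tuple t s 0 = 0" "star_tuple t s (frag_of p) = frag_of (\<lambda>l\<in>{1..t}. s (p l))"
  "star_tuple t s (a + b) = star_tuple t s a + star_tuple t s b"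
  "star_tuple t s (a - b) = star_tuple t s a - star_tuple t s b"
  "star_tuple t s (- a) = - star_tuple t s a"
  by (simp_all add: star_tuple_def frag_extend_add frag_extend_diff frag_extend_minus)

definition tensor_weight :: "nat \<Rightarrow> ('a \<Rightarrow> int) \<Rightarrow> ((nat \<Rightarrow> 'a) \<Rightarrow>\<^sub>0 int) set \<Rightarrow> int" where
  "tensor_weight t \<omega> = coset_eval (\<lambda>p. \<Prod>l\<in>{1..t}. \<omega> (p l))"

locale tensor_algebra = R: ring R for R :: "('a, 'b) ring_scheme" (structure) and t :: nat
begin

abbreviation "PM \<equiv> product_group {1..t} (\<lambda>_. R)"
abbreviation "N \<equiv> tensor_subgroup t R"

sublocale T: monoid_algebra PM
  unfolding monoid_algebra_def
proof (rule monoidI)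
  fix x y z assume "x \<in> carrier PM" "y \<in> carrier PM" "z \<in> carrier PM"
  then show "x \<otimes>\<^bsub>PM\<^esub> y \<otimes>\<^bsub>PM\<^esub> z = x \<otimes>\<^bsub>PM\<^esub> (y \<otimes>\<^bsub>PM\<^esub> z)"
    by (auto simp: R.m_assoc PiE_iff intro!: restrict_ext)
next
  fix x assume "x \<in> carrier PM"
  then show "\<one>\<^bsub>PM\<^esub> \<otimes>\<^bsub>PM\<^esub> x = x" "x \<otimes>\<^bsub>PM\<^esub> \<one>\<^bsub>PM\<^esub> = x"
    by (auto simp: fun_eq_iff PiE_iff extensional_def)
qed (auto simp: PiE_iff)

lemma tuple_ring_eq: "tuple_ring t R = T.\<A>"
  by (simp add: tuple_ring_def)

lemma relators_cases:
  assumes "c \<in> multilinear_relators t R"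
  obtains p l a b where "p \<in> {1..t} \<rightarrow>\<^sub>E carrier R" "l \<in> {1..t}" "a \<in> carrier R" "b \<in> carrier R"
    "c = frag_of (p(l := a \<oplus> b)) - frag_of (p(l := a)) - frag_of (p(l := b))"
  using assms unfolding multilinear_relators_def by blast

lemma relatorsI:
  "p \<in> {1..t} \<rightarrow>\<^sub>E carrier R \<Longrightarrow> l \<in> {1..t} \<Longrightarrow> a \<in> carrier R \<Longrightarrow> b \<in> carrier R \<Longrightarrow>
    frag_of (p(l := a \<oplus> b)) - frag_of (p(l := a)) - frag_of (p(l := b)) \<in> multilinear_relators t R"
  unfolding multilinear_relators_def by blast

lemma upd_closed:
  "p \<in> {1..t} \<rightarrow>\<^sub>E carrier R \<Longrightarrow> l \<in> {1..t} \<Longrightarrow> a \<in> carrier R \<Longrightarrow> p(l := a) \<in> {1..t} \<rightarrow>\<^sub>E carrier R"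
  by (auto simp: PiE_iff extensional_def)

lemma relators_closed: "multilinear_relators t R \<subseteq> carrier T.\<A>"
proof
  fix c assume "c \<in> multilinear_relators t R"
  then show "c \<in> carrier T.\<A>"
    by (rule relators_cases) (simp del: fun_upd_apply add: upd_closed)
qed

lemma N_eq: "N = generate (add_monoid T.\<A>) (multilinear_relators t R)"
  by (simp add: tensor_subgroup_def tuple_ring_eq)

lemma N_subgroup: "subgroup N (add_monoid T.\<A>)"
  unfolding N_eq by (rule T.add.generate_is_subgroup) (use relators_closed in simp)

lemma N_closed: "N \<subseteq> carrier T.\<A>"
  using subgroup.subset[OF N_subgroup] by simp

lemma N_ops: "0 \<in> N" "x \<in> N \<Longrightarrow> y \<in> N \<Longrightarrow> x + y \<in> N" "x \<in> N \<Longrightarrow> - x \<in> N"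
proof -
  show "0 \<in> N" using subgroup.one_closed[OF N_subgroup] by simp
  show "x \<in> N \<Longrightarrow> y \<in> N \<Longrightarrow> x + y \<in> N" using subgroup.m_closed[OF N_subgroup] by simp
  show "- x \<in> N" if "x \<in> N"
    using subgroup.m_inv_closed[OF N_subgroup that] N_closed that T.minus_eq_uminus
    by (auto simp: a_inv_def)
qed

lemma N_diff: "x \<in> N \<Longrightarrow> y \<in> N \<Longrightarrow> x - y \<in> N"
  using N_ops(2)[of x "- y"] N_ops(3)[of y] by simp

lemma N_incl: "c \<in> multilinear_relators t R \<Longrightarrow> c \<in> N"
  unfolding N_eq by (rule generate.incl)

lemma N_induct [consumes 1, case_names rel zero add minus]:
  assumes "c \<in> N" "\<And>c. c \<in> multilinear_relators t R \<Longrightarrow> P c" "P 0"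
    "\<And>a b. P a \<Longrightarrow> P b \<Longrightarrow> P (a + b)" "\<And>a. P a \<Longrightarrow> P (- a)"
  shows "P c"
  using assms(1) unfolding N_eq
proof (induction rule: generate.induct)
  case (inv h)
  have "h \<in> carrier T.\<A>" using inv relators_closed by blast
  then have "inv\<^bsub>add_monoid T.\<A>\<^esub> h = - h" using T.minus_eq_uminus by (simp add: a_inv_def)
  then show ?case using assms inv by simp
qed (use assms in auto)

text \<open>The slotwise product with a tuple turns a relator at slot \<open>l\<close> into another
  relator at slot \<open>l\<close>, by distributivity in that slot.\<close>

lemma N_mult_of:
  assumes "c \<in> N" "q \<in> carrier PM"
  shows "frag_of q \<otimes>\<^bsub>T.\<A>\<^esub> c \<in> N" "c \<otimes>\<^bsub>T.\<A>\<^esub> frag_of q \<in> N"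
proof -
  have upd: "q \<otimes>\<^bsub>PM\<^esub> p(l := a) = (q \<otimes>\<^bsub>PM\<^esub> p)(l := q l \<otimes> a)"
    "p(l := a) \<otimes>\<^bsub>PM\<^esub> q = (p \<otimes>\<^bsub>PM\<^esub> q)(l := a \<otimes> q l)" if "l \<in> {1..t}" for p l a
    using that by (auto simp: fun_eq_iff)
  have q: "q l \<in> carrier R" if "l \<in> {1..t}" for l
    using assms(2) that by auto
  have "frag_of q \<otimes>\<^bsub>T.\<A>\<^esub> c \<in> N \<and> c \<otimes>\<^bsub>T.\<A>\<^esub> frag_of q \<in> N"
    using assms(1)
  proof (induction rule: N_induct)
    case (rel c)
    then obtain p l a b where *: "p \<in> {1..t} \<rightarrow>\<^sub>E carrier R" "l \<in> {1..t}" "a \<in> carrier R" "b \<in> carrier R"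
      and c: "c = frag_of (p(l := a \<oplus> b)) - frag_of (p(l := a)) - frag_of (p(l := b))"
      by (rule relators_cases)
    have p: "p \<in> carrier PM" using * by simp
    have pq: "q \<otimes>\<^bsub>PM\<^esub> p \<in> {1..t} \<rightarrow>\<^sub>E carrier R" "p \<otimes>\<^bsub>PM\<^esub> q \<in> {1..t} \<rightarrow>\<^sub>E carrier R"
      using T.M.m_closed[OF p assms(2)] T.M.m_closed[OF assms(2) p] by (simp_all only: carrier_product_group)
    show ?case
      unfolding c T.mult_bilinear_diff T.mult_of upd[OF *(2)]
      using relatorsI[OF pq(1) *(2), of "q l \<otimes> a" "q l \<otimes> b"]
        relatorsI[OF pq(2) *(2), of "a \<otimes> q l" "b \<otimes> q l"] q[OF *(2)] *
      by (intro conjI N_incl) (simp_all only: R.r_distr R.l_distr R.m_closed)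
  next
    case (minus a)
    then show ?case
      using T.mult_bilinear_diff(1)[of 0 a] T.mult_bilinear_diff(2)[of _ 0 a]
      by (simp add: T.mult_bilinear N_ops)
  qed (auto simp: T.mult_bilinear N_ops)
  then show "frag_of q \<otimes>\<^bsub>T.\<A>\<^esub> c \<in> N" "c \<otimes>\<^bsub>T.\<A>\<^esub> frag_of q \<in> N" by auto
qed

sublocale TQ: monoid_algebra_quotient PM N
  unfolding monoid_algebra_quotient_def
proof (intro conjI T.monoid_algebra_axioms idealI T.ring_axioms N_subgroup)
  fix a x assume a: "a \<in> N" and x: "x \<in> carrier T.\<A>"
  show "x \<otimes>\<^bsub>T.\<A>\<^esub> a \<in> N"
    using x by (induction rule: T.carrier_induct)
      (auto simp: T.mult_bilinear T.mult_bilinear_diff N_ops N_diff N_mult_of[OF a] simp del: carrier_product_group)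
  show "a \<otimes>\<^bsub>T.\<A>\<^esub> x \<in> N"
    using x by (induction rule: T.carrier_induct)
      (auto simp: T.mult_bilinear T.mult_bilinear_diff N_ops N_diff N_mult_of[OF a] simp del: carrier_product_group)
qed

abbreviation "TP \<equiv> tensor_power t R"

lemma TP_eq: "TP = TQ.\<Q>"
  by (simp add: tensor_power_def tuple_ring_eq)

sublocale TP: ring TP
  unfolding TP_eq by (rule TQ.Q_ring)

section \<open>Pure tensors and their multilinearity\<close>

abbreviation "pure \<equiv> pure_tensor t R"

lemma pure_eq: "pure p = TQ.cs (frag_of (restrict p {1..t}))"
  by (simp add: pure_tensor_def tuple_ring_eq)

lemma pure_cong: "(\<And>l. l \<in> {1..t} \<Longrightarrow> p l = q l) \<Longrightarrow> pure p = pure q"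
  unfolding pure_eq by (metis (mono_tags, lifting) restrict_ext)

lemma pure_closed: "(\<And>l. l \<in> {1..t} \<Longrightarrow> p l \<in> carrier R) \<Longrightarrow> pure p \<in> carrier TP"
  unfolding pure_eq TP_eq by (rule TQ.cs_closed) simp

lemma pure_mult:
  assumes "\<And>l. l \<in> {1..t} \<Longrightarrow> p l \<in> carrier R" "\<And>l. l \<in> {1..t} \<Longrightarrow> q l \<in> carrier R"
  shows "pure p \<otimes>\<^bsub>TP\<^esub> pure q = pure (\<lambda>l. p l \<otimes> q l)"
proof -
  have "restrict p {1..t} \<otimes>\<^bsub>PM\<^esub> restrict q {1..t} = (\<lambda>l\<in>{1..t}. p l \<otimes> q l)"
    by (auto simp: fun_eq_iff)
  then show ?thesis
    using assms unfolding pure_eq TP_eq by (subst TQ.cs_mult[symmetric]) (simp_all del: mult_product_group)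
qed

lemma pure_one: "pure (\<lambda>_. \<one>) = \<one>\<^bsub>TP\<^esub>"
  unfolding pure_eq TP_eq TQ.cs_one by simp

lemma pure_add:
  assumes "\<And>j. j \<in> {1..t} \<Longrightarrow> p j \<in> carrier R" "l \<in> {1..t}" "a \<in> carrier R" "b \<in> carrier R"
  shows "pure (p(l := a \<oplus> b)) = pure (p(l := a)) \<oplus>\<^bsub>TP\<^esub> pure (p(l := b))"
proof -
  let ?p = "restrict p {1..t}"
  have p: "?p \<in> {1..t} \<rightarrow>\<^sub>E carrier R" using assms(1) by auto
  have upd: "restrict (p(l := c)) {1..t} = ?p(l := c)" for c
    using assms(2) by (auto simp: fun_eq_iff)
  have "TQ.cs (frag_of (?p(l := a \<oplus> b))) = TQ.cs (frag_of (?p(l := a)) + frag_of (?p(l := b)))"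
  proof (rule TQ.cs_eqI)
    show "frag_of (?p(l := a \<oplus> b)) - (frag_of (?p(l := a)) + frag_of (?p(l := b))) \<in> N"
      using N_incl[OF relatorsI[OF p assms(2-)]] by (simp add: diff_diff_add)
  qed (use upd_closed[OF p assms(2)] assms in \<open>simp del: fun_upd_apply\<close>)
  then show ?thesis
    unfolding pure_eq upd TP_eq
    by (subst TQ.cs_add[symmetric])
      (use upd_closed[OF p assms(2)] assms in \<open>simp_all del: fun_upd_apply\<close>)
qed

text \<open>Writing the zero in slot \<open>l\<close> as a sum of two zeros shows that the tensor
  equals its own double.\<close>

lemma pure_zero:
  assumes "\<And>j. j \<in> {1..t} \<Longrightarrow> p j \<in> carrier R" "l \<in> {1..t}" "p l = \<zero>"
  shows "pure p = \<zero>\<^bsub>TP\<^esub>"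
proof -
  have *: "p(l := \<zero>) = p" "\<zero> \<oplus> \<zero> = \<zero>"
    using assms(3) by (auto simp: fun_eq_iff)
  have c: "pure p \<in> carrier TP"
    by (rule pure_closed) (rule assms(1))
  have "pure p = pure p \<oplus>\<^bsub>TP\<^esub> pure p"
    using pure_add[of p l \<zero> \<zero>, OF assms(1,2)] unfolding * by blast
  then show ?thesis
    using TP.add.l_cancel_one'[OF c c] by blast
qed

lemma pure_finsum:
  assumes "\<And>j. j \<in> {1..t} \<Longrightarrow> p j \<in> carrier R" "l \<in> {1..t}" "\<And>i. i \<in> J \<Longrightarrow> f i \<in> carrier R" "finite J"
  shows "pure (p(l := finsum R f J)) = (\<Oplus>\<^bsub>TP\<^esub>i\<in>J. pure (p(l := f i)))"
  using assms(4,3)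
proof (induction J rule: finite_induct)
  case empty
  then show ?case using assms by (simp, intro pure_zero[of _ l]) auto
next
  case (insert j J)
  then have "pure (p(l := f i)) \<in> carrier TP" if "i \<in> insert j J" for i
    using assms that by (intro pure_closed) auto
  then have "(\<Oplus>\<^bsub>TP\<^esub>i\<in>insert j J. pure (p(l := f i))) = pure (p(l := f j)) \<oplus>\<^bsub>TP\<^esub> (\<Oplus>\<^bsub>TP\<^esub>i\<in>J. pure (p(l := f i)))"
    using insert by (intro TP.finsum_insert) auto
  moreover have "finsum R f (insert j J) = f j \<oplus> finsum R f J" "finsum R f J \<in> carrier R"
    using insert by (auto intro!: R.finsum_insert)
  ultimately show ?case
    using insert.IH insert.prems pure_add[of p l "f j" "finsum R f J", OF assms(1,2)]
    by (metis insertCI)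
qed

section \<open>Additive involutions and functionals induced on the tensor power\<close>

context
  fixes s :: "'a \<Rightarrow> 'a"
  assumes s_closed: "\<And>a. a \<in> carrier R \<Longrightarrow> s a \<in> carrier R"
    and s_s: "\<And>a. a \<in> carrier R \<Longrightarrow> s (s a) = a"
    and s_add: "\<And>a b. a \<in> carrier R \<Longrightarrow> b \<in> carrier R \<Longrightarrow> s (a \<oplus> b) = s a \<oplus> s b"
begin

lemma star_tuple_closed: "c \<in> carrier T.\<A> \<Longrightarrow> star_tuple t s c \<in> carrier T.\<A>"
  by (induction rule: T.carrier_induct) (auto intro: s_closed)

lemma star_tuple_star: "c \<in> carrier T.\<A> \<Longrightarrow> star_tuple t s (star_tuple t s c) = c"
proof (induction rule: T.carrier_induct)
  case (of p)
  then have "(\<lambda>l\<in>{1..t}. s ((\<lambda>l\<in>{1..t}. s (p l)) l)) = p"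
    by (auto simp: fun_eq_iff PiE_iff extensional_def s_s)
  then show ?case by simp
qed auto

text \<open>An additive map sends multilinearity relators to such relators; the reverse inclusion
  comes from involutivity.\<close>

lemma star_tuple_N: "star_tuple t s ` N = N"
proof -
  have sub: "star_tuple t s c \<in> N" if "c \<in> N" for c
    using that
  proof (induction rule: N_induct)
    case (rel c)
    then obtain p l a b where *: "p \<in> {1..t} \<rightarrow>\<^sub>E carrier R" "l \<in> {1..t}" "a \<in> carrier R" "b \<in> carrier R"
      and c: "c = frag_of (p(l := a \<oplus> b)) - frag_of (p(l := a)) - frag_of (p(l := b))"
      by (rule relators_cases)
    have upd: "(\<lambda>j\<in>{1..t}. s ((p(l := a)) j)) = (\<lambda>j\<in>{1..t}. s (p j))(l := s a)" for a
      using *(2) by (auto simp: fun_eq_iff)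
    have "(\<lambda>j\<in>{1..t}. s (p j)) \<in> {1..t} \<rightarrow>\<^sub>E carrier R" using * s_closed by auto
    from relatorsI[OF this *(2) s_closed[OF *(3)] s_closed[OF *(4)]]
    show ?case unfolding c star_tuple_simps upd s_add[OF *(3,4)] by (rule N_incl)
  qed (auto simp: N_ops)
  have "c \<in> star_tuple t s ` N" if "c \<in> N" for c
    using sub[OF that] star_tuple_star[of c] N_closed that by (metis imageI subsetD)
  then show ?thesis using sub by auto
qed

lemma tensor_map_cs: "tensor_map t s (TQ.cs c) = TQ.cs (star_tuple t s c)"
proof -
  have "tensor_map t s C = star_tuple t s ` C" for C
    by (simp add: tensor_map_def star_tuple_def)
  then show ?thesis
    using TQ.image_cs[of "star_tuple t s" c] star_tuple_N by simp
qed

lemma tensor_map_pure: "tensor_map t s (pure p) = pure (\<lambda>l. s (p l))"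
proof -
  have "(\<lambda>l\<in>{1..t}. s (restrict p {1..t} l)) = (\<lambda>l\<in>{1..t}. s (p l))"
    by (auto simp: fun_eq_iff)
  then show ?thesis unfolding pure_eq tensor_map_cs by simp
qed

lemma tensor_map_closed: "a \<in> carrier TP \<Longrightarrow> tensor_map t s a \<in> carrier TP"
  unfolding TP_eq
  by (erule TQ.cs_cases) (auto simp: tensor_map_cs intro!: TQ.cs_closed star_tuple_closed)

lemma tensor_map_add:
  assumes "a \<in> carrier TP" "b \<in> carrier TP"
  shows "tensor_map t s (a \<oplus>\<^bsub>TP\<^esub> b) = tensor_map t s a \<oplus>\<^bsub>TP\<^esub> tensor_map t s b"
  using assms unfolding TP_eq
  by (elim TQ.cs_cases) (auto simp: TQ.cs_add[symmetric] tensor_map_cs star_tuple_closed)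

end

context
  fixes \<omega> :: "'a \<Rightarrow> int"
  assumes \<omega>_add: "\<And>a b. a \<in> carrier R \<Longrightarrow> b \<in> carrier R \<Longrightarrow> \<omega> (a \<oplus> b) = \<omega> a + \<omega> b"
begin

text \<open>In a relator the slots other than \<open>l\<close> contribute one common factor, and the
  remaining factor is additive.\<close>

lemma weight_N:
  assumes "c \<in> N" shows "frag_eval (\<lambda>p. \<Prod>l\<in>{1..t}. \<omega> (p l)) c = 0"
  using assms
proof (induction rule: N_induct)
  case (rel c)
  then obtain p l a b where *: "p \<in> {1..t} \<rightarrow>\<^sub>E carrier R" "l \<in> {1..t}" "a \<in> carrier R" "b \<in> carrier R"
    and c: "c = frag_of (p(l := a \<oplus> b)) - frag_of (p(l := a)) - frag_of (p(l := b))"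
    by (rule relators_cases)
  have "(\<Prod>j\<in>{1..t}. \<omega> ((p(l := a)) j)) = \<omega> a * (\<Prod>j\<in>{1..t} - {l}. \<omega> (p j))" for a
    using *(2) by (subst prod.remove[of _ l]) (auto intro!: prod.cong)
  then show ?case
    unfolding c frag_eval_simps using * by (simp add: \<omega>_add algebra_simps)
next
  case (minus a)
  then show ?case using frag_eval_simps(4)[of _ 0 a] by simp
qed auto

lemma tensor_weight_cs:
  "c \<in> carrier T.\<A> \<Longrightarrow> tensor_weight t \<omega> (TQ.cs c) = frag_eval (\<lambda>p. \<Prod>l\<in>{1..t}. \<omega> (p l)) c"
  unfolding tensor_weight_def by (rule TQ.coset_eval_eq) (rule weight_N)

lemma tensor_weight_pure:
  assumes "\<And>j. j \<in> {1..t} \<Longrightarrow> p j \<in> carrier R"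
  shows "tensor_weight t \<omega> (pure p) = (\<Prod>l\<in>{1..t}. \<omega> (p l))"
  unfolding pure_eq using assms by (subst tensor_weight_cs) auto

lemma tensor_weight_add:
  assumes "a \<in> carrier TP" "b \<in> carrier TP"
  shows "tensor_weight t \<omega> (a \<oplus>\<^bsub>TP\<^esub> b) = tensor_weight t \<omega> a + tensor_weight t \<omega> b"
  using assms unfolding TP_eq
  by (elim TQ.cs_cases) (auto simp: TQ.cs_add[symmetric] tensor_weight_cs)

end

end


section \<open>Matrix rings\<close>

lemma (in abelian_monoid) finsum_swap:
  assumes "finite A" "finite B" "\<And>x y. x \<in> A \<Longrightarrow> y \<in> B \<Longrightarrow> f x y \<in> carrier G"
  shows "(\<Oplus>x\<in>A. \<Oplus>y\<in>B. f x y) = (\<Oplus>y\<in>B. \<Oplus>x\<in>A. f x y)"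
  using assms(1,3)
proof (induction A rule: finite_induct)
  case (insert a A)
  have "(\<Oplus>x\<in>insert a A. \<Oplus>y\<in>B. f x y) = (\<Oplus>y\<in>B. f a y) \<oplus> (\<Oplus>y\<in>B. \<Oplus>x\<in>A. f x y)"
    using insert by (subst finsum_insert) auto
  also have "\<dots> = (\<Oplus>y\<in>B. f a y \<oplus> (\<Oplus>x\<in>A. f x y))"
    using insert by (intro finsum_addf[symmetric]) auto
  also have "\<dots> = (\<Oplus>y\<in>B. \<Oplus>x\<in>insert a A. f x y)"
    using insert by (intro finsum_cong') auto
  finally show ?case .
qed simp

locale matrix_algebra = R: ring R for R :: "('a, 'b) ring_scheme" (structure) and m :: nat
begin

abbreviation "MR \<equiv> matrix_ring m R"
abbreviation "mu \<equiv> matrix_unit m R"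

lemma MR_entry:
  assumes "i \<in> {1..m}" "j \<in> {1..m}"
  shows "(U \<otimes>\<^bsub>MR\<^esub> V) (i, j) = (\<Oplus>k\<in>{1..m}. U (i, k) \<otimes> V (k, j))"
    "(U \<oplus>\<^bsub>MR\<^esub> V) (i, j) = U (i, j) \<oplus> V (i, j)"
    "\<one>\<^bsub>MR\<^esub> (i, j) = (if i = j then \<one> else \<zero>)" "\<zero>\<^bsub>MR\<^esub> (i, j) = \<zero>"
    "mu k l c (i, j) = (if i = k \<and> j = l then c else \<zero>)"
    "matrix_scale_right m R U c (i, j) = U (i, j) \<otimes> c"
    "conj_transpose m s U (i, j) = s (U (j, i))"
  using assms by (simp_all add: matrix_ring_def matrix_unit_def matrix_scale_right_def conj_transpose_def)

lemma MR_carrier_iff: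
  "U \<in> carrier MR \<longleftrightarrow> (\<forall>i\<in>{1..m}. \<forall>j\<in>{1..m}. U (i, j) \<in> carrier R) \<and> U \<in> extensional ({1..m} \<times> {1..m})"
  by (auto simp: matrix_ring_def PiE_iff)

lemma MR_extensional:
  "U \<otimes>\<^bsub>MR\<^esub> V \<in> extensional ({1..m} \<times> {1..m})" "U \<oplus>\<^bsub>MR\<^esub> V \<in> extensional ({1..m} \<times> {1..m})"
  "\<one>\<^bsub>MR\<^esub> \<in> extensional ({1..m} \<times> {1..m})" "\<zero>\<^bsub>MR\<^esub> \<in> extensional ({1..m} \<times> {1..m})"
  "mu i j c \<in> extensional ({1..m} \<times> {1..m})"
  "matrix_scale_right m R U c \<in> extensional ({1..m} \<times> {1..m})"
  "conj_transpose m s U \<in> extensional ({1..m} \<times> {1..m})"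
  by (simp_all only: matrix_ring_def matrix_unit_def matrix_scale_right_def conj_transpose_def
    ring_record_simps restrict_extensional)

lemma MR_eqI:
  assumes "U \<in> extensional ({1..m} \<times> {1..m})" "V \<in> extensional ({1..m} \<times> {1..m})"
    "\<And>i j. i \<in> {1..m} \<Longrightarrow> j \<in> {1..m} \<Longrightarrow> U (i, j) = V (i, j)"
  shows "U = V"
  using assms(1,2) by (rule extensionalityI) (use assms(3) in auto)

lemma entry_closed: "U \<in> carrier MR \<Longrightarrow> i \<in> {1..m} \<Longrightarrow> j \<in> {1..m} \<Longrightarrow> U (i, j) \<in> carrier R"
  by (simp add: MR_carrier_iff)

lemma MR_closed:
  "U \<in> carrier MR \<Longrightarrow> V \<in> carrier MR \<Longrightarrow> U \<otimes>\<^bsub>MR\<^esub> V \<in> carrier MR"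
  "U \<in> carrier MR \<Longrightarrow> V \<in> carrier MR \<Longrightarrow> U \<oplus>\<^bsub>MR\<^esub> V \<in> carrier MR"
  "\<one>\<^bsub>MR\<^esub> \<in> carrier MR" "\<zero>\<^bsub>MR\<^esub> \<in> carrier MR" "c \<in> carrier R \<Longrightarrow> mu i j c \<in> carrier MR"
  by (auto simp: MR_carrier_iff[of "_ \<otimes>\<^bsub>MR\<^esub> _"] MR_carrier_iff[of "_ \<oplus>\<^bsub>MR\<^esub> _"] MR_carrier_iff[of "\<one>\<^bsub>MR\<^esub>"]
    MR_carrier_iff[of "\<zero>\<^bsub>MR\<^esub>"] MR_carrier_iff[of "mu _ _ _"]
    MR_entry MR_extensional intro!: R.finsum_closed R.m_closed R.a_closed intro: entry_closed)

lemma MR_assoc: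
  assumes "U \<in> carrier MR" "V \<in> carrier MR" "W \<in> carrier MR"
  shows "U \<otimes>\<^bsub>MR\<^esub> V \<otimes>\<^bsub>MR\<^esub> W = U \<otimes>\<^bsub>MR\<^esub> (V \<otimes>\<^bsub>MR\<^esub> W)"
proof (rule MR_eqI)
  fix i j assume ij: "i \<in> {1..m}" "j \<in> {1..m}"
  have c: "U (i, l) \<in> carrier R" "V (l, k) \<in> carrier R" "W (k, j) \<in> carrier R"
    if "k \<in> {1..m}" "l \<in> {1..m}" for k l
    using assms ij that by (auto intro: entry_closed)
  have "(U \<otimes>\<^bsub>MR\<^esub> V \<otimes>\<^bsub>MR\<^esub> W) (i, j) = (\<Oplus>k\<in>{1..m}. (\<Oplus>l\<in>{1..m}. U (i, l) \<otimes> V (l, k)) \<otimes> W (k, j))"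
    using ij by (auto simp: MR_entry c intro!: R.finsum_cong')
  also have "\<dots> = (\<Oplus>k\<in>{1..m}. \<Oplus>l\<in>{1..m}. U (i, l) \<otimes> V (l, k) \<otimes> W (k, j))"
    by (intro R.finsum_cong' R.finsum_ldistr) (auto simp: c)
  also have "\<dots> = (\<Oplus>l\<in>{1..m}. \<Oplus>k\<in>{1..m}. U (i, l) \<otimes> V (l, k) \<otimes> W (k, j))"
    by (intro R.finsum_swap) (auto simp: c)
  also have "\<dots> = (\<Oplus>l\<in>{1..m}. \<Oplus>k\<in>{1..m}. U (i, l) \<otimes> (V (l, k) \<otimes> W (k, j)))"
    by (intro R.finsum_cong' R.m_assoc) (auto simp: c)
  also have "\<dots> = (\<Oplus>l\<in>{1..m}. U (i, l) \<otimes> (\<Oplus>k\<in>{1..m}. V (l, k) \<otimes> W (k, j)))"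
    by (intro R.finsum_cong' R.finsum_rdistr[symmetric]) (auto simp: c)
  also have "\<dots> = (U \<otimes>\<^bsub>MR\<^esub> (V \<otimes>\<^bsub>MR\<^esub> W)) (i, j)"
    using ij by (auto simp: MR_entry c intro!: R.finsum_cong')
  finally show "(U \<otimes>\<^bsub>MR\<^esub> V \<otimes>\<^bsub>MR\<^esub> W) (i, j) = (U \<otimes>\<^bsub>MR\<^esub> (V \<otimes>\<^bsub>MR\<^esub> W)) (i, j)" .
qed (rule MR_extensional)+

lemma MR_one:
  assumes "U \<in> carrier MR"
  shows "\<one>\<^bsub>MR\<^esub> \<otimes>\<^bsub>MR\<^esub> U = U" "U \<otimes>\<^bsub>MR\<^esub> \<one>\<^bsub>MR\<^esub> = U"
proof -
  have U: "U \<in> extensional ({1..m} \<times> {1..m})" using assms by (simp add: MR_carrier_iff)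
  show "\<one>\<^bsub>MR\<^esub> \<otimes>\<^bsub>MR\<^esub> U = U"
  proof (rule MR_eqI[OF MR_extensional(1) U])
    fix i j assume ij: "i \<in> {1..m}" "j \<in> {1..m}"
    have "(\<one>\<^bsub>MR\<^esub> \<otimes>\<^bsub>MR\<^esub> U) (i, j) = (\<Oplus>k\<in>{1..m}. if i = k then U (k, j) else \<zero>)"
      unfolding MR_entry(1)[OF ij]
      by (intro R.finsum_cong') (use ij assms in \<open>auto simp: MR_entry entry_closed\<close>)
    also have "\<dots> = U (i, j)"
      using ij assms by (intro R.finsum_singleton) (auto simp: entry_closed)
    finally show "(\<one>\<^bsub>MR\<^esub> \<otimes>\<^bsub>MR\<^esub> U) (i, j) = U (i, j)" .
  qed
  show "U \<otimes>\<^bsub>MR\<^esub> \<one>\<^bsub>MR\<^esub> = U"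
  proof (rule MR_eqI[OF MR_extensional(1) U])
    fix i j assume ij: "i \<in> {1..m}" "j \<in> {1..m}"
    have "(U \<otimes>\<^bsub>MR\<^esub> \<one>\<^bsub>MR\<^esub>) (i, j) = (\<Oplus>k\<in>{1..m}. if j = k then U (i, k) else \<zero>)"
      unfolding MR_entry(1)[OF ij]
      by (intro R.finsum_cong') (use ij assms in \<open>auto simp: MR_entry entry_closed\<close>)
    also have "\<dots> = U (i, j)"
      using ij assms by (intro R.finsum_singleton) (auto simp: entry_closed)
    finally show "(U \<otimes>\<^bsub>MR\<^esub> \<one>\<^bsub>MR\<^esub>) (i, j) = U (i, j)" .
  qed
qed

sublocale MR: ring MR
proof (rule ringI)
  show "abelian_group MR"
  proof (rule abelian_groupI)
    fix U assume U: "U \<in> carrier MR"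
    let ?V = "\<lambda>ij\<in>{1..m} \<times> {1..m}. \<ominus> U ij"
    have "?V \<in> carrier MR" using U by (auto simp: MR_carrier_iff)
    moreover have "?V \<oplus>\<^bsub>MR\<^esub> U = \<zero>\<^bsub>MR\<^esub>"
      by (rule MR_eqI) (use U in \<open>auto simp: MR_extensional MR_entry entry_closed R.l_neg\<close>)
    ultimately show "\<exists>V\<in>carrier MR. V \<oplus>\<^bsub>MR\<^esub> U = \<zero>\<^bsub>MR\<^esub>" by blast
  next
    fix U V W assume UVW: "U \<in> carrier MR" "V \<in> carrier MR" "W \<in> carrier MR"
    then show "U \<oplus>\<^bsub>MR\<^esub> V \<oplus>\<^bsub>MR\<^esub> W = U \<oplus>\<^bsub>MR\<^esub> (V \<oplus>\<^bsub>MR\<^esub> W)"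
      by (intro MR_eqI) (auto simp: MR_extensional MR_entry entry_closed R.a_assoc)
  next
    fix U V assume UV: "U \<in> carrier MR" "V \<in> carrier MR"
    then show "U \<oplus>\<^bsub>MR\<^esub> V = V \<oplus>\<^bsub>MR\<^esub> U"
      by (intro MR_eqI) (auto simp: MR_extensional MR_entry entry_closed R.a_comm)
  next
    fix U assume U: "U \<in> carrier MR"
    then show "\<zero>\<^bsub>MR\<^esub> \<oplus>\<^bsub>MR\<^esub> U = U"
      by (intro MR_eqI) (auto simp: MR_extensional MR_entry entry_closed MR_carrier_iff)
  qed (auto simp: MR_closed)
  show "monoid MR"
    by (rule monoidI) (auto simp: MR_closed MR_assoc MR_one)
next
  fix U V W assume UVW: "U \<in> carrier MR" "V \<in> carrier MR" "W \<in> carrier MR"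
  show "(U \<oplus>\<^bsub>MR\<^esub> V) \<otimes>\<^bsub>MR\<^esub> W = U \<otimes>\<^bsub>MR\<^esub> W \<oplus>\<^bsub>MR\<^esub> V \<otimes>\<^bsub>MR\<^esub> W"
  proof (rule MR_eqI)
    fix i j assume ij: "i \<in> {1..m}" "j \<in> {1..m}"
    have "(\<Oplus>k\<in>{1..m}. (U (i, k) \<oplus> V (i, k)) \<otimes> W (k, j))
        = (\<Oplus>k\<in>{1..m}. U (i, k) \<otimes> W (k, j) \<oplus> V (i, k) \<otimes> W (k, j))"
      using UVW ij by (intro R.finsum_cong') (auto simp: entry_closed R.l_distr)
    also have "\<dots> = (\<Oplus>k\<in>{1..m}. U (i, k) \<otimes> W (k, j)) \<oplus> (\<Oplus>k\<in>{1..m}. V (i, k) \<otimes> W (k, j))"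
      using UVW ij by (intro R.finsum_addf) (auto simp: entry_closed)
    also have "(\<Oplus>k\<in>{1..m}. (U (i, k) \<oplus> V (i, k)) \<otimes> W (k, j)) = ((U \<oplus>\<^bsub>MR\<^esub> V) \<otimes>\<^bsub>MR\<^esub> W) (i, j)"
      unfolding MR_entry(1)[OF ij]
      using UVW ij by (intro R.finsum_cong') (auto simp: entry_closed MR_entry)
    finally show "((U \<oplus>\<^bsub>MR\<^esub> V) \<otimes>\<^bsub>MR\<^esub> W) (i, j) = (U \<otimes>\<^bsub>MR\<^esub> W \<oplus>\<^bsub>MR\<^esub> V \<otimes>\<^bsub>MR\<^esub> W) (i, j)"
      unfolding MR_entry(2)[OF ij] MR_entry(1)[OF ij] .
  qed (rule MR_extensional)+
  show "W \<otimes>\<^bsub>MR\<^esub> (U \<oplus>\<^bsub>MR\<^esub> V) = W \<otimes>\<^bsub>MR\<^esub> U \<oplus>\<^bsub>MR\<^esub> W \<otimes>\<^bsub>MR\<^esub> V"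
  proof (rule MR_eqI)
    fix i j assume ij: "i \<in> {1..m}" "j \<in> {1..m}"
    have "(\<Oplus>k\<in>{1..m}. W (i, k) \<otimes> (U (k, j) \<oplus> V (k, j)))
        = (\<Oplus>k\<in>{1..m}. W (i, k) \<otimes> U (k, j) \<oplus> W (i, k) \<otimes> V (k, j))"
      using UVW ij by (intro R.finsum_cong') (auto simp: entry_closed R.r_distr)
    also have "\<dots> = (\<Oplus>k\<in>{1..m}. W (i, k) \<otimes> U (k, j)) \<oplus> (\<Oplus>k\<in>{1..m}. W (i, k) \<otimes> V (k, j))"
      using UVW ij by (intro R.finsum_addf) (auto simp: entry_closed)
    also have "(\<Oplus>k\<in>{1..m}. W (i, k) \<otimes> (U (k, j) \<oplus> V (k, j))) = (W \<otimes>\<^bsub>MR\<^esub> (U \<oplus>\<^bsub>MR\<^esub> V)) (i, j)"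
      unfolding MR_entry(1)[OF ij]
      using UVW ij by (intro R.finsum_cong') (auto simp: entry_closed MR_entry)
    finally show "(W \<otimes>\<^bsub>MR\<^esub> (U \<oplus>\<^bsub>MR\<^esub> V)) (i, j) = (W \<otimes>\<^bsub>MR\<^esub> U \<oplus>\<^bsub>MR\<^esub> W \<otimes>\<^bsub>MR\<^esub> V) (i, j)"
      unfolding MR_entry(2)[OF ij] MR_entry(1)[OF ij] .
  qed (rule MR_extensional)+
qed

lemma mu_mult:
  assumes "j \<in> {1..m}" "k \<in> {1..m}" "c \<in> carrier R" "d \<in> carrier R"
  shows "mu i j c \<otimes>\<^bsub>MR\<^esub> mu k l d = (if j = k then mu i l (c \<otimes> d) else \<zero>\<^bsub>MR\<^esub>)"
proof (rule MR_eqI)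
  fix i' l' assume il: "i' \<in> {1..m}" "l' \<in> {1..m}"
  \<comment> \<open>The inner condition does not mention \<open>n\<close>; the outer one singles out
    the summand \<open>n = j\<close>, which is the form that \<open>finsum_singleton\<close>
    evaluates.\<close>
  have "(mu i j c \<otimes>\<^bsub>MR\<^esub> mu k l d) (i', l')
      = (\<Oplus>n\<in>{1..m}. if j = n then (if j = k \<and> i' = i \<and> l' = l then c \<otimes> d else \<zero>) else \<zero>)"
    unfolding MR_entry(1)[OF il]
    using il assms by (intro R.finsum_cong') (auto simp: MR_entry)
  also have "\<dots> = (if j = k \<and> i' = i \<and> l' = l then c \<otimes> d else \<zero>)"
    using assms by (intro R.finsum_singleton) auto
  finally show "(mu i j c \<otimes>\<^bsub>MR\<^esub> mu k l d) (i', l') = (if j = k then mu i l (c \<otimes> d) else \<zero>\<^bsub>MR\<^esub>) (i', l')"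
    using il by (simp add: MR_entry)
qed (simp_all add: MR_extensional)

lemma mu_zero: "mu i j \<zero> = \<zero>\<^bsub>MR\<^esub>"
  by (rule MR_eqI) (auto simp: MR_extensional MR_entry)

lemma mu_add: "c \<in> carrier R \<Longrightarrow> d \<in> carrier R \<Longrightarrow> mu i j (c \<oplus> d) = mu i j c \<oplus>\<^bsub>MR\<^esub> mu i j d"
  by (rule MR_eqI) (auto simp: MR_extensional MR_entry)

lemma mu_finsum:
  assumes "finite A" "\<And>x. x \<in> A \<Longrightarrow> f x \<in> carrier R"
  shows "mu i j (finsum R f A) = (\<Oplus>\<^bsub>MR\<^esub>x\<in>A. mu i j (f x))"
  using assms
proof (induction A rule: finite_induct)
  case (insert a A)
  then have "(\<Oplus>\<^bsub>MR\<^esub>x\<in>insert a A. mu i j (f x)) = mu i j (f a) \<oplus>\<^bsub>MR\<^esub> (\<Oplus>\<^bsub>MR\<^esub>x\<in>A. mu i j (f x))"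
    by (intro MR.finsum_insert) (auto intro: MR_closed)
  then show ?case using insert by (simp add: mu_add)
qed (simp add: mu_zero)

lemma finsum_entry:
  assumes "i \<in> {1..m}" "j \<in> {1..m}" "\<And>x. x \<in> A \<Longrightarrow> f x \<in> carrier MR" "finite A"
  shows "finsum MR f A (i, j) = (\<Oplus>x\<in>A. f x (i, j))"
  using assms(4,3)
proof (induction A rule: finite_induct)
  case (insert a A)
  then have "finsum MR f (insert a A) = f a \<oplus>\<^bsub>MR\<^esub> finsum MR f A"
    by (intro MR.finsum_insert) auto
  moreover have "(\<Oplus>x\<in>insert a A. f x (i, j)) = f a (i, j) \<oplus> (\<Oplus>x\<in>A. f x (i, j))"
    using insert assms by (intro R.finsum_insert) (auto intro: entry_closed)
  ultimately show ?case using insert assms by (simp add: MR_entry)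
qed (use assms in \<open>simp add: MR_entry\<close>)

lemma mu_one_sum: "(\<Oplus>\<^bsub>MR\<^esub>i\<in>{1..m}. mu i i \<one>) = \<one>\<^bsub>MR\<^esub>"
proof (rule MR_eqI)
  have c: "(\<Oplus>\<^bsub>MR\<^esub>i\<in>{1..m}. mu i i \<one>) \<in> carrier MR"
    by (intro MR.finsum_closed) (auto intro: MR_closed)
  then show "(\<Oplus>\<^bsub>MR\<^esub>i\<in>{1..m}. mu i i \<one>) \<in> extensional ({1..m} \<times> {1..m})"
    by (simp add: MR_carrier_iff)
  fix i j assume ij: "i \<in> {1..m}" "j \<in> {1..m}"
  have "(\<Oplus>\<^bsub>MR\<^esub>k\<in>{1..m}. mu k k \<one>) (i, j) = (\<Oplus>k\<in>{1..m}. mu k k \<one> (i, j))"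
    using ij by (intro finsum_entry) (auto intro: MR_closed)
  also have "\<dots> = (\<Oplus>k\<in>{1..m}. if i = k then (if i = j then \<one> else \<zero>) else \<zero>)"
    using ij by (intro R.finsum_cong') (auto simp: MR_entry)
  also have "\<dots> = \<one>\<^bsub>MR\<^esub> (i, j)"
    using ij by (subst R.finsum_singleton) (auto simp: MR_entry)
  finally show "(\<Oplus>\<^bsub>MR\<^esub>k\<in>{1..m}. mu k k \<one>) (i, j) = \<one>\<^bsub>MR\<^esub> (i, j)" .
qed (rule MR_extensional)

lemma scale_mu:
  "c \<in> carrier R \<Longrightarrow> d \<in> carrier R \<Longrightarrow> matrix_scale_right m R (mu i j c) d = mu i j (c \<otimes> d)"
  by (rule MR_eqI) (auto simp: MR_extensional MR_entry)

context
  fixes s :: "'a \<Rightarrow> 'a"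
  assumes s_closed: "\<And>a. a \<in> carrier R \<Longrightarrow> s a \<in> carrier R"
    and s_add: "\<And>a b. a \<in> carrier R \<Longrightarrow> b \<in> carrier R \<Longrightarrow> s (a \<oplus> b) = s a \<oplus> s b"
begin

lemma s_zero: "s \<zero> = \<zero>"
  using s_add[of \<zero> \<zero>] s_closed[of \<zero>] by (metis R.add.l_cancel_one' R.l_zero R.zero_closed)

lemma conj_transpose_mu: "conj_transpose m s (mu i j c) = mu j i (s c)"
  by (rule MR_eqI) (auto simp: MR_extensional MR_entry s_zero)

lemma conj_transpose_closed: "U \<in> carrier MR \<Longrightarrow> conj_transpose m s U \<in> carrier MR"
  by (auto simp: MR_carrier_iff[of "conj_transpose m s U"] MR_extensional MR_entry intro!: s_closed entry_closed)

lemma conj_transpose_add: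
  "U \<in> carrier MR \<Longrightarrow> V \<in> carrier MR \<Longrightarrow>
    conj_transpose m s (U \<oplus>\<^bsub>MR\<^esub> V) = conj_transpose m s U \<oplus>\<^bsub>MR\<^esub> conj_transpose m s V"
  by (rule MR_eqI) (auto simp: MR_extensional MR_entry intro!: s_add entry_closed)

lemma conj_transpose_zero: "conj_transpose m s \<zero>\<^bsub>MR\<^esub> = \<zero>\<^bsub>MR\<^esub>"
  by (rule MR_eqI) (auto simp: MR_extensional MR_entry s_zero)

end

end


section \<open>Words in tensor powers of \<open>\<bbbL>\<^sub>r\<close>\<close>

locale leavitt_tensor_algebra = leavitt_algebra r for r +
  fixes t :: nat
begin

sublocale LT: tensor_algebra L t
  unfolding tensor_algebra_def by (rule L.ring_axioms)

abbreviation "R \<equiv> leavitt_tensor r t"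

lemma R_eq: "R = tensor_power t L"
  by (simp add: leavitt_tensor_def)

sublocale R: ring R
  unfolding R_eq by (rule LT.TP.ring_axioms)

text \<open>Values outside \<open>{1..t}\<close> are unconstrained and ignored by \<open>ty\<close>
  and \<open>tx\<close>, so distinct index functions may name the same word; hence
  \<open>ty_cong\<close>.\<close>

definition indices :: "(nat \<Rightarrow> nat list) set" where
  "indices = {p. \<forall>l\<in>{1..t}. p l \<in> lists {1..r}}"

definition ty :: "(nat \<Rightarrow> nat list) \<Rightarrow> leavitt_tensor" where
  "ty p = pure_tensor t L (\<lambda>l. yw (p l))"

definition tx :: "(nat \<Rightarrow> nat list) \<Rightarrow> leavitt_tensor" where
  "tx p = pure_tensor t L (\<lambda>l. xw (p l))"

definition weight :: "leavitt_tensor \<Rightarrow> int" where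
  "weight = tensor_weight t (leavitt_weight r)"

abbreviation "star \<equiv> tensor_map t leavitt_star"

lemma indicesD: "p \<in> indices \<Longrightarrow> l \<in> {1..t} \<Longrightarrow> p l \<in> lists {1..r}"
  unfolding indices_def by blast

lemma indicesI: "(\<And>l. l \<in> {1..t} \<Longrightarrow> p l \<in> lists {1..r}) \<Longrightarrow> p \<in> indices"
  unfolding indices_def by blast

lemma indices_append: "p \<in> indices \<Longrightarrow> q \<in> indices \<Longrightarrow> (\<lambda>l. p l @ q l) \<in> indices"
  by (intro indicesI) (simp only: append_in_lists_conv indicesD)

lemma pure_zero_slot:
  "(\<And>j. j \<in> {1..t} \<Longrightarrow> p j \<in> carrier L) \<Longrightarrow> l \<in> {1..t} \<Longrightarrow> p l = \<zero>\<^bsub>L\<^esub> \<Longrightarrow>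
    pure_tensor t L p = \<zero>\<^bsub>R\<^esub>"
  unfolding R_eq by (rule LT.pure_zero)

lemma ty_closed [simp]: "p \<in> indices \<Longrightarrow> ty p \<in> carrier R"
  and tx_closed [simp]: "p \<in> indices \<Longrightarrow> tx p \<in> carrier R"
  unfolding ty_def tx_def R_eq by (auto intro!: LT.pure_closed yw_closed xw_closed dest: indicesD)

lemma ty_cong: "(\<And>l. l \<in> {1..t} \<Longrightarrow> p l = q l) \<Longrightarrow> ty p = ty q"
  unfolding ty_def by (intro LT.pure_cong) simp

lemma ty_mult: "p \<in> indices \<Longrightarrow> q \<in> indices \<Longrightarrow> ty p \<otimes>\<^bsub>R\<^esub> ty q = ty (\<lambda>l. p l @ q l)"
  unfolding ty_def R_eq
  by (subst LT.pure_mult) (auto intro!: yw_closed LT.pure_cong yw_append[symmetric] dest: indicesD)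

lemma tx_mult: "p \<in> indices \<Longrightarrow> q \<in> indices \<Longrightarrow> tx p \<otimes>\<^bsub>R\<^esub> tx q = tx (\<lambda>l. q l @ p l)"
  unfolding tx_def R_eq
  by (subst LT.pure_mult) (auto intro!: xw_closed LT.pure_cong xw_append[symmetric] dest: indicesD)

lemma ty_tx: "p \<in> indices \<Longrightarrow> q \<in> indices \<Longrightarrow> ty p \<otimes>\<^bsub>R\<^esub> tx q = pure_tensor t L (\<lambda>l. yw (p l) \<otimes>\<^bsub>L\<^esub> xw (q l))"
  unfolding ty_def tx_def R_eq by (rule LT.pure_mult) (auto intro!: yw_closed xw_closed dest: indicesD)

lemma tx_ty: "p \<in> indices \<Longrightarrow> q \<in> indices \<Longrightarrow> tx p \<otimes>\<^bsub>R\<^esub> ty q = pure_tensor t L (\<lambda>l. xw (p l) \<otimes>\<^bsub>L\<^esub> yw (q l))"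
  unfolding ty_def tx_def R_eq by (rule LT.pure_mult) (auto intro!: yw_closed xw_closed dest: indicesD)

lemma pure_one: "pure_tensor t L (\<lambda>_. \<one>\<^bsub>L\<^esub>) = \<one>\<^bsub>R\<^esub>"
  unfolding R_eq by (rule LT.pure_one)

lemma ty_Nil: "ty (\<lambda>_. []) = \<one>\<^bsub>R\<^esub>" and tx_Nil: "tx (\<lambda>_. []) = \<one>\<^bsub>R\<^esub>"
  by (simp_all add: ty_def tx_def pure_one)

lemma Nil_indices [simp]: "(\<lambda>_. []) \<in> indices"
  by (simp add: indices_def)

text \<open>All slots cancel completely; one mismatch puts a zero in its slot and so kills the whole
  tensor.\<close>

lemma tx_ty_same_length:
  assumes "p \<in> indices" "q \<in> indices" "\<And>l. l \<in> {1..t} \<Longrightarrow> length (p l) = length (q l)"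
  shows "tx p \<otimes>\<^bsub>R\<^esub> ty q = (if \<forall>l\<in>{1..t}. p l = q l then \<one>\<^bsub>R\<^esub> else \<zero>\<^bsub>R\<^esub>)"
proof -
  have e: "xw (p l) \<otimes>\<^bsub>L\<^esub> yw (q l) = (if p l = q l then \<one>\<^bsub>L\<^esub> else \<zero>\<^bsub>L\<^esub>)" if "l \<in> {1..t}" for l
    using assms that by (intro xw_yw) (auto dest: indicesD)
  show ?thesis
  proof (cases "\<forall>l\<in>{1..t}. p l = q l")
    case True
    then have "tx p \<otimes>\<^bsub>R\<^esub> ty q = pure_tensor t L (\<lambda>_. \<one>\<^bsub>L\<^esub>)"
      unfolding tx_ty[OF assms(1,2)] by (intro LT.pure_cong) (metis e)
    then show ?thesis using True by (simp add: pure_one)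
  next
    case False
    then obtain l where l: "l \<in> {1..t}" "p l \<noteq> q l" by blast
    have "tx p \<otimes>\<^bsub>R\<^esub> ty q = \<zero>\<^bsub>R\<^esub>"
      unfolding tx_ty[OF assms(1,2)] by (rule pure_zero_slot[OF _ l(1)]) (use e l in auto)
    then show ?thesis using False by auto
  qed
qed

definition unit_index :: "nat \<Rightarrow> nat \<Rightarrow> nat \<Rightarrow> nat list" where
  "unit_index l k = (\<lambda>n. if n = l then [k] else [])"

lemma unit_index_in [simp]: "k \<in> {1..r} \<Longrightarrow> unit_index l k \<in> indices"
  by (auto simp: unit_index_def indices_def)

lemma tensor_y_eq: "tensor_y r t l k = ty (unit_index l k)"
  unfolding tensor_y_def ty_def by (rule LT.pure_cong) (simp add: unit_index_def leavitt_y_eq yw_def wd_Nil)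

lemma tx_ty_unit:
  assumes "k \<in> {1..r}" "k' \<in> {1..r}" "l \<in> {1..t}"
  shows "tx (unit_index l k) \<otimes>\<^bsub>R\<^esub> ty (unit_index l k') = (if k = k' then \<one>\<^bsub>R\<^esub> else \<zero>\<^bsub>R\<^esub>)"
proof -
  have "(\<forall>n\<in>{1..t}. unit_index l k n = unit_index l k' n) \<longleftrightarrow> k = k'"
    using assms(3) by (auto simp: unit_index_def)
  moreover have "length (unit_index l k n) = length (unit_index l k' n)" for n
    by (simp add: unit_index_def)
  ultimately show ?thesis
    using tx_ty_same_length[OF unit_index_in[OF assms(1)] unit_index_in[OF assms(2)]] by simp
qed

text \<open>The other slots all hold the unit, so linearity in slot \<open>l\<close> pulls the sum
  inside, where the second defining relation of the Leavitt ring applies.\<close>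

lemma ty_tx_unit_sum:
  assumes "l \<in> {1..t}"
  shows "(\<Oplus>\<^bsub>R\<^esub>k\<in>{1..r}. ty (unit_index l k) \<otimes>\<^bsub>R\<^esub> tx (unit_index l k)) = \<one>\<^bsub>R\<^esub>"
proof -
  let ?f = "\<lambda>k. wd [GenY k] \<otimes>\<^bsub>L\<^esub> wd [GenX k]"
  let ?g = "\<lambda>k. pure_tensor t L ((\<lambda>_. \<one>\<^bsub>L\<^esub>)(l := ?f k))"
  have f: "?f k \<in> carrier L" if "k \<in> {1..r}" for k
    using that by auto
  have "ty (unit_index l k) \<otimes>\<^bsub>R\<^esub> tx (unit_index l k) = ?g k" if "k \<in> {1..r}" for k
    unfolding ty_tx[OF unit_index_in[OF that] unit_index_in[OF that]]
    by (rule LT.pure_cong) (auto simp: unit_index_def yw_def xw_def wd_Nil)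
  then have "(\<Oplus>\<^bsub>R\<^esub>k\<in>{1..r}. ty (unit_index l k) \<otimes>\<^bsub>R\<^esub> tx (unit_index l k)) = (\<Oplus>\<^bsub>R\<^esub>k\<in>{1..r}. ?g k)"
    unfolding R_eq using f by (intro LT.TP.finsum_cong') (auto intro!: LT.pure_closed)
  also have "\<dots> = pure_tensor t L ((\<lambda>_. \<one>\<^bsub>L\<^esub>)(l := finsum L ?f {1..r}))"
    unfolding R_eq using f assms by (intro LT.pure_finsum[symmetric]) auto
  also have "\<dots> = \<one>\<^bsub>R\<^esub>"
    unfolding wd_yx_sum by (subst pure_one[symmetric]) (rule LT.pure_cong, simp)
  finally show ?thesis .
qed

text \<open>Normal forms are chosen slot by slot; the only obstruction is a slot holding zero, which
  makes the tensor zero.\<close>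

lemma pure_monomial_normal_form:
  assumes "w \<in> {1..t} \<rightarrow> leavitt_monomials r"
  shows "pure_tensor t L w = \<zero>\<^bsub>R\<^esub> \<or> (\<exists>p\<in>indices. \<exists>q\<in>indices. pure_tensor t L w = ty p \<otimes>\<^bsub>R\<^esub> tx q)"
proof (cases "\<exists>l\<in>{1..t}. w l = \<zero>\<^bsub>L\<^esub>")
  case True
  then obtain l where l: "l \<in> {1..t}" "w l = \<zero>\<^bsub>L\<^esub>" ..
  have "w j \<in> carrier L" if "j \<in> {1..t}" for j
  proof -
    obtain u where u: "u \<in> lists gens" "w j = wd u"
      using assms \<open>j \<in> {1..t}\<close> unfolding leavitt_monomials_eq by blast
    show ?thesis unfolding u(2) using u(1) by (rule wd_closed)
  qed
  then have "pure_tensor t L w = \<zero>\<^bsub>R\<^esub>"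
    using l by (rule pure_zero_slot)
  then show ?thesis ..
next
  case False
  \<comment> \<open>Both index words of a slot are packed into one pair, so that a single choice
    function yields them together.\<close>
  have "\<forall>l. \<exists>ab. l \<in> {1..t} \<longrightarrow>
    fst ab \<in> lists {1..r} \<and> snd ab \<in> lists {1..r} \<and> w l = yw (fst ab) \<otimes>\<^bsub>L\<^esub> xw (snd ab)"
  proof (intro allI)
    fix l
    show "\<exists>ab. l \<in> {1..t} \<longrightarrow>
      fst ab \<in> lists {1..r} \<and> snd ab \<in> lists {1..r} \<and> w l = yw (fst ab) \<otimes>\<^bsub>L\<^esub> xw (snd ab)"
    proof (cases "l \<in> {1..t}")
      case True
      then obtain u where u: "u \<in> lists gens" "w l = wd u"
        using assms unfolding leavitt_monomials_eq by blast
      then obtain \<alpha> \<beta> where "\<alpha> \<in> lists {1..r}" "\<beta> \<in> lists {1..r}" "w l = yw \<alpha> \<otimes>\<^bsub>L\<^esub> xw \<beta>"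
        using wd_normal_form[OF u(1)] False True by metis
      then show ?thesis by (intro exI[of _ "(\<alpha>, \<beta>)"]) simp
    qed blast
  qed
  from choice[OF this] obtain f where f: "\<And>l. l \<in> {1..t} \<Longrightarrow> fst (f l) \<in> lists {1..r}"
    "\<And>l. l \<in> {1..t} \<Longrightarrow> snd (f l) \<in> lists {1..r}"
    "\<And>l. l \<in> {1..t} \<Longrightarrow> w l = yw (fst (f l)) \<otimes>\<^bsub>L\<^esub> xw (snd (f l))"
    by blast
  have p: "(\<lambda>l. fst (f l)) \<in> indices" and q: "(\<lambda>l. snd (f l)) \<in> indices"
    by (rule indicesI, rule f(1), assumption, rule indicesI, rule f(2), assumption)
  have "pure_tensor t L w = ty (\<lambda>l. fst (f l)) \<otimes>\<^bsub>R\<^esub> tx (\<lambda>l. snd (f l))"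
    unfolding ty_tx[OF p q] by (rule LT.pure_cong) (rule f(3))
  then show ?thesis using p q by blast
qed

lemma ty_tx_monomial:
  assumes "p \<in> indices" "q \<in> indices"
  shows "\<exists>w\<in>{1..t} \<rightarrow> leavitt_monomials r. ty p \<otimes>\<^bsub>R\<^esub> tx q = pure_tensor t L w"
proof
  show "(\<lambda>l. yw (p l) \<otimes>\<^bsub>L\<^esub> xw (q l)) \<in> {1..t} \<rightarrow> leavitt_monomials r"
    using assms by (auto intro!: yw_xw_monomial dest: indicesD)
qed (rule ty_tx[OF assms])

section \<open>Involution and weight on the tensor power\<close>

lemma star_add:
  "a \<in> carrier R \<Longrightarrow> b \<in> carrier R \<Longrightarrow> star (a \<oplus>\<^bsub>R\<^esub> b) = star a \<oplus>\<^bsub>R\<^esub> star b"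
  unfolding R_eq
  by (rule LT.tensor_map_add) (simp_all add: leavitt_star_closed leavitt_star_star leavitt_star_add)

lemma star_closed: "a \<in> carrier R \<Longrightarrow> star a \<in> carrier R"
  unfolding R_eq
  by (rule LT.tensor_map_closed) (simp_all add: leavitt_star_closed leavitt_star_star leavitt_star_add)

lemma star_ty_tx:
  assumes "p \<in> indices" "q \<in> indices"
  shows "star (ty p \<otimes>\<^bsub>R\<^esub> tx q) = ty q \<otimes>\<^bsub>R\<^esub> tx p"
proof -
  have "star (ty p \<otimes>\<^bsub>R\<^esub> tx q) = pure_tensor t L (\<lambda>l. leavitt_star (yw (p l) \<otimes>\<^bsub>L\<^esub> xw (q l)))"
    unfolding ty_tx[OF assms]
    by (rule LT.tensor_map_pure) (simp_all add: leavitt_star_closed leavitt_star_star leavitt_star_add)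
  also have "\<dots> = ty q \<otimes>\<^bsub>R\<^esub> tx p"
    unfolding ty_tx[OF assms(2,1)]
    using assms by (intro LT.pure_cong leavitt_star_yw_xw) (auto dest: indicesD)
  finally show ?thesis .
qed

lemma star_ty: "p \<in> indices \<Longrightarrow> star (ty p) = tx p"
  using star_ty_tx[of p "\<lambda>_. []"] by (simp add: ty_Nil tx_Nil)

lemma weight_add:
  "a \<in> carrier R \<Longrightarrow> b \<in> carrier R \<Longrightarrow> weight (a \<oplus>\<^bsub>R\<^esub> b) = weight a + weight b"
  unfolding R_eq weight_def by (rule LT.tensor_weight_add) (simp_all add: leavitt_weight_add)

lemma weight_pure:
  "(\<And>j. j \<in> {1..t} \<Longrightarrow> p j \<in> carrier L) \<Longrightarrow>
    weight (pure_tensor t L p) = (\<Prod>l\<in>{1..t}. leavitt_weight r (p l))"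
  unfolding weight_def by (rule LT.tensor_weight_pure) (simp_all add: leavitt_weight_add)

lemma weight_one: "weight \<one>\<^bsub>R\<^esub> = 1"
  unfolding pure_one[symmetric] by (subst weight_pure) (auto simp: leavitt_weight_one)

lemma weight_zero: "weight \<zero>\<^bsub>R\<^esub> = 0"
  using weight_add[of "\<zero>\<^bsub>R\<^esub>" "\<zero>\<^bsub>R\<^esub>"] by simp

text \<open>Each slot is a product of monomials, hence a monomial. Its weight is non-negative
  whatever cancels in it, so no comparison of \<open>p\<close> and \<open>q\<close> has to be
  made.\<close>

lemma weight_tx_ty_nonneg:
  assumes "p \<in> indices" "q \<in> indices" shows "0 \<le> weight (tx p \<otimes>\<^bsub>R\<^esub> ty q)"
proof -
  have "xw (p l) \<otimes>\<^bsub>L\<^esub> yw (q l) \<in> leavitt_monomials r" if "l \<in> {1..t}" for l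
    using assms that yw_xw_monomial[of "[]" "p l"] yw_xw_monomial[of "q l" "[]"]
    by (auto dest!: indicesD simp: leavitt_monomials_def intro: submonoid_generated.mult)
  then show ?thesis
    unfolding tx_ty[OF assms] using assms
    by (subst weight_pure)
      (auto intro!: prod_nonneg leavitt_weight_nonneg L.m_closed xw_closed yw_closed dest: indicesD)
qed

text \<open>For the converse inclusion the induction is on the total length over all slots: letters
  in different slots commute, so any nonempty slot may give up a letter.\<close>

lemma words_Y_eq: "words_Y r t = ty ` indices"
proof
  show "words_Y r t \<subseteq> ty ` indices"
  proof
    fix a assume "a \<in> words_Y r t"
    then show "a \<in> ty ` indices"
      unfolding words_Y_def
    proof (induction rule: submonoid_generated.induct)
      case one
      show ?case by (rule image_eqI[where x = "\<lambda>_. []"]) (simp_all add: ty_Nil)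
    next
      case (incl s)
      then show ?case by (auto simp: tensor_y_eq)
    next
      case (mult a b)
      then obtain p q where "p \<in> indices" "q \<in> indices" "a = ty p" "b = ty q" by auto
      then show ?case by (auto simp: ty_mult indices_append)
    qed
  qed
next
  have "ty p \<in> words_Y r t" if "p \<in> indices" "n = (\<Sum>l\<in>{1..t}. length (p l))" for p n
    using that
  proof (induction n arbitrary: p)
    case 0
    then have "ty p = \<one>\<^bsub>R\<^esub>" unfolding ty_Nil[symmetric] by (intro ty_cong) auto
    then show ?case unfolding words_Y_def by (simp add: submonoid_generated.one)
  next
    case (Suc n)
    have "\<exists>l\<in>{1..t}. p l \<noteq> []"
    proof (rule ccontr)
      assume "\<not> ?thesis"
      then have "(\<Sum>l\<in>{1..t}. length (p l)) = 0" by (intro sum.neutral) auto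
      then show False using Suc by simp
    qed
    then obtain l where l: "l \<in> {1..t}" "p l \<noteq> []" by blast
    \<comment> \<open>The letter is taken from the end because it is put back by multiplication on
      the right.\<close>
    define q where "q = p(l := butlast (p l))"
    define k where "k = last (p l)"
    have pl: "p l = butlast (p l) @ [k]" using l by (simp add: k_def)
    have k: "k \<in> {1..r}" and b: "butlast (p l) \<in> lists {1..r}"
      using indicesD[OF Suc.prems(1) l(1)] pl by (metis append_in_lists_conv Cons_in_lists_iff)+
    have q: "q \<in> indices" using Suc.prems(1) b by (auto simp: q_def indices_def)
    have "(\<Sum>j\<in>{1..t}. length (p j)) = length (p l) + (\<Sum>j\<in>{1..t}-{l}. length (p j))"
      "(\<Sum>j\<in>{1..t}. length (q j)) = length (q l) + (\<Sum>j\<in>{1..t}-{l}. length (q j))"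
      using l by (auto intro: sum.remove)
    moreover have "(\<Sum>j\<in>{1..t}-{l}. length (p j)) = (\<Sum>j\<in>{1..t}-{l}. length (q j))"
      by (rule sum.cong) (auto simp: q_def)
    moreover have "length (p l) = Suc (length (q l))" using l by (simp add: q_def)
    ultimately have "n = (\<Sum>j\<in>{1..t}. length (q j))" using Suc.prems(2) by simp
    then have "ty q \<in> words_Y r t" by (rule Suc.IH[OF q])
    moreover have "tensor_y r t l k \<in> words_Y r t"
      unfolding words_Y_def using l k by (intro submonoid_generated.incl) blast
    ultimately have "ty q \<otimes>\<^bsub>R\<^esub> tensor_y r t l k \<in> words_Y r t"
      unfolding words_Y_def by (rule submonoid_generated.mult)
    also have "ty q \<otimes>\<^bsub>R\<^esub> tensor_y r t l k = ty p"
      unfolding tensor_y_eq ty_mult[OF q unit_index_in[OF k]]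
      by (rule ty_cong) (use pl in \<open>auto simp: q_def unit_index_def\<close>)
    finally show ?case .
  qed
  then show "ty ` indices \<subseteq> words_Y r t" by blast
qed

end


section \<open>Word matrices and their adjoints\<close>

locale leavitt_matrix_algebra = leavitt_tensor_algebra r t for r t +
  fixes m :: nat
  assumes m_pos: "1 \<le> m"
begin

abbreviation "M \<equiv> leavitt_matrices r t m"
abbreviation "mu \<equiv> matrix_unit m R"
abbreviation "adj \<equiv> leavitt_adjoint t m"
abbreviation "W \<equiv> words_W r t m"
abbreviation "ch \<equiv> child r t m"
abbreviation "e \<equiv> mu 1 1 \<one>\<^bsub>R\<^esub>"

sublocale MM: matrix_algebra R m
  unfolding matrix_algebra_def by (rule R.ring_axioms)

lemma M_eq: "M = MM.MR"
  by (simp add: leavitt_matrices_def)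

sublocale M: ring M
  unfolding M_eq by (rule MM.MR.ring_axioms)

lemma one_in [simp]: "1 \<in> {1..m}"
  using m_pos by simp

lemma mu_mult:
  "j \<in> {1..m} \<Longrightarrow> k \<in> {1..m} \<Longrightarrow> c \<in> carrier R \<Longrightarrow> d \<in> carrier R \<Longrightarrow>
    mu i j c \<otimes>\<^bsub>M\<^esub> mu k l d = (if j = k then mu i l (c \<otimes>\<^bsub>R\<^esub> d) else \<zero>\<^bsub>M\<^esub>)"
  unfolding M_eq by (rule MM.mu_mult)

lemma mu_closed [simp]: "c \<in> carrier R \<Longrightarrow> mu i j c \<in> carrier M"
  unfolding M_eq by (rule MM.MR_closed(5))

lemma mu_zero: "mu i j \<zero>\<^bsub>R\<^esub> = \<zero>\<^bsub>M\<^esub>"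
  unfolding M_eq by (rule MM.mu_zero)

lemma e_closed [simp]: "e \<in> carrier M"
  by simp

lemma adj_mu: "adj (mu i j c) = mu j i (star c)"
  unfolding leavitt_adjoint_def
  by (rule MM.conj_transpose_mu) (simp_all add: star_closed star_add)

lemma adj_closed [simp]: "U \<in> carrier M \<Longrightarrow> adj U \<in> carrier M"
  unfolding leavitt_adjoint_def M_eq
  by (rule MM.conj_transpose_closed) (simp_all add: star_closed star_add)

lemma adj_add:
  "U \<in> carrier M \<Longrightarrow> V \<in> carrier M \<Longrightarrow> adj (U \<oplus>\<^bsub>M\<^esub> V) = adj U \<oplus>\<^bsub>M\<^esub> adj V"
  unfolding leavitt_adjoint_def M_eq
  by (rule MM.conj_transpose_add) (simp_all add: star_closed star_add)

lemma adj_zero: "adj \<zero>\<^bsub>M\<^esub> = \<zero>\<^bsub>M\<^esub>"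
  unfolding leavitt_adjoint_def M_eq
  by (rule MM.conj_transpose_zero) (simp_all add: star_closed star_add)

definition wv :: "nat \<Rightarrow> (nat \<Rightarrow> nat list) \<Rightarrow> leavitt_matrix" where
  "wv i p = mu i 1 (ty p)"

lemma W_iff: "a \<in> W \<longleftrightarrow> (\<exists>i\<in>{1..m}. \<exists>p\<in>indices. a = wv i p)"
  unfolding words_W_def words_Y_eq wv_def by blast

lemma W_cases:
  assumes "a \<in> W" obtains i p where "i \<in> {1..m}" "p \<in> indices" "a = wv i p"
  using assms W_iff by blast

lemma adj_wv: "p \<in> indices \<Longrightarrow> adj (wv i p) = mu 1 i (tx p)"
  by (simp add: wv_def adj_mu star_ty)

lemma W_closed: "a \<in> W \<Longrightarrow> a \<in> carrier M"
  by (erule W_cases) (simp add: wv_def)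

lemma adj_wv_mult:
  assumes "i \<in> {1..m}" "j \<in> {1..m}" "p \<in> indices" "q \<in> indices"
  shows "adj (wv i p) \<otimes>\<^bsub>M\<^esub> wv j q = (if i = j then mu 1 1 (tx p \<otimes>\<^bsub>R\<^esub> ty q) else \<zero>\<^bsub>M\<^esub>)"
  unfolding adj_wv[OF assms(3)] unfolding wv_def using assms by (simp add: mu_mult)

lemma wv_mult_adj:
  assumes "i \<in> {1..m}" "j \<in> {1..m}" "p \<in> indices" "q \<in> indices"
  shows "wv i p \<otimes>\<^bsub>M\<^esub> adj (wv j q) = mu i j (ty p \<otimes>\<^bsub>R\<^esub> tx q)"
  unfolding adj_wv[OF assms(4)] unfolding wv_def using assms mu_mult[OF one_in one_in] by simp

lemma adj_self: "a \<in> W \<Longrightarrow> adj a \<otimes>\<^bsub>M\<^esub> a = e"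
  by (erule W_cases) (simp add: adj_wv_mult tx_ty_same_length)

lemma W_e: "a \<in> W \<Longrightarrow> a \<otimes>\<^bsub>M\<^esub> e = a"
  by (erule W_cases) (use mu_mult[OF one_in one_in] in \<open>simp add: wv_def\<close>)

text \<open>Reversal of a product under the adjoint is used in this shape only, where the normal
  form of the entry provides it.\<close>

lemma adj_outer:
  assumes "a \<in> W" "b \<in> W" shows "adj (a \<otimes>\<^bsub>M\<^esub> adj b) = b \<otimes>\<^bsub>M\<^esub> adj a"
  using assms by (elim W_cases) (simp add: wv_mult_adj adj_mu star_ty_tx)

text \<open>Words are matrices with one nonzero column, the first. A letter placed in the corner
  \<open>(1, 1)\<close> multiplies them from the right, so \<open>child\<close> becomes a product
  inside \<open>M\<close>.\<close>

definition yc :: "nat \<Rightarrow> nat \<Rightarrow> leavitt_matrix" where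
  "yc l s = mu 1 1 (ty (unit_index l s))"

definition xc :: "nat \<Rightarrow> nat \<Rightarrow> leavitt_matrix" where
  "xc l s = mu 1 1 (tx (unit_index l s))"

lemma yc_closed [simp]: "s \<in> {1..r} \<Longrightarrow> yc l s \<in> carrier M"
  and xc_closed [simp]: "s \<in> {1..r} \<Longrightarrow> xc l s \<in> carrier M"
  unfolding yc_def xc_def by (auto intro!: mu_closed ty_closed tx_closed unit_index_in)

lemma xc_yc:
  assumes "s \<in> {1..r}" "s' \<in> {1..r}" "l \<in> {1..t}"
  shows "xc l s \<otimes>\<^bsub>M\<^esub> yc l s' = (if s = s' then e else \<zero>\<^bsub>M\<^esub>)"
  unfolding yc_def xc_def
  using assms mu_mult[OF one_in one_in tx_closed[OF unit_index_in[OF assms(1)]] ty_closed[OF unit_index_in[OF assms(2)]]]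
  by (simp only: tx_ty_unit mu_zero if_True split: if_split) simp

lemma yc_xc_sum:
  assumes "l \<in> {1..t}"
  shows "(\<Oplus>\<^bsub>M\<^esub>s\<in>{1..r}. yc l s \<otimes>\<^bsub>M\<^esub> xc l s) = e"
proof -
  have c: "ty (unit_index l s) \<otimes>\<^bsub>R\<^esub> tx (unit_index l s) \<in> carrier R" if "s \<in> {1..r}" for s
    using that by (intro R.m_closed ty_closed tx_closed unit_index_in)
  have "yc l s \<otimes>\<^bsub>M\<^esub> xc l s = mu 1 1 (ty (unit_index l s) \<otimes>\<^bsub>R\<^esub> tx (unit_index l s))"
    if "s \<in> {1..r}" for s
    unfolding yc_def xc_def
    using mu_mult[OF one_in one_in ty_closed[OF unit_index_in[OF that]] tx_closed[OF unit_index_in[OF that]]]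
    by simp
  then have "(\<Oplus>\<^bsub>M\<^esub>s\<in>{1..r}. yc l s \<otimes>\<^bsub>M\<^esub> xc l s)
      = (\<Oplus>\<^bsub>M\<^esub>s\<in>{1..r}. mu 1 1 (ty (unit_index l s) \<otimes>\<^bsub>R\<^esub> tx (unit_index l s)))"
    using c by (intro M.finsum_cong') auto
  also have "\<dots> = mu 1 1 (\<Oplus>\<^bsub>R\<^esub>s\<in>{1..r}. ty (unit_index l s) \<otimes>\<^bsub>R\<^esub> tx (unit_index l s))"
    unfolding M_eq using c by (intro MM.mu_finsum[symmetric]) auto
  finally show ?thesis using ty_tx_unit_sum[OF assms] by simp
qed

lemma child_wv:
  assumes "i \<in> {1..m}" "p \<in> indices" "s \<in> {1..r}"
  shows "ch l (wv i p) s = wv i (\<lambda>n. p n @ unit_index l s n)"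
  unfolding child_def wv_def tensor_y_eq
  using assms by (subst MM.scale_mu) (auto simp: ty_mult)

lemma child_in_W:
  assumes "a \<in> W" "s \<in> {1..r}" shows "ch l a s \<in> W"
  using assms(1)
proof (rule W_cases)
  fix i p assume *: "i \<in> {1..m}" "p \<in> indices" "a = wv i p"
  have "(\<lambda>n. p n @ unit_index l s n) \<in> indices"
    using * assms(2) by (intro indices_append unit_index_in)
  then show ?thesis
    unfolding *(3) child_wv[OF *(1,2) assms(2)] W_iff using *(1) by blast
qed

lemma child_eq:
  assumes "a \<in> W" "s \<in> {1..r}" shows "ch l a s = a \<otimes>\<^bsub>M\<^esub> yc l s"
  using assms(1)
proof (rule W_cases)
  fix i p assume *: "i \<in> {1..m}" "p \<in> indices" "a = wv i p"
  have "unit_index l s \<in> indices" using assms(2) by (rule unit_index_in)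
  then show ?thesis
    using * assms(2) mu_mult[OF one_in one_in]
    by (simp only: child_wv) (simp add: wv_def yc_def ty_mult)
qed

lemma adj_child:
  assumes "a \<in> W" "s \<in> {1..r}" shows "adj (ch l a s) = xc l s \<otimes>\<^bsub>M\<^esub> adj a"
  using assms(1)
proof (rule W_cases)
  fix i p assume *: "i \<in> {1..m}" "p \<in> indices" "a = wv i p"
  have u: "unit_index l s \<in> indices" using assms(2) by (rule unit_index_in)
  show ?thesis
    using * u assms(2) mu_mult[OF one_in one_in]
    by (simp only: child_wv adj_wv indices_append) (simp add: xc_def tx_mult)
qed

lemma initial_basis_eq: "initial_basis r t m = (\<lambda>i. wv i (\<lambda>_. [])) ` {1..m}"
  unfolding initial_basis_def wv_def ty_Nil ..

lemma initial_complete: "(\<Oplus>\<^bsub>M\<^esub>i\<in>{1..m}. wv i (\<lambda>_. []) \<otimes>\<^bsub>M\<^esub> adj (wv i (\<lambda>_. []))) = \<one>\<^bsub>M\<^esub>"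
proof -
  have "(\<Oplus>\<^bsub>M\<^esub>i\<in>{1..m}. wv i (\<lambda>_. []) \<otimes>\<^bsub>M\<^esub> adj (wv i (\<lambda>_. []))) = (\<Oplus>\<^bsub>M\<^esub>i\<in>{1..m}. mu i i \<one>\<^bsub>R\<^esub>)"
    by (intro M.finsum_cong') (simp_all add: wv_mult_adj ty_Nil tx_Nil)
  then show ?thesis unfolding M_eq by (simp add: MM.mu_one_sum)
qed

text \<open>Products \<open>adj a\<close> times \<open>b\<close> of words are concentrated in the
  corner, so this entry carries all that has to be weighed.\<close>

definition wt :: "leavitt_matrix \<Rightarrow> int" where "wt U = weight (U (1, 1))"

lemma wt_add: "U \<in> carrier M \<Longrightarrow> V \<in> carrier M \<Longrightarrow> wt (U \<oplus>\<^bsub>M\<^esub> V) = wt U + wt V"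
  unfolding wt_def M_eq
  by (simp add: MM.MR_entry(2)[OF one_in one_in] MM.entry_closed[OF _ one_in one_in] weight_add)

lemma wt_mu: "wt (mu 1 1 c) = weight c"
  unfolding wt_def by (simp add: MM.MR_entry(5)[OF one_in one_in])

lemma wt_e: "wt e = 1"
  by (simp add: wt_mu weight_one)

lemma wt_zero: "wt \<zero>\<^bsub>M\<^esub> = 0"
  using wt_mu[of "\<zero>\<^bsub>R\<^esub>"] by (simp add: mu_zero weight_zero)

text \<open>The weight rules out a collapse of the quotients. Distinctness of words is derived from
  this through \<open>orthogonal_imp_neq\<close>.\<close>

lemma e_nonzero: "e \<noteq> \<zero>\<^bsub>M\<^esub>"
  using wt_e wt_zero by auto

lemma wt_adj_mult_nonneg: "a \<in> W \<Longrightarrow> b \<in> W \<Longrightarrow> 0 \<le> wt (adj a \<otimes>\<^bsub>M\<^esub> b)"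
  by (elim W_cases) (auto simp: adj_wv_mult wt_mu wt_zero weight_tx_ty_nonneg)

section \<open>Generators of the positive cone as products of a word and an adjoint word\<close>

definition cone_gens :: "leavitt_matrix set" where
  "cone_gens = {mu i j (pure_tensor t L w) | i j w.
    i \<in> {1..m} \<and> j \<in> {1..m} \<and> w \<in> {1..t} \<rightarrow> leavitt_monomials r}"

lemma positive_cone_eq: "positive_cone r t m = submonoid_generated (add_monoid M) cone_gens"
  unfolding positive_cone_def cone_gens_def ..

lemma outer_in_cone_gens:
  assumes "a \<in> W" "b \<in> W" shows "a \<otimes>\<^bsub>M\<^esub> adj b \<in> cone_gens"
proof -
  obtain i p j q where *: "i \<in> {1..m}" "p \<in> indices" "a = wv i p"
    "j \<in> {1..m}" "q \<in> indices" "b = wv j q"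
    using assms by (elim W_cases) blast
  obtain w where "w \<in> {1..t} \<rightarrow> leavitt_monomials r" "ty p \<otimes>\<^bsub>R\<^esub> tx q = pure_tensor t L w"
    using ty_tx_monomial[OF *(2,5)] by blast
  then show ?thesis unfolding cone_gens_def using * wv_mult_adj[of i j p q] by auto
qed

text \<open>A matrix unit with an entry in normal form splits at the middle index 1. The zero case
  is real: a product of generators of the Leavitt ring may vanish.\<close>

lemma cone_gens_cases:
  assumes "U \<in> cone_gens"
  shows "U = \<zero>\<^bsub>M\<^esub> \<or> (\<exists>a\<in>W. \<exists>b\<in>W. U = a \<otimes>\<^bsub>M\<^esub> adj b)"
proof -
  obtain i j w where *: "i \<in> {1..m}" "j \<in> {1..m}" "w \<in> {1..t} \<rightarrow> leavitt_monomials r"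
    "U = mu i j (pure_tensor t L w)"
    using assms unfolding cone_gens_def by blast
  from pure_monomial_normal_form[OF *(3)] show ?thesis
  proof (elim disjE bexE)
    assume "pure_tensor t L w = \<zero>\<^bsub>R\<^esub>"
    then show ?thesis using *(4) mu_zero by simp
  next
    fix p q assume "p \<in> indices" "q \<in> indices" "pure_tensor t L w = ty p \<otimes>\<^bsub>R\<^esub> tx q"
    then show ?thesis using * wv_mult_adj[of i j p q] W_iff by metis
  qed
qed

text \<open>The index \<open>d\<close> is the number of letters missing to reach length \<open>N\<close> in all coordinates.\<close>

definition lev :: "nat \<Rightarrow> nat \<Rightarrow> leavitt_matrix set" where
  "lev N d = {wv i p | i p. i \<in> {1..m} \<and> p \<in> indices \<and> (\<forall>l\<in>{1..t}. length (p l) \<le> N) \<and>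
     (\<Sum>l\<in>{1..t}. N - length (p l)) = d}"

lemma lev_W: "a \<in> lev N d \<Longrightarrow> a \<in> W"
  unfolding lev_def W_iff by blast

text \<open>A positive total deficit leaves some coordinate shorter than \<open>N\<close>; any
  letter appended there lowers the total by one.\<close>

lemma lev_child:
  assumes "a \<in> lev N (Suc d)"
  obtains l where "l \<in> {1..t}" "\<And>s. s \<in> {1..r} \<Longrightarrow> ch l a s \<in> lev N d"
proof -
  obtain i p where *: "i \<in> {1..m}" "p \<in> indices" "\<forall>l\<in>{1..t}. length (p l) \<le> N"
    "(\<Sum>l\<in>{1..t}. N - length (p l)) = Suc d" "a = wv i p"
    using assms unfolding lev_def by blast
  have "\<exists>l\<in>{1..t}. N - length (p l) \<noteq> 0"
    by (rule ccontr) (use *(4) in auto)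
  then obtain l where l: "l \<in> {1..t}" "length (p l) < N" by auto
  have "ch l a s \<in> lev N d" if s: "s \<in> {1..r}" for s
  proof -
    let ?q = "\<lambda>n. p n @ unit_index l s n"
    have "(\<Sum>j\<in>{1..t}. N - length (p j)) = (N - length (p l)) + (\<Sum>j\<in>{1..t}-{l}. N - length (p j))"
      "(\<Sum>j\<in>{1..t}. N - length (?q j)) = (N - length (?q l)) + (\<Sum>j\<in>{1..t}-{l}. N - length (?q j))"
      using sum.remove[of "{1..t}" l "\<lambda>j. N - length (p j)"]
        sum.remove[of "{1..t}" l "\<lambda>j. N - length (?q j)"] l by (simp_all only: finite_atLeastAtMost)
    moreover have "(\<Sum>j\<in>{1..t}-{l}. N - length (p j)) = (\<Sum>j\<in>{1..t}-{l}. N - length (?q j))"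
      by (rule sum.cong) (auto simp: unit_index_def)
    moreover have "N - length (p l) = Suc (N - length (?q l))" using l by (simp add: unit_index_def)
    ultimately have "(\<Sum>j\<in>{1..t}. N - length (?q j)) = d" using *(4) by linarith
    moreover have "\<forall>n\<in>{1..t}. length (?q n) \<le> N" using * l by (auto simp: unit_index_def)
    moreover have "?q \<in> indices" using * s by (intro indices_append unit_index_in)
    ultimately show ?thesis
      unfolding *(5) child_wv[OF *(1,2) s] lev_def using *(1) by blast
  qed
  then show ?thesis using l that by blast
qed

lemma lev_orthogonal:
  assumes "a \<in> lev N 0" "b \<in> lev N 0" "a \<noteq> b" shows "adj a \<otimes>\<^bsub>M\<^esub> b = \<zero>\<^bsub>M\<^esub>"
proof -
  obtain i p where *: "i \<in> {1..m}" "p \<in> indices" "\<forall>l\<in>{1..t}. length (p l) \<le> N"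
    "(\<Sum>l\<in>{1..t}. N - length (p l)) = 0" "a = wv i p"
    using assms(1) unfolding lev_def by blast
  obtain j q where **: "j \<in> {1..m}" "q \<in> indices" "\<forall>l\<in>{1..t}. length (q l) \<le> N"
    "(\<Sum>l\<in>{1..t}. N - length (q l)) = 0" "b = wv j q"
    using assms(2) unfolding lev_def by blast
  \<comment> \<open>A vanishing sum of truncated differences gives lengths at least
    \<open>N\<close>, and the bound in \<open>lev\<close> gives at most \<open>N\<close>.\<close>
  have "length (p l) = length (q l)" if "l \<in> {1..t}" for l
    using *(3,4) **(3,4) that by (metis diff_is_0_eq finite_atLeastAtMost le_antisym sum_eq_0_iff)
  then have "tx p \<otimes>\<^bsub>R\<^esub> ty q = (if \<forall>l\<in>{1..t}. p l = q l then \<one>\<^bsub>R\<^esub> else \<zero>\<^bsub>R\<^esub>)"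
    using * ** by (intro tx_ty_same_length) auto
  moreover have "i \<noteq> j \<or> \<not> (\<forall>l\<in>{1..t}. p l = q l)"
    using assms(3) *(5) **(5) ty_cong[of p q] by (auto simp: wv_def)
  ultimately show ?thesis
    unfolding *(5) **(5) adj_wv_mult[OF *(1) **(1) *(2) **(2)] by (auto simp: mu_zero)
qed

lemma lev_exists:
  assumes "a \<in> W" shows "\<exists>N0. \<forall>N\<ge>N0. \<exists>d. a \<in> lev N d"
proof -
  obtain i p where *: "i \<in> {1..m}" "p \<in> indices" "a = wv i p"
    using assms by (rule W_cases)
  have "\<forall>l\<in>{1..t}. length (p l) \<le> (\<Sum>l\<in>{1..t}. length (p l))"
    by (auto intro!: member_le_sum)
  then show ?thesis
    using * by (intro exI[of _ "\<Sum>l\<in>{1..t}. length (p l)"]) (auto simp: lev_def intro: order_trans)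
qed

lemma lev_exists_finite:
  assumes "finite A" "A \<subseteq> W" shows "\<exists>N0. \<forall>N\<ge>N0. A \<subseteq> (\<Union>d. lev N d)"
  using assms
proof (induction A rule: finite_induct)
  case (insert a A)
  then obtain N1 N2 where "\<forall>N\<ge>N1. A \<subseteq> (\<Union>d. lev N d)" "\<forall>N\<ge>N2. \<exists>d. a \<in> lev N d"
    using lev_exists[of a] by blast
  then show ?case by (intro exI[of _ "max N1 N2"]) auto
qed simp

end


section \<open>Frames and their expansions\<close>

context leavitt_matrix_algebra
begin

declare W_closed [simp]

text \<open>Every basis is a frame, but for \<open>t \<ge> 3\<close> a frame need not be a basis.\<close>

definition frame :: "leavitt_matrix set \<Rightarrow> bool" where
  "frame A \<longleftrightarrow> finite A \<and> A \<subseteq> W \<and> (\<forall>a\<in>A. \<forall>b\<in>A. a \<noteq> b \<longrightarrow> adj a \<otimes>\<^bsub>M\<^esub> b = \<zero>\<^bsub>M\<^esub>) \<and>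
    (\<Oplus>\<^bsub>M\<^esub>a\<in>A. a \<otimes>\<^bsub>M\<^esub> adj a) = \<one>\<^bsub>M\<^esub>"

lemma frameD:
  assumes "frame A"
  shows "finite A" "A \<subseteq> W" "a \<in> A \<Longrightarrow> a \<in> W"
    "a \<in> A \<Longrightarrow> b \<in> A \<Longrightarrow> a \<noteq> b \<Longrightarrow> adj a \<otimes>\<^bsub>M\<^esub> b = \<zero>\<^bsub>M\<^esub>"
    "(\<Oplus>\<^bsub>M\<^esub>a\<in>A. a \<otimes>\<^bsub>M\<^esub> adj a) = \<one>\<^bsub>M\<^esub>"
  using assms unfolding frame_def by auto

text \<open>If the two words were equal, the product would be \<open>e\<close>, which is
  nonzero.\<close>

lemma orthogonal_imp_neq: "a \<in> W \<Longrightarrow> adj a \<otimes>\<^bsub>M\<^esub> b = \<zero>\<^bsub>M\<^esub> \<Longrightarrow> a \<noteq> b"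
  using adj_self e_nonzero by auto

lemma e_adj: "a \<in> W \<Longrightarrow> e \<otimes>\<^bsub>M\<^esub> adj a = adj a"
  by (erule W_cases) (use mu_mult[OF one_in one_in] in \<open>simp add: adj_wv\<close>)

lemma e_yc: "s \<in> {1..r} \<Longrightarrow> e \<otimes>\<^bsub>M\<^esub> yc l s = yc l s"
  using mu_mult[OF one_in one_in, of "\<one>\<^bsub>R\<^esub>" "ty (unit_index l s)"] unit_index_in[of s l]
  unfolding yc_def by simp

lemma adj_adj: "a \<in> W \<Longrightarrow> adj (adj a) = a"
proof (erule W_cases)
  fix i p assume *: "p \<in> indices" "a = wv i p"
  have "star (tx p) = ty p"
    using star_ty_tx[of "\<lambda>_. []" p] * by (simp add: ty_Nil tx_Nil)
  then show ?thesis
    unfolding *(2) adj_wv[OF *(1)] adj_mu by (simp add: wv_def)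
qed

lemma adj_inject: "a \<in> W \<Longrightarrow> b \<in> W \<Longrightarrow> adj a = adj b \<Longrightarrow> a = b"
  using adj_adj by metis

lemma children_orthonormal:
  assumes "a \<in> W" "s \<in> {1..r}" "s' \<in> {1..r}" "l \<in> {1..t}"
  shows "adj (ch l a s) \<otimes>\<^bsub>M\<^esub> ch l a s' = (if s = s' then e else \<zero>\<^bsub>M\<^esub>)"
proof -
  have "adj (ch l a s) \<otimes>\<^bsub>M\<^esub> ch l a s' = xc l s \<otimes>\<^bsub>M\<^esub> (adj a \<otimes>\<^bsub>M\<^esub> a) \<otimes>\<^bsub>M\<^esub> yc l s'"
    unfolding adj_child[OF assms(1,2)] child_eq[OF assms(1,3)]
    using assms(1) xc_closed[OF assms(2)] yc_closed[OF assms(3)] by (simp add: M.m_assoc)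
  also have "\<dots> = xc l s \<otimes>\<^bsub>M\<^esub> (e \<otimes>\<^bsub>M\<^esub> yc l s')"
    using assms(2,3) unfolding adj_self[OF assms(1)] by (intro M.m_assoc xc_closed yc_closed e_closed)
  finally show ?thesis using assms by (simp only: e_yc xc_yc)
qed

lemma child_orthogonal:
  assumes "a \<in> W" "b \<in> W" "s \<in> {1..r}"
  shows "adj a \<otimes>\<^bsub>M\<^esub> b = \<zero>\<^bsub>M\<^esub> \<Longrightarrow> adj (ch l a s) \<otimes>\<^bsub>M\<^esub> b = \<zero>\<^bsub>M\<^esub>"
    "adj b \<otimes>\<^bsub>M\<^esub> a = \<zero>\<^bsub>M\<^esub> \<Longrightarrow> adj b \<otimes>\<^bsub>M\<^esub> ch l a s = \<zero>\<^bsub>M\<^esub>"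
proof -
  have c: "a \<in> carrier M" "b \<in> carrier M" "xc l s \<in> carrier M" "yc l s \<in> carrier M"
    using assms by (auto intro: xc_closed yc_closed)
  show "adj a \<otimes>\<^bsub>M\<^esub> b = \<zero>\<^bsub>M\<^esub> \<Longrightarrow> adj (ch l a s) \<otimes>\<^bsub>M\<^esub> b = \<zero>\<^bsub>M\<^esub>"
    unfolding adj_child[OF assms(1,3)] using c by (simp add: M.m_assoc)
  show "adj b \<otimes>\<^bsub>M\<^esub> a = \<zero>\<^bsub>M\<^esub> \<Longrightarrow> adj b \<otimes>\<^bsub>M\<^esub> ch l a s = \<zero>\<^bsub>M\<^esub>"
    unfolding child_eq[OF assms(1,3)] using c by (simp add: M.m_assoc[symmetric])
qed

lemma child_inj: "a \<in> W \<Longrightarrow> l \<in> {1..t} \<Longrightarrow> inj_on (ch l a) {1..r}"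
  using children_orthonormal orthogonal_imp_neq[OF child_in_W] by (intro inj_onI) (metis (full_types))

text \<open>The relation \<open>yc_xc_sum\<close> is inserted between \<open>a\<close> and
  \<open>adj b\<close>. With \<open>a = b\<close> it keeps frames complete; for a pair of a
  bijection it keeps \<open>Theta\<close> unchanged.\<close>

lemma children_sum:
  assumes "a \<in> W" "b \<in> W" "l \<in> {1..t}"
  shows "(\<Oplus>\<^bsub>M\<^esub>s\<in>{1..r}. ch l a s \<otimes>\<^bsub>M\<^esub> adj (ch l b s)) = a \<otimes>\<^bsub>M\<^esub> adj b"
proof -
  have c: "yc l s \<in> carrier M" "xc l s \<in> carrier M" if "s \<in> {1..r}" for s
    using that by auto
  have "(\<Oplus>\<^bsub>M\<^esub>s\<in>{1..r}. ch l a s \<otimes>\<^bsub>M\<^esub> adj (ch l b s))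
      = (\<Oplus>\<^bsub>M\<^esub>s\<in>{1..r}. a \<otimes>\<^bsub>M\<^esub> (yc l s \<otimes>\<^bsub>M\<^esub> xc l s) \<otimes>\<^bsub>M\<^esub> adj b)"
  proof (intro M.finsum_cong' refl)
    fix s assume s: "s \<in> {1..r}"
    show "ch l a s \<otimes>\<^bsub>M\<^esub> adj (ch l b s) = a \<otimes>\<^bsub>M\<^esub> (yc l s \<otimes>\<^bsub>M\<^esub> xc l s) \<otimes>\<^bsub>M\<^esub> adj b"
      unfolding child_eq[OF assms(1) s] adj_child[OF assms(2) s]
      using assms c[OF s] by (simp add: M.m_assoc)
  qed (use assms c in auto)
  also have "\<dots> = (\<Oplus>\<^bsub>M\<^esub>s\<in>{1..r}. a \<otimes>\<^bsub>M\<^esub> (yc l s \<otimes>\<^bsub>M\<^esub> xc l s)) \<otimes>\<^bsub>M\<^esub> adj b"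
    using assms c by (intro M.finsum_ldistr[symmetric]) auto
  also have "(\<Oplus>\<^bsub>M\<^esub>s\<in>{1..r}. a \<otimes>\<^bsub>M\<^esub> (yc l s \<otimes>\<^bsub>M\<^esub> xc l s)) = a \<otimes>\<^bsub>M\<^esub> (\<Oplus>\<^bsub>M\<^esub>s\<in>{1..r}. yc l s \<otimes>\<^bsub>M\<^esub> xc l s)"
    using assms c by (intro M.finsum_rdistr[symmetric]) auto
  finally show ?thesis unfolding yc_xc_sum[OF assms(3)] W_e[OF assms(1)] .
qed

text \<open>A child inherits the orthogonality of its parent to the other members, yet it is not
  orthogonal to itself. Hence the union in \<open>expansion\<close> is disjoint and sums over it
  split.\<close>

lemma children_disjoint:
  assumes "frame A" "a \<in> A" "s \<in> {1..r}" "l \<in> {1..t}"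
  shows "ch l a s \<notin> A - {a}"
proof
  assume *: "ch l a s \<in> A - {a}"
  then have "adj (ch l a s) \<otimes>\<^bsub>M\<^esub> ch l a s = \<zero>\<^bsub>M\<^esub>"
    using frameD[OF assms(1)] assms by (intro child_orthogonal(1)) auto
  then show False using orthogonal_imp_neq child_in_W frameD[OF assms(1)] assms by blast
qed

lemma frame_expansion:
  assumes A: "frame A" and a: "a \<in> A" and l: "l \<in> {1..t}"
  shows "frame (expansion r t m l a A)"
proof -
  note f = frameD[OF A]
  have aW: "a \<in> W" using f a by blast
  have W: "expansion r t m l a A \<subseteq> W"
    using f child_in_W[OF aW] by (auto simp: expansion_def)
  have orth: "adj x \<otimes>\<^bsub>M\<^esub> y = \<zero>\<^bsub>M\<^esub>"
    if x: "x \<in> expansion r t m l a A" and y: "y \<in> expansion r t m l a A" and ne: "x \<noteq> y" for x y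
  proof -
    consider "x \<in> A - {a}" "y \<in> A - {a}" | s where "x \<in> A - {a}" "s \<in> {1..r}" "y = ch l a s"
      | s where "y \<in> A - {a}" "s \<in> {1..r}" "x = ch l a s"
      | s s' where "s \<in> {1..r}" "s' \<in> {1..r}" "x = ch l a s" "y = ch l a s'"
      using x y unfolding expansion_def by blast
    then show ?thesis
    proof cases
      case 1
      then show ?thesis using f ne by auto
    next
      case 2
      then show ?thesis using f(3,4) a by (auto intro!: child_orthogonal(2))
    next
      case 3
      then show ?thesis using f(3,4) a by (auto intro!: child_orthogonal(1))
    next
      case 4
      then show ?thesis using children_orthonormal[OF aW 4(1,2) l] ne by auto
    qed
  qed
  have "(\<Oplus>\<^bsub>M\<^esub>x\<in>expansion r t m l a A. x \<otimes>\<^bsub>M\<^esub> adj x)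
      = (\<Oplus>\<^bsub>M\<^esub>x\<in>A - {a}. x \<otimes>\<^bsub>M\<^esub> adj x) \<oplus>\<^bsub>M\<^esub> (\<Oplus>\<^bsub>M\<^esub>x\<in>ch l a ` {1..r}. x \<otimes>\<^bsub>M\<^esub> adj x)"
    unfolding expansion_def
    using f children_disjoint[OF A a _ l] child_in_W[OF aW] by (intro M.finsum_Un_disjoint) auto
  also have "(\<Oplus>\<^bsub>M\<^esub>x\<in>ch l a ` {1..r}. x \<otimes>\<^bsub>M\<^esub> adj x) = (\<Oplus>\<^bsub>M\<^esub>s\<in>{1..r}. ch l a s \<otimes>\<^bsub>M\<^esub> adj (ch l a s))"
    using child_inj[OF aW l] child_in_W[OF aW] by (intro M.finsum_reindex) auto
  also have "\<dots> = a \<otimes>\<^bsub>M\<^esub> adj a" by (rule children_sum[OF aW aW l])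
  also have "(\<Oplus>\<^bsub>M\<^esub>x\<in>A - {a}. x \<otimes>\<^bsub>M\<^esub> adj x) \<oplus>\<^bsub>M\<^esub> (a \<otimes>\<^bsub>M\<^esub> adj a)
      = (\<Oplus>\<^bsub>M\<^esub>x\<in>insert a (A - {a}). x \<otimes>\<^bsub>M\<^esub> adj x)"
    using f aW by (subst M.finsum_insert) (auto intro!: M.a_comm M.finsum_closed)
  also have "insert a (A - {a}) = A" using a by blast
  finally show ?thesis
    unfolding frame_def using W orth f by (auto simp: expansion_def)
qed

text \<open>Multiplying the completeness relation by \<open>adj c\<close> shows that a word
  orthogonal to the whole frame would have zero adjoint.\<close>

lemma frame_meets:
  assumes "frame A" "c \<in> W" shows "\<exists>a\<in>A. adj c \<otimes>\<^bsub>M\<^esub> a \<noteq> \<zero>\<^bsub>M\<^esub>"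
proof (rule ccontr)
  assume "\<not> ?thesis"
  then have z: "adj c \<otimes>\<^bsub>M\<^esub> a = \<zero>\<^bsub>M\<^esub>" if "a \<in> A" for a using that by blast
  note f = frameD[OF assms(1)]
  have "adj c = adj c \<otimes>\<^bsub>M\<^esub> (\<Oplus>\<^bsub>M\<^esub>a\<in>A. a \<otimes>\<^bsub>M\<^esub> adj a)"
    using f assms by simp
  also have "\<dots> = (\<Oplus>\<^bsub>M\<^esub>a\<in>A. adj c \<otimes>\<^bsub>M\<^esub> (a \<otimes>\<^bsub>M\<^esub> adj a))"
    using f assms by (intro M.finsum_rdistr) auto
  also have "\<dots> = (\<Oplus>\<^bsub>M\<^esub>a\<in>A. \<zero>\<^bsub>M\<^esub>)"
    using f(3) assms z by (intro M.finsum_cong') (auto simp: M.m_assoc[symmetric])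
  finally have "adj c \<otimes>\<^bsub>M\<^esub> c = \<zero>\<^bsub>M\<^esub>" using assms by simp
  then show False using orthogonal_imp_neq assms by blast
qed

text \<open>Within one level the only word not orthogonal to \<open>c\<close> is \<open>c\<close>
  itself, so a frame there must contain it.\<close>

lemma frame_level:
  assumes "frame A" "A \<subseteq> lev N 0" shows "A = lev N 0"
proof (rule subset_antisym[OF assms(2)], rule subsetI)
  fix c assume c: "c \<in> lev N 0"
  then obtain a where "a \<in> A" "adj c \<otimes>\<^bsub>M\<^esub> a \<noteq> \<zero>\<^bsub>M\<^esub>"
    using frame_meets[OF assms(1) lev_W] by blast
  then show "c \<in> A" using lev_orthogonal[OF c] assms(2) by blast
qed

lemma wv_in_W: "i \<in> {1..m} \<Longrightarrow> p \<in> indices \<Longrightarrow> wv i p \<in> W"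
  unfolding W_iff by blast

lemma frame_initial: "frame (initial_basis r t m)"
proof -
  have inj: "inj_on (\<lambda>i. wv i (\<lambda>_. [])) {1..m}"
  proof (rule inj_onI)
    fix i j assume ij: "i \<in> {1..m}" "j \<in> {1..m}" "wv i (\<lambda>_. []) = wv j (\<lambda>_. [])"
    show "i = j"
    proof (rule ccontr)
      assume "i \<noteq> j"
      then have "adj (wv i (\<lambda>_. [])) \<otimes>\<^bsub>M\<^esub> wv j (\<lambda>_. []) = \<zero>\<^bsub>M\<^esub>"
        using ij(1,2) adj_wv_mult[of i j "\<lambda>_. []" "\<lambda>_. []"] by simp
      from orthogonal_imp_neq[OF wv_in_W[OF ij(1) Nil_indices] this] ij(3)
      show False by (rule notE)
    qed
  qed
  have W: "wv i (\<lambda>_. []) \<in> W" if "i \<in> {1..m}" for i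
    using that Nil_indices by (rule wv_in_W)
  have "(\<Oplus>\<^bsub>M\<^esub>a\<in>initial_basis r t m. a \<otimes>\<^bsub>M\<^esub> adj a)
      = (\<Oplus>\<^bsub>M\<^esub>i\<in>{1..m}. wv i (\<lambda>_. []) \<otimes>\<^bsub>M\<^esub> adj (wv i (\<lambda>_. [])))"
    unfolding initial_basis_eq using W by (intro M.finsum_reindex[OF _ inj]) auto
  then show ?thesis
    unfolding frame_def using W initial_complete
    by (auto simp: initial_basis_eq adj_wv_mult)
qed

text \<open>\<open>bases\<close> is an intersection of admissible families, and the frames form one
  of them.\<close>

lemma bases_frame: "A \<in> bases r t m \<Longrightarrow> frame A"
proof -
  have "{A. frame A} \<in> {\<BB>. \<BB> \<subseteq> {A. finite A \<and> A \<subseteq> W} \<and>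
      initial_basis r t m \<in> \<BB> \<and> expansion_closed r t m \<BB>}"
    unfolding expansion_closed_def using frame_initial frame_expansion frameD(1,2) by blast
  then show "A \<in> bases r t m \<Longrightarrow> frame A" unfolding bases_def by blast
qed

lemma initial_in_bases: "initial_basis r t m \<in> bases r t m"
  unfolding bases_def by blast

lemma expansion_in_bases:
  "A \<in> bases r t m \<Longrightarrow> a \<in> A \<Longrightarrow> l \<in> {1..t} \<Longrightarrow> expansion r t m l a A \<in> bases r t m"
  unfolding bases_def expansion_closed_def by blast


section \<open>Bijections between frames\<close>

text \<open>The conditions on the graph are symmetric under \<open>converse\<close>, so each
  statement about domains yields one about ranges.\<close>

definition frame_bij :: "basis_bij \<Rightarrow> bool" where
  "frame_bij \<phi> \<longleftrightarrow> finite \<phi> \<and> frame (Domain \<phi>) \<and> frame (Range \<phi>) \<and>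
    single_valued \<phi> \<and> single_valued (\<phi>\<inverse>)"

text \<open>Unlike \<open>expands_to\<close> it does not ask for bases at both ends; surjectivity
  starts from a bijection whose domain is only known to be a frame.\<close>

definition step :: "basis_bij \<Rightarrow> basis_bij \<Rightarrow> bool" where
  "step \<phi> \<psi> \<longleftrightarrow> (\<exists>(a, b)\<in>\<phi>. \<exists>l\<in>{1..t}. \<psi> = expand_bij r t m l a b \<phi>)"

definition Theta :: "basis_bij \<Rightarrow> leavitt_matrix" where
  "Theta \<phi> = (\<Oplus>\<^bsub>M\<^esub>x\<in>\<phi>. fst x \<otimes>\<^bsub>M\<^esub> adj (snd x))"

lemma frame_bijD:
  assumes "frame_bij \<phi>"
  shows "finite \<phi>" "frame (Domain \<phi>)" "frame (Range \<phi>)"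
    "(a, b) \<in> \<phi> \<Longrightarrow> (a, b') \<in> \<phi> \<Longrightarrow> b = b'" "(a, b) \<in> \<phi> \<Longrightarrow> (a', b) \<in> \<phi> \<Longrightarrow> a = a'"
    "(a, b) \<in> \<phi> \<Longrightarrow> a \<in> W" "(a, b) \<in> \<phi> \<Longrightarrow> b \<in> W"
    "x \<in> \<phi> \<Longrightarrow> fst x \<in> W" "x \<in> \<phi> \<Longrightarrow> snd x \<in> W"
proof -
  show "finite \<phi>" "frame (Domain \<phi>)" "frame (Range \<phi>)"
    using assms unfolding frame_bij_def by auto
  then show W: "(a, b) \<in> \<phi> \<Longrightarrow> a \<in> W" "(a, b) \<in> \<phi> \<Longrightarrow> b \<in> W" for a b
    using frameD(3) by blast+
  show "x \<in> \<phi> \<Longrightarrow> fst x \<in> W" "x \<in> \<phi> \<Longrightarrow> snd x \<in> W"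
    using W[of "fst x" "snd x"] by simp_all
  show "(a, b) \<in> \<phi> \<Longrightarrow> (a, b') \<in> \<phi> \<Longrightarrow> b = b'" "(a, b) \<in> \<phi> \<Longrightarrow> (a', b) \<in> \<phi> \<Longrightarrow> a = a'"
    using assms unfolding frame_bij_def by (auto dest: single_valuedD)
qed

lemma frame_bij_converse: "frame_bij \<phi> \<Longrightarrow> frame_bij (\<phi>\<inverse>)"
  unfolding frame_bij_def by simp

lemma expand_bij_converse: "expand_bij r t m l b a (\<phi>\<inverse>) = (expand_bij r t m l a b \<phi>)\<inverse>"
  unfolding expand_bij_def by auto

lemma step_converse:
  assumes "step \<phi> \<psi>" shows "step (\<phi>\<inverse>) (\<psi>\<inverse>)"
proof -
  obtain a b l where "(a, b) \<in> \<phi>" "l \<in> {1..t}" "\<psi> = expand_bij r t m l a b \<phi>"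
    using assms unfolding step_def by blast
  then have "(b, a) \<in> \<phi>\<inverse>" "l \<in> {1..t}" "\<psi>\<inverse> = expand_bij r t m l b a (\<phi>\<inverse>)"
    by (simp_all add: expand_bij_converse)
  then show ?thesis unfolding step_def by blast
qed

lemma steps_converse: "step\<^sup>*\<^sup>* \<phi> \<psi> \<Longrightarrow> step\<^sup>*\<^sup>* (\<phi>\<inverse>) (\<psi>\<inverse>)"
  by (induction rule: rtranclp_induct) (auto intro: step_converse rtranclp.rtrancl_into_rtrancl)

lemma Domain_expand_bij:
  assumes "frame_bij \<phi>" "(a, b) \<in> \<phi>"
  shows "Domain (expand_bij r t m l a b \<phi>) = expansion r t m l a (Domain \<phi>)"
proof -
  have "Domain (\<phi> - {(a, b)}) = Domain \<phi> - {a}"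
    using frame_bijD(4,5)[OF assms(1)] assms(2) by blast
  then show ?thesis
    unfolding expand_bij_def expansion_def Domain_Un_eq by force
qed

lemma Range_expand_bij:
  assumes "frame_bij \<phi>" "(a, b) \<in> \<phi>"
  shows "Range (expand_bij r t m l a b \<phi>) = expansion r t m l b (Range \<phi>)"
  using Domain_expand_bij[OF frame_bij_converse[OF assms(1)], of b a l] assms(2)
  by (simp add: expand_bij_converse)

lemma frame_bij_expand:
  assumes \<phi>: "frame_bij \<phi>" and ab: "(a, b) \<in> \<phi>" and l: "l \<in> {1..t}"
  shows "frame_bij (expand_bij r t m l a b \<phi>)"
proof -
  note f = frame_bijD[OF \<phi>]
  have a: "a \<in> Domain \<phi>" and b: "b \<in> Range \<phi>" using ab by auto
  have aW: "a \<in> W" and bW: "b \<in> W" using f ab by auto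
  \<comment> \<open>Injectivity in both directions requires the new pairs to miss the old ones in
    each coordinate separately.\<close>
  have dj: "(ch l a s, y) \<notin> \<phi> - {(a, b)}" "(x, ch l b s) \<notin> \<phi> - {(a, b)}" if "s \<in> {1..r}" for s x y
    using children_disjoint[OF f(2) a that l] children_disjoint[OF f(3) b that l] f(4,5) ab by auto
  have "single_valued (expand_bij r t m l a b \<phi>)"
    unfolding expand_bij_def single_valued_def
    using f(4) dj(1) child_inj[OF aW l, unfolded inj_on_def] by blast
  moreover have "single_valued ((expand_bij r t m l a b \<phi>)\<inverse>)"
    unfolding expand_bij_def single_valued_def
    using f(5) dj(2) child_inj[OF bW l, unfolded inj_on_def] by blast
  moreover have "finite (expand_bij r t m l a b \<phi>)" using f by (simp add: expand_bij_def)
  ultimately show ?thesis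
    unfolding frame_bij_def Domain_expand_bij[OF \<phi> ab] Range_expand_bij[OF \<phi> ab]
    using frame_expansion f(2,3) a b l by blast
qed

text \<open>\<open>children_sum\<close> trades the term of the pair \<open>(a, b)\<close> for the
  terms of its children.\<close>

lemma Theta_expand:
  assumes \<phi>: "frame_bij \<phi>" and ab: "(a, b) \<in> \<phi>" and l: "l \<in> {1..t}"
  shows "Theta (expand_bij r t m l a b \<phi>) = Theta \<phi>"
proof -
  note f = frame_bijD[OF \<phi>]
  let ?g = "\<lambda>x. fst x \<otimes>\<^bsub>M\<^esub> adj (snd x)"
  let ?c = "\<lambda>s. (ch l a s, ch l b s)"
  have a: "a \<in> Domain \<phi>" using ab by auto
  have aW: "a \<in> W" and bW: "b \<in> W" using f ab by auto
  \<comment> \<open>A child pair among the remaining ones could only start with \<open>a\<close>; it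
    would then be the deleted pair, since the relation is single-valued.\<close>
  have dj: "?c s \<notin> \<phi> - {(a, b)}" if "s \<in> {1..r}" for s
  proof
    assume c: "?c s \<in> \<phi> - {(a, b)}"
    then have "ch l a s = a" using children_disjoint[OF f(2) a that l] by blast
    moreover from this c have "ch l b s = b" using f(4) ab by auto
    ultimately show False using c by simp
  qed
  have inj: "inj_on ?c {1..r}" using child_inj[OF aW l] unfolding inj_on_def by blast
  have "Theta (expand_bij r t m l a b \<phi>) = finsum M ?g (\<phi> - {(a, b)}) \<oplus>\<^bsub>M\<^esub> finsum M ?g (?c ` {1..r})"
    unfolding Theta_def expand_bij_def
    using f(1,8,9) dj child_in_W[OF aW] child_in_W[OF bW] by (intro M.finsum_Un_disjoint) auto
  also have "finsum M ?g (?c ` {1..r}) = (\<Oplus>\<^bsub>M\<^esub>s\<in>{1..r}. ch l a s \<otimes>\<^bsub>M\<^esub> adj (ch l b s))"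
    using child_in_W[OF aW] child_in_W[OF bW] by (subst M.finsum_reindex[OF _ inj]) auto
  also have "\<dots> = a \<otimes>\<^bsub>M\<^esub> adj b" by (rule children_sum[OF aW bW l])
  also have "finsum M ?g (\<phi> - {(a, b)}) \<oplus>\<^bsub>M\<^esub> (a \<otimes>\<^bsub>M\<^esub> adj b) = finsum M ?g (insert (a, b) (\<phi> - {(a, b)}))"
    using f(1,8,9) aW bW by (subst M.finsum_insert) (auto intro!: M.a_comm M.finsum_closed)
  also have "insert (a, b) (\<phi> - {(a, b)}) = \<phi>" using ab by blast
  finally show ?thesis unfolding Theta_def .
qed

lemma step_preserves:
  assumes "frame_bij \<phi>" "step \<phi> \<psi>"
  shows "frame_bij \<psi>" "Theta \<psi> = Theta \<phi>"
    "Domain \<phi> \<in> bases r t m \<Longrightarrow> Domain \<psi> \<in> bases r t m"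
    "Range \<phi> \<in> bases r t m \<Longrightarrow> Range \<psi> \<in> bases r t m"
proof -
  obtain a b l where *: "(a, b) \<in> \<phi>" "l \<in> {1..t}" "\<psi> = expand_bij r t m l a b \<phi>"
    using assms(2) unfolding step_def by blast
  show "frame_bij \<psi>" "Theta \<psi> = Theta \<phi>"
    using * assms(1) by (simp_all only: frame_bij_expand Theta_expand)
  show "Domain \<phi> \<in> bases r t m \<Longrightarrow> Domain \<psi> \<in> bases r t m"
    unfolding *(3) Domain_expand_bij[OF assms(1) *(1)] using * by (intro expansion_in_bases) auto
  show "Range \<phi> \<in> bases r t m \<Longrightarrow> Range \<psi> \<in> bases r t m"
    unfolding *(3) Range_expand_bij[OF assms(1) *(1)] using * by (intro expansion_in_bases) auto
qed

lemma steps_preserve: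
  assumes "step\<^sup>*\<^sup>* \<phi> \<psi>" "frame_bij \<phi>"
  shows "frame_bij \<psi> \<and> Theta \<psi> = Theta \<phi> \<and>
    (Domain \<phi> \<in> bases r t m \<longrightarrow> Domain \<psi> \<in> bases r t m) \<and>
    (Range \<phi> \<in> bases r t m \<longrightarrow> Range \<psi> \<in> bases r t m)"
  using assms(1)
proof (induction rule: rtranclp_induct)
  case (step \<chi> \<psi>)
  then show ?case using step_preserves[of \<chi> \<psi>] by auto
qed (use assms(2) in auto)

text \<open>The minimum makes a function of the word without a proof that the word determines its
  lengths.\<close>

definition deficit :: "nat \<Rightarrow> leavitt_matrix \<Rightarrow> nat" where
  "deficit N a = (LEAST d. a \<in> lev N d)"

lemma deficit_le: "a \<in> lev N d \<Longrightarrow> deficit N a \<le> d"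
  unfolding deficit_def by (rule Least_le)

lemma lev_deficit: "a \<in> lev N d \<Longrightarrow> a \<in> lev N (deficit N a)"
  unfolding deficit_def by (rule LeastI)

text \<open>One expansion may increase the sum of deficits, so each word is given a weight
  exponential in its deficit. The base \<open>r + 1\<close> exceeds the number of children, hence
  the total weight drops.\<close>

lemma expand_domain_to_level:
  assumes "frame_bij \<phi>" "Domain \<phi> \<subseteq> (\<Union>d. lev N d)"
  shows "\<exists>\<psi>. step\<^sup>*\<^sup>* \<phi> \<psi> \<and> Domain \<psi> = lev N 0"
  using assms
proof (induction "\<Sum>a\<in>Domain \<phi>. (r + 1) ^ deficit N a" arbitrary: \<phi> rule: less_induct)
  case less
  note f = frame_bijD[OF less.prems(1)]
  show ?case
  proof (cases "Domain \<phi> \<subseteq> lev N 0")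
    case True
    then show ?thesis using frame_level[OF f(2)] by blast
  next
    case False
    then obtain a where a: "a \<in> Domain \<phi>" "a \<notin> lev N 0" by blast
    then have def: "a \<in> lev N (deficit N a)" using less.prems(2) lev_deficit by blast
    with a obtain d where d: "deficit N a = Suc d" by (cases "deficit N a") auto
    obtain l where l: "l \<in> {1..t}" "\<And>s. s \<in> {1..r} \<Longrightarrow> ch l a s \<in> lev N d"
      using lev_child def d by metis
    obtain b where ab: "(a, b) \<in> \<phi>" using a by blast
    let ?\<psi> = "expand_bij r t m l a b \<phi>"
    let ?w = "\<lambda>a. (r + 1) ^ deficit N a"
    have D: "Domain ?\<psi> = (Domain \<phi> - {a}) \<union> ch l a ` {1..r}"
      using Domain_expand_bij[OF less.prems(1) ab] by (simp add: expansion_def)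
    have fin: "finite (Domain \<phi>)" using f by (auto dest: frameD)
    \<comment> \<open>An upper bound suffices, so overlaps between old words and children may be
      ignored here.\<close>
    have "sum ?w (Domain ?\<psi>) \<le> sum ?w (Domain \<phi> - {a}) + sum ?w (ch l a ` {1..r})"
      unfolding D by (metis fin finite_Diff finite_atLeastAtMost finite_imageI le_add1 sum.union_inter)
    also have "sum ?w (ch l a ` {1..r}) \<le> (\<Sum>s\<in>{1..r}. ?w (ch l a s))"
      by (rule order_trans[OF sum_image_le]) auto
    also have "\<dots> \<le> (\<Sum>s\<in>{1..r}. (r + 1) ^ d)"
      using l(2) by (intro sum_mono power_increasing deficit_le) auto
    \<comment> \<open>\<open>r\<close> children of weight at most \<open>(r + 1) ^ d\<close> replace
      one word of weight \<open>(r + 1) ^ Suc d\<close>.\<close>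
    also have "\<dots> < (r + 1) ^ Suc d" by simp
    also have "sum ?w (Domain \<phi> - {a}) + (r + 1) ^ Suc d = sum ?w (Domain \<phi>)"
      using sum.remove[OF fin a(1), of ?w] d by simp
    finally have "sum ?w (Domain ?\<psi>) < sum ?w (Domain \<phi>)" by simp
    moreover have "frame_bij ?\<psi>" using less.prems(1) ab l(1) by (rule frame_bij_expand)
    moreover have "Domain ?\<psi> \<subseteq> (\<Union>d. lev N d)" unfolding D using less.prems(2) l(2) by blast
    ultimately obtain \<chi> where "step\<^sup>*\<^sup>* ?\<psi> \<chi>" "Domain \<chi> = lev N 0" using less.hyps by blast
    moreover have "step \<phi> ?\<psi>" unfolding step_def using ab l(1) by blast
    ultimately show ?thesis by (meson converse_rtranclp_into_rtranclp)
  qed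
qed

lemma expand_range_to_level:
  assumes "frame_bij \<phi>" "Range \<phi> \<subseteq> (\<Union>d. lev N d)"
  shows "\<exists>\<psi>. step\<^sup>*\<^sup>* \<phi> \<psi> \<and> Range \<psi> = lev N 0"
proof -
  obtain \<psi> where "step\<^sup>*\<^sup>* (\<phi>\<inverse>) \<psi>" "Domain \<psi> = lev N 0"
    using expand_domain_to_level[OF frame_bij_converse[OF assms(1)], of N] assms(2)
    unfolding Domain_converse by blast
  then show ?thesis using steps_converse[of "\<phi>\<inverse>" \<psi>] by (intro exI[of _ "\<psi>\<inverse>"]) simp
qed

lemma frame_bij_Id_on:
  assumes "frame A" shows "frame_bij (Id_on A)"
proof -
  have "finite (Id_on A)" using frameD(1)[OF assms] by (simp add: Id_on_def)
  moreover have "single_valued (Id_on A)" by (auto simp: single_valued_def)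
  ultimately show ?thesis using assms by (simp add: frame_bij_def)
qed

text \<open>Expanding the identity on the initial basis moves its domain through bases only, and the
  process ends at the level.\<close>

lemma level_basis: "lev N 0 \<in> bases r t m"
proof -
  let ?I = "initial_basis r t m"
  have "?I \<subseteq> (\<Union>d. lev N d)"
  proof
    fix a assume "a \<in> ?I"
    then obtain i where i: "i \<in> {1..m}" "a = wv i (\<lambda>_. [])" unfolding initial_basis_eq by blast
    \<comment> \<open>An empty index misses all \<open>N\<close> letters in every
      coordinate.\<close>
    have "a \<in> lev N (\<Sum>l\<in>{1..t}. N - length [])"
      unfolding lev_def i(2)
      by (intro CollectI exI[of _ i] exI[of _ "\<lambda>_. []"] conjI i(1) Nil_indices) simp_all
    then show "a \<in> (\<Union>d. lev N d)" by blast
  qed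
  then obtain \<psi> where "step\<^sup>*\<^sup>* (Id_on ?I) \<psi>" "Domain \<psi> = lev N 0"
    using expand_domain_to_level[OF frame_bij_Id_on[OF frame_initial], of N] by auto
  then show ?thesis
    using steps_preserve[OF _ frame_bij_Id_on[OF frame_initial]] initial_in_bases by force
qed

end


section \<open>The map from bijections to matrices\<close>

context leavitt_matrix_algebra
begin

lemma Theta_closed:
  assumes "frame_bij \<phi>" shows "Theta \<phi> \<in> carrier M"
  unfolding Theta_def using frame_bijD(6-9)[OF assms] by (intro M.finsum_closed) auto

lemma adj_mult_Theta:
  assumes \<phi>: "frame_bij \<phi>" and ab: "(a, b) \<in> \<phi>"
  shows "adj a \<otimes>\<^bsub>M\<^esub> Theta \<phi> = adj b"
proof -
  note f = frame_bijD[OF \<phi>]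
  have aW: "a \<in> W" and bW: "b \<in> W" using f ab by auto
  have "adj a \<otimes>\<^bsub>M\<^esub> Theta \<phi> = (\<Oplus>\<^bsub>M\<^esub>x\<in>\<phi>. adj a \<otimes>\<^bsub>M\<^esub> (fst x \<otimes>\<^bsub>M\<^esub> adj (snd x)))"
    unfolding Theta_def using f(1,8,9) aW by (intro M.finsum_rdistr) auto
  also have "\<dots> = (\<Oplus>\<^bsub>M\<^esub>x\<in>\<phi>. if (a, b) = x then adj b else \<zero>\<^bsub>M\<^esub>)"
  proof (intro M.finsum_cong' refl)
    fix x assume x: "x \<in> \<phi>"
    note W = f(8)[OF x] f(9)[OF x]
    have "adj a \<otimes>\<^bsub>M\<^esub> (fst x \<otimes>\<^bsub>M\<^esub> adj (snd x)) = adj a \<otimes>\<^bsub>M\<^esub> fst x \<otimes>\<^bsub>M\<^esub> adj (snd x)"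
      using W aW by (simp add: M.m_assoc)
    also have "\<dots> = (if (a, b) = x then adj b else \<zero>\<^bsub>M\<^esub>)"
    proof (cases "fst x = a")
      case True
      then have "x = (a, b)" using f(4)[OF ab, of "snd x"] x by (metis prod.collapse)
      then show ?thesis using aW bW by (simp add: adj_self e_adj)
    next
      case False
      then have "adj a \<otimes>\<^bsub>M\<^esub> fst x = \<zero>\<^bsub>M\<^esub>"
        using frameD(4)[OF f(2), of a "fst x"] DomainI[OF ab] DomainI[of "fst x" "snd x" \<phi>] x by simp
      then show ?thesis using False W by auto
    qed
    finally show "adj a \<otimes>\<^bsub>M\<^esub> (fst x \<otimes>\<^bsub>M\<^esub> adj (snd x)) = (if (a, b) = x then adj b else \<zero>\<^bsub>M\<^esub>)" .
  qed (use bW in auto)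
  also have "\<dots> = adj b"
    using ab f(1) bW by (intro M.finsum_singleton) auto
  finally show ?thesis .
qed

lemma Theta_inject_same_Domain:
  assumes "frame_bij \<phi>" "frame_bij \<psi>" "Domain \<phi> = Domain \<psi>" "Theta \<phi> = Theta \<psi>"
  shows "\<phi> = \<psi>"
proof -
  have "\<phi> \<subseteq> \<psi>"
    if *: "frame_bij \<phi>" "frame_bij \<psi>" "Domain \<phi> = Domain \<psi>" "Theta \<phi> = Theta \<psi>" for \<phi> \<psi>
  proof
    fix x assume "x \<in> \<phi>"
    then obtain a b where ab: "x = (a, b)" "(a, b) \<in> \<phi>" by (cases x) auto
    then obtain b' where ab': "(a, b') \<in> \<psi>" using *(3) by blast
    have "adj b = adj b'"
      using adj_mult_Theta[OF *(1) ab(2)] adj_mult_Theta[OF *(2) ab'] unfolding *(4) by (rule trans[OF sym])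
    then have "b = b'"
      by (rule adj_inject[OF frame_bijD(7)[OF *(1) ab(2)] frame_bijD(7)[OF *(2) ab']])
    then show "x \<in> \<psi>" using ab ab' by simp
  qed
  then show ?thesis using assms by (metis subset_antisym)
qed

text \<open>Each second factor \<open>adj b\<close> of the left sum lies over the common middle
  frame, and multiplying it by \<open>Theta \<psi>\<close> replaces it by the adjoint of the image
  of \<open>b\<close>. No double sum has to be handled.\<close>

lemma Theta_relcomp:
  assumes \<phi>: "frame_bij \<phi>" and \<psi>: "frame_bij \<psi>" and eq: "Range \<phi> = Domain \<psi>"
  shows "Theta (\<phi> O \<psi>) = Theta \<phi> \<otimes>\<^bsub>M\<^esub> Theta \<psi>"
proof -
  note f = frame_bijD[OF \<phi>] and g = frame_bijD[OF \<psi>]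
  have "\<exists>c. (snd x, c) \<in> \<psi>" if "x \<in> \<phi>" for x
  proof -
    have "snd x \<in> Range \<phi>" using that by (auto simp: Range_snd)
    then show ?thesis using eq by auto
  qed
  then obtain h where h: "\<And>x. x \<in> \<phi> \<Longrightarrow> (snd x, h x) \<in> \<psi>" by metis
  let ?k = "\<lambda>x. (fst x, h x)"
  have hW: "h x \<in> W" if "x \<in> \<phi>" for x using g(7) h[OF that] by blast
  have img: "\<phi> O \<psi> = ?k ` \<phi>"
  proof
    show "?k ` \<phi> \<subseteq> \<phi> O \<psi>"
    proof
      fix y assume "y \<in> ?k ` \<phi>"
      then obtain x where x: "x \<in> \<phi>" "y = (fst x, h x)" by blast
      have "(fst x, snd x) \<in> \<phi>" using x(1) by simp
      then show "y \<in> \<phi> O \<psi>" unfolding x(2) using h[OF x(1)] by (rule relcompI)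
    qed
    show "\<phi> O \<psi> \<subseteq> ?k ` \<phi>"
    proof
      fix y assume "y \<in> \<phi> O \<psi>"
      then obtain a b c where abc: "y = (a, c)" "(a, b) \<in> \<phi>" "(b, c) \<in> \<psi>" by blast
      then have "h (a, b) = c" using g(4) h[of "(a, b)"] by simp
      then show "y \<in> ?k ` \<phi>" using abc by (intro image_eqI[of _ _ "(a, b)"]) simp_all
    qed
  qed
  have inj: "inj_on ?k \<phi>"
  proof (rule inj_onI)
    fix x y assume xy: "x \<in> \<phi>" "y \<in> \<phi>" "?k x = ?k y"
    have "(fst x, snd x) \<in> \<phi>" using xy(1) by simp
    moreover have "(fst x, snd y) \<in> \<phi>" using xy(2,3) by simp
    ultimately have "snd x = snd y" by (rule f(4))
    then show "x = y" using xy(3) by (simp add: prod_eq_iff)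
  qed
  have "Theta \<phi> \<otimes>\<^bsub>M\<^esub> Theta \<psi> = (\<Oplus>\<^bsub>M\<^esub>x\<in>\<phi>. fst x \<otimes>\<^bsub>M\<^esub> adj (snd x) \<otimes>\<^bsub>M\<^esub> Theta \<psi>)"
    unfolding Theta_def[of \<phi>] using f(1,8,9) Theta_closed[OF \<psi>] by (intro M.finsum_ldistr) auto
  also have "\<dots> = (\<Oplus>\<^bsub>M\<^esub>x\<in>\<phi>. fst x \<otimes>\<^bsub>M\<^esub> adj (h x))"
  proof (intro M.finsum_cong' refl)
    fix x assume x: "x \<in> \<phi>"
    have "fst x \<otimes>\<^bsub>M\<^esub> adj (snd x) \<otimes>\<^bsub>M\<^esub> Theta \<psi> = fst x \<otimes>\<^bsub>M\<^esub> (adj (snd x) \<otimes>\<^bsub>M\<^esub> Theta \<psi>)"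
      using f(8,9)[OF x] Theta_closed[OF \<psi>] by (intro M.m_assoc) auto
    then show "fst x \<otimes>\<^bsub>M\<^esub> adj (snd x) \<otimes>\<^bsub>M\<^esub> Theta \<psi> = fst x \<otimes>\<^bsub>M\<^esub> adj (h x)"
      using adj_mult_Theta[OF \<psi> h[OF x]] by simp
  qed (use f(8) hW in auto)
  also have "\<dots> = (\<Oplus>\<^bsub>M\<^esub>y\<in>?k ` \<phi>. fst y \<otimes>\<^bsub>M\<^esub> adj (snd y))"
    using f(8) hW by (subst M.finsum_reindex[OF _ inj]) auto
  finally show ?thesis unfolding img unfolding Theta_def[of "?k ` \<phi>"] by (rule sym)
qed

lemma Theta_Id_on:
  assumes "frame A" shows "Theta (Id_on A) = \<one>\<^bsub>M\<^esub>"
proof -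
  have "Id_on A = (\<lambda>a. (a, a)) ` A" by (auto simp: Id_on_def)
  moreover have "inj_on (\<lambda>a. (a, a)) A" by (auto simp: inj_on_def)
  ultimately have "Theta (Id_on A) = (\<Oplus>\<^bsub>M\<^esub>a\<in>A. a \<otimes>\<^bsub>M\<^esub> adj a)"
    unfolding Theta_def using frameD(3)[OF assms] by (simp only:) (subst M.finsum_reindex, auto)
  then show ?thesis using frameD(5)[OF assms] by simp
qed

lemma adj_finsum:
  assumes "finite A" "\<And>x. x \<in> A \<Longrightarrow> f x \<in> carrier M"
  shows "adj (finsum M f A) = (\<Oplus>\<^bsub>M\<^esub>x\<in>A. adj (f x))"
  using assms
proof (induction A rule: finite_induct)
  case (insert a A)
  have "finsum M f (insert a A) = f a \<oplus>\<^bsub>M\<^esub> finsum M f A"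
    using insert by (intro M.finsum_insert) auto
  moreover have "(\<Oplus>\<^bsub>M\<^esub>x\<in>insert a A. adj (f x)) = adj (f a) \<oplus>\<^bsub>M\<^esub> (\<Oplus>\<^bsub>M\<^esub>x\<in>A. adj (f x))"
    using insert by (intro M.finsum_insert) auto
  ultimately show ?case using insert by (simp add: adj_add)
qed (simp add: adj_zero)

lemma Theta_converse:
  assumes "frame_bij \<phi>" shows "Theta (\<phi>\<inverse>) = adj (Theta \<phi>)"
proof -
  note f = frame_bijD[OF assms]
  have img: "\<phi>\<inverse> = prod.swap ` \<phi>" by force
  have "Theta (\<phi>\<inverse>) = (\<Oplus>\<^bsub>M\<^esub>x\<in>\<phi>. snd x \<otimes>\<^bsub>M\<^esub> adj (fst x))"
    unfolding Theta_def img using f(8,9) by (subst M.finsum_reindex) auto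
  also have "\<dots> = (\<Oplus>\<^bsub>M\<^esub>x\<in>\<phi>. adj (fst x \<otimes>\<^bsub>M\<^esub> adj (snd x)))"
    using f(8,9) by (intro M.finsum_cong') (auto simp: adj_outer)
  also have "\<dots> = adj (Theta \<phi>)"
    unfolding Theta_def using f(1,8,9) by (intro adj_finsum[symmetric]) auto
  finally show ?thesis .
qed

text \<open>Composites with the converse are identities on frames, and on those \<open>Theta\<close>
  is the completeness sum.\<close>

lemma Theta_unitary:
  assumes "frame_bij \<phi>" shows "Theta \<phi> \<in> unitaries r t m"
proof -
  note f = frame_bijD[OF assms] and c = frame_bij_converse[OF assms]
  have "\<phi> O \<phi>\<inverse> = Id_on (Domain \<phi>)" "\<phi>\<inverse> O \<phi> = Id_on (Range \<phi>)"
    by (auto simp: Id_on_iff; use f(4,5) in blast)+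
  then have "Theta \<phi> \<otimes>\<^bsub>M\<^esub> Theta (\<phi>\<inverse>) = \<one>\<^bsub>M\<^esub>" "Theta (\<phi>\<inverse>) \<otimes>\<^bsub>M\<^esub> Theta \<phi> = \<one>\<^bsub>M\<^esub>"
    using Theta_relcomp[OF assms c] Theta_relcomp[OF c assms] Theta_Id_on[OF f(2)] Theta_Id_on[OF f(3)]
    by simp_all
  then show ?thesis
    using Theta_closed[OF assms] unfolding unitaries_def Theta_converse[OF assms] by simp
qed

lemma Theta_positive:
  assumes "frame_bij \<phi>" shows "Theta \<phi> \<in> positive_cone r t m"
proof -
  note f = frame_bijD[OF assms]
  let ?g = "\<lambda>x. fst x \<otimes>\<^bsub>M\<^esub> adj (snd x)"
  \<comment> \<open>Stated for all subsets, because those met in the induction are not graphs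
    between frames.\<close>
  have "finsum M ?g \<psi> \<in> positive_cone r t m" if "finite \<psi>" "\<psi> \<subseteq> \<phi>" for \<psi>
    using that
  proof (induction \<psi> rule: finite_induct)
    case empty
    have "\<one>\<^bsub>add_monoid M\<^esub> \<in> positive_cone r t m"
      unfolding positive_cone_eq by (rule submonoid_generated.one)
    then show ?case by simp
  next
    case (insert x \<psi>)
    have gW: "?g y \<in> carrier M" if "y \<in> \<phi>" for y using f(8,9)[OF that] by simp
    have "?g x \<in> positive_cone r t m"
      unfolding positive_cone_eq
      using insert.prems f(8,9) by (intro submonoid_generated.incl outer_in_cone_gens) auto
    moreover have "finsum M ?g \<psi> \<in> positive_cone r t m" using insert by auto
    ultimately have "?g x \<otimes>\<^bsub>add_monoid M\<^esub> finsum M ?g \<psi> \<in> positive_cone r t m"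
      unfolding positive_cone_eq by (rule submonoid_generated.mult)
    moreover have "finsum M ?g (insert x \<psi>) = ?g x \<oplus>\<^bsub>M\<^esub> finsum M ?g \<psi>"
      using insert.hyps insert.prems gW by (intro M.finsum_insert) blast+
    ultimately show ?case by simp
  qed
  then show ?thesis unfolding Theta_def using f(1) by blast
qed


section \<open>Every positive unitary comes from a bijection of bases\<close>

text \<open>Terms of a positive element may repeat, so they form a list rather than a set. The
  length of such a list is what \<open>isometric_lsum_single\<close> bounds.\<close>

definition lsum :: "('x \<Rightarrow> leavitt_matrix) \<Rightarrow> 'x list \<Rightarrow> leavitt_matrix" where
  "lsum f xs = foldr (\<lambda>x s. f x \<oplus>\<^bsub>M\<^esub> s) xs \<zero>\<^bsub>M\<^esub>"

lemma lsum_simps [simp]: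
  "lsum f [] = \<zero>\<^bsub>M\<^esub>" "lsum f (x # xs) = f x \<oplus>\<^bsub>M\<^esub> lsum f xs"
  by (simp_all add: lsum_def)

lemma lsum_closed: "(\<And>x. x \<in> set xs \<Longrightarrow> f x \<in> carrier M) \<Longrightarrow> lsum f xs \<in> carrier M"
  by (induction xs) auto

lemma lsum_append:
  "(\<And>x. x \<in> set xs \<union> set ys \<Longrightarrow> f x \<in> carrier M) \<Longrightarrow> lsum f (xs @ ys) = lsum f xs \<oplus>\<^bsub>M\<^esub> lsum f ys"
  by (induction xs) (auto simp: M.a_assoc lsum_closed)

lemma lsum_cong: "(\<And>x. x \<in> set xs \<Longrightarrow> f x = g x) \<Longrightarrow> lsum f xs = lsum g xs"
  by (induction xs) auto

lemma lsum_rmult: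
  assumes "\<And>x. x \<in> set xs \<Longrightarrow> f x \<in> carrier M" "c \<in> carrier M"
  shows "lsum f xs \<otimes>\<^bsub>M\<^esub> c = lsum (\<lambda>x. f x \<otimes>\<^bsub>M\<^esub> c) xs"
  using assms by (induction xs) (auto simp: M.l_distr lsum_closed)

lemma lsum_lmult:
  assumes "\<And>x. x \<in> set xs \<Longrightarrow> f x \<in> carrier M" "c \<in> carrier M"
  shows "c \<otimes>\<^bsub>M\<^esub> lsum f xs = lsum (\<lambda>x. c \<otimes>\<^bsub>M\<^esub> f x) xs"
  using assms by (induction xs) (auto simp: M.r_distr lsum_closed)

lemma lsum_adj:
  assumes "\<And>x. x \<in> set xs \<Longrightarrow> f x \<in> carrier M"
  shows "adj (lsum f xs) = lsum (\<lambda>x. adj (f x)) xs"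
  using assms by (induction xs) (auto simp: adj_add adj_zero lsum_closed)

lemma lsum_filter:
  assumes "\<And>x. x \<in> set xs \<Longrightarrow> f x \<in> carrier M" "\<And>x. x \<in> set xs \<Longrightarrow> \<not> P x \<Longrightarrow> f x = \<zero>\<^bsub>M\<^esub>"
  shows "lsum f xs = lsum f (filter P xs)"
  using assms
proof (induction xs)
  case (Cons x xs)
  have "lsum f (filter P xs) \<in> carrier M"
    by (rule lsum_closed) (use Cons.prems(1) in auto)
  then show ?case using Cons by auto
qed simp

lemma lsum_map: "lsum f (map g xs) = lsum (\<lambda>x. f (g x)) xs"
  by (induction xs) auto

lemma wt_lsum:
  "(\<And>x. x \<in> set xs \<Longrightarrow> f x \<in> carrier M) \<Longrightarrow> wt (lsum f xs) = (\<Sum>x\<leftarrow>xs. wt (f x))"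
  by (induction xs) (auto simp: wt_zero wt_add lsum_closed)

abbreviation "outer x \<equiv> fst x \<otimes>\<^bsub>M\<^esub> adj (snd x)"

lemma outer_closed: "x \<in> W \<times> W \<Longrightarrow> outer x \<in> carrier M"
  by auto

lemma cone_lsum:
  assumes "U \<in> positive_cone r t m"
  shows "\<exists>xs. set xs \<subseteq> W \<times> W \<and> U = lsum outer xs"
  using assms unfolding positive_cone_eq
proof (induction rule: submonoid_generated.induct)
  case one
  show ?case by (intro exI[of _ "[]"]) simp
next
  case (incl U)
  then consider "U = \<zero>\<^bsub>M\<^esub>" | a b where "a \<in> W" "b \<in> W" "U = a \<otimes>\<^bsub>M\<^esub> adj b"
    using cone_gens_cases by blast
  then show ?case
  proof cases
    case 1
    then show ?thesis by (intro exI[of _ "[]"]) simp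
  next
    case 2
    then show ?thesis by (intro exI[of _ "[(a, b)]"]) simp
  qed
next
  case (mult U V)
  then obtain xs ys where *: "set xs \<subseteq> W \<times> W" "U = lsum outer xs" "set ys \<subseteq> W \<times> W" "V = lsum outer ys"
    by blast
  have "lsum outer (xs @ ys) = lsum outer xs \<oplus>\<^bsub>M\<^esub> lsum outer ys"
    by (rule lsum_append) (use * outer_closed in blast)
  then show ?case using * by (intro exI[of _ "xs @ ys"]) simp
qed

text \<open>Bridges the two kinds of sums: expanding a term yields a finite sum over letters, each
  of whose terms is already a list.\<close>

lemma refine_finsum:
  assumes "finite A" "\<And>s. s \<in> A \<Longrightarrow> \<exists>xs. set xs \<subseteq> W \<times> C \<and> f s = lsum outer xs" "C \<subseteq> W"
  shows "\<exists>xs. set xs \<subseteq> W \<times> C \<and> finsum M f A = lsum outer xs"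
  using assms(1,2)
proof (induction A rule: finite_induct)
  case empty
  show ?case by (intro exI[of _ "[]"]) simp
next
  case (insert a A)
  have c: "lsum outer xs \<in> carrier M" if "set xs \<subseteq> W \<times> C" for xs
    by (rule lsum_closed, rule outer_closed) (use that assms(3) in blast)
  have fc: "f s \<in> carrier M" if "s \<in> insert a A" for s
    using insert.prems[OF that] c by auto
  obtain xs ys where *: "set xs \<subseteq> W \<times> C" "f a = lsum outer xs"
    "set ys \<subseteq> W \<times> C" "finsum M f A = lsum outer ys"
    using insert by blast
  have "finsum M f (insert a A) = f a \<oplus>\<^bsub>M\<^esub> finsum M f A"
    using insert.hyps fc by (intro M.finsum_insert) auto
  also have "\<dots> = lsum outer (xs @ ys)"
    unfolding * by (rule lsum_append[symmetric], rule outer_closed) (use * assms(3) in auto)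
  finally show ?case using * by (intro exI[of _ "xs @ ys"]) simp
qed

text \<open>The second word is expanded down to the level while the first follows with the same
  letters. Nothing is claimed about the lengths of the first words.\<close>

lemma refine_outer:
  assumes "a \<in> W" "b \<in> lev N d"
  shows "\<exists>xs. set xs \<subseteq> W \<times> lev N 0 \<and> a \<otimes>\<^bsub>M\<^esub> adj b = lsum outer xs"
  using assms
proof (induction d arbitrary: a b)
  case 0
  then show ?case using lev_W[of b N 0] by (intro exI[of _ "[(a, b)]"]) simp
next
  case (Suc d)
  obtain l where l: "l \<in> {1..t}" "\<And>s. s \<in> {1..r} \<Longrightarrow> ch l b s \<in> lev N d"
    using lev_child[OF Suc.prems(2)] by metis
  have "\<exists>xs. set xs \<subseteq> W \<times> lev N 0 \<and> ch l a s \<otimes>\<^bsub>M\<^esub> adj (ch l b s) = lsum outer xs" if "s \<in> {1..r}" for s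
    using Suc.IH[OF child_in_W[OF Suc.prems(1) that] l(2)[OF that]] .
  then have "\<exists>xs. set xs \<subseteq> W \<times> lev N 0 \<and>
      (\<Oplus>\<^bsub>M\<^esub>s\<in>{1..r}. ch l a s \<otimes>\<^bsub>M\<^esub> adj (ch l b s)) = lsum outer xs"
    by (intro refine_finsum) (auto intro: lev_W)
  then show ?case
    unfolding children_sum[OF Suc.prems(1) lev_W[OF Suc.prems(2)] l(1)] .
qed

lemma refine_lsum:
  assumes "set xs \<subseteq> W \<times> (\<Union>d. lev N d)"
  shows "\<exists>ys. set ys \<subseteq> W \<times> lev N 0 \<and> lsum outer xs = lsum outer ys"
  using assms
proof (induction xs)
  case Nil
  show ?case by (intro exI[of _ "[]"]) simp
next
  case (Cons x xs)
  then obtain ys where ys: "set ys \<subseteq> W \<times> lev N 0" "lsum outer xs = lsum outer ys" by auto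
  obtain d where "fst x \<in> W" "snd x \<in> lev N d" using Cons.prems by auto
  then obtain zs where zs: "set zs \<subseteq> W \<times> lev N 0" "outer x = lsum outer zs"
    using refine_outer by blast
  have "lsum outer (zs @ ys) = lsum outer zs \<oplus>\<^bsub>M\<^esub> lsum outer ys"
    by (rule lsum_append, rule outer_closed) (use ys(1) zs(1) lev_W[of _ N 0] in blast)
  then show ?case using ys zs by (intro exI[of _ "zs @ ys"]) simp
qed

text \<open>The outer list shrinks in the induction while the inner one must stay whole, hence two
  lists in place of one.\<close>

lemma sum_list_ge_diagonal:
  fixes g :: "'x \<Rightarrow> 'x \<Rightarrow> int"
  assumes "\<And>x y. x \<in> set xs \<Longrightarrow> y \<in> set ys \<Longrightarrow> 0 \<le> g x y" "\<And>x. x \<in> set xs \<Longrightarrow> g x x = 1"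
    "set xs \<subseteq> set ys"
  shows "int (length xs) \<le> (\<Sum>x\<leftarrow>xs. \<Sum>y\<leftarrow>ys. g x y)"
  using assms
proof (induction xs)
  case (Cons x xs)
  have "g x x \<le> (\<Sum>y\<leftarrow>ys. g x y)"
  proof -
    have g0: "0 \<le> g x y" if "y \<in> set ys" for y
      using Cons.prems(1)[of x y] that by simp
    \<comment> \<open>The inner list has to shrink as well in order to isolate one of its
      entries.\<close>
    have "g x z \<le> (\<Sum>y\<leftarrow>zs. g x y)" if "z \<in> set zs" "set zs \<subseteq> set ys" for z zs
      using that
    proof (induction zs)
      case (Cons w zs)
      have "0 \<le> g x y" if "y \<in> set (w # zs)" for y
        using that Cons.prems(2) g0 by blast
      then have "0 \<le> (\<Sum>y\<leftarrow>zs. g x y)" "0 \<le> g x w"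
        by (auto intro!: sum_list_nonneg)
      then show ?case using Cons by auto
    qed simp
    from this[of x ys] Cons.prems(3) show ?thesis by simp
  qed
  then show ?case using Cons by auto
qed simp

text \<open>Positivity enters here: the diagonal terms of the Gram sum have weight \<open>1\<close>, the others have
  non-negative weight, and the total weight is \<open>1\<close>.\<close>

lemma isometric_lsum_single:
  assumes "set as \<subseteq> W" "lsum adj as \<otimes>\<^bsub>M\<^esub> lsum (\<lambda>a. a) as = e"
  shows "\<exists>a. as = [a]"
proof -
  have c: "a \<in> carrier M" if "a \<in> set as" for a using that assms(1) by auto
  have s: "lsum (\<lambda>a. a) as \<in> carrier M" by (rule lsum_closed) (rule c)
  have "lsum adj as \<otimes>\<^bsub>M\<^esub> lsum (\<lambda>a. a) as = lsum (\<lambda>a. adj a \<otimes>\<^bsub>M\<^esub> lsum (\<lambda>a. a) as) as"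
    by (rule lsum_rmult) (use c s in auto)
  also have "\<dots> = lsum (\<lambda>a. lsum (\<lambda>b. adj a \<otimes>\<^bsub>M\<^esub> b) as) as"
    by (rule lsum_cong, rule lsum_lmult) (use c in auto)
  finally have "1 = wt (lsum (\<lambda>a. lsum (\<lambda>b. adj a \<otimes>\<^bsub>M\<^esub> b) as) as)"
    using assms(2) wt_e by simp
  also have "\<dots> = (\<Sum>a\<leftarrow>as. wt (lsum (\<lambda>b. adj a \<otimes>\<^bsub>M\<^esub> b) as))"
    by (rule wt_lsum, rule lsum_closed) (use c in auto)
  also have "\<dots> = (\<Sum>a\<leftarrow>as. \<Sum>b\<leftarrow>as. wt (adj a \<otimes>\<^bsub>M\<^esub> b))"
    by (intro arg_cong[where f = sum_list] map_cong refl wt_lsum) (use c in auto)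
  finally have "(\<Sum>a\<leftarrow>as. \<Sum>b\<leftarrow>as. wt (adj a \<otimes>\<^bsub>M\<^esub> b)) = 1" by simp
  moreover have "int (length as) \<le> (\<Sum>a\<leftarrow>as. \<Sum>b\<leftarrow>as. wt (adj a \<otimes>\<^bsub>M\<^esub> b))"
  proof (rule sum_list_ge_diagonal)
    fix a assume "a \<in> set as"
    then show "wt (adj a \<otimes>\<^bsub>M\<^esub> a) = 1" using assms(1) adj_self wt_e by auto
  qed (use assms(1) wt_adj_mult_nonneg in auto)
  moreover have "as \<noteq> []" using assms(2) e_nonzero by auto
  ultimately have "length as = 1" by (cases as) auto
  then show ?thesis by (simp add: length_Suc_conv One_nat_def)
qed

text \<open>Orthogonality within the level makes \<open>c\<close> select the terms of
  \<open>U\<close> ending in \<open>c\<close>. Both \<open>U c\<close> and its adjoint are read off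
  from the same sublist, and unitarity makes their product \<open>e\<close>, so the list has one
  entry.\<close>

lemma unitary_columns:
  assumes U: "U \<in> unitaries r t m" "U = lsum outer xs" and xs: "set xs \<subseteq> W \<times> lev N 0"
    and c: "c \<in> lev N 0"
  shows "\<exists>a\<in>W. U \<otimes>\<^bsub>M\<^esub> c = a \<and> adj c \<otimes>\<^bsub>M\<^esub> adj U = adj a"
proof -
  let ?ys = "filter (\<lambda>x. snd x = c) xs"
  let ?as = "map fst ?ys"
  have cW: "c \<in> W" using c by (rule lev_W)
  have x: "fst x \<in> W" "snd x \<in> lev N 0" "snd x \<in> W" if "x \<in> set xs" for x
    using xs that lev_W[of _ N 0] by auto
  have UM: "U \<in> carrier M" using U(1) unfolding unitaries_def by simp
  have adjU: "adj U = lsum (\<lambda>x. snd x \<otimes>\<^bsub>M\<^esub> adj (fst x)) xs"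
  proof -
    have "adj U = lsum (\<lambda>x. adj (outer x)) xs"
      unfolding U(2) by (rule lsum_adj) (use x in simp)
    also have "\<dots> = lsum (\<lambda>x. snd x \<otimes>\<^bsub>M\<^esub> adj (fst x)) xs"
      by (rule lsum_cong) (use x adj_outer in simp)
    finally show ?thesis .
  qed
  have sel: "adj (snd x) \<otimes>\<^bsub>M\<^esub> c = (if snd x = c then e else \<zero>\<^bsub>M\<^esub>)"
    "adj c \<otimes>\<^bsub>M\<^esub> snd x = (if snd x = c then e else \<zero>\<^bsub>M\<^esub>)" if "x \<in> set xs" for x
    using x[OF that] c cW adj_self lev_orthogonal[of _ N] by auto
  have "U \<otimes>\<^bsub>M\<^esub> c = lsum (\<lambda>x. outer x \<otimes>\<^bsub>M\<^esub> c) xs"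
    unfolding U(2) by (rule lsum_rmult) (use x cW in auto)
  also have "\<dots> = lsum (\<lambda>x. if snd x = c then fst x else \<zero>\<^bsub>M\<^esub>) xs"
  proof (rule lsum_cong)
    fix z assume z: "z \<in> set xs"
    have "outer z \<otimes>\<^bsub>M\<^esub> c = fst z \<otimes>\<^bsub>M\<^esub> (adj (snd z) \<otimes>\<^bsub>M\<^esub> c)"
      using x[OF z] cW by (intro M.m_assoc) auto
    then show "outer z \<otimes>\<^bsub>M\<^esub> c = (if snd z = c then fst z else \<zero>\<^bsub>M\<^esub>)"
      unfolding sel(1)[OF z] using x[OF z] W_e by simp
  qed
  also have "\<dots> = lsum (\<lambda>x. if snd x = c then fst x else \<zero>\<^bsub>M\<^esub>) ?ys"
    by (rule lsum_filter) (use x in auto)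
  also have "\<dots> = lsum (\<lambda>a. a) ?as"
    unfolding lsum_map by (rule lsum_cong) simp
  finally have Uc: "U \<otimes>\<^bsub>M\<^esub> c = lsum (\<lambda>a. a) ?as" .
  have "adj c \<otimes>\<^bsub>M\<^esub> adj U = lsum (\<lambda>x. adj c \<otimes>\<^bsub>M\<^esub> (snd x \<otimes>\<^bsub>M\<^esub> adj (fst x))) xs"
    unfolding adjU by (rule lsum_lmult) (use x cW in auto)
  also have "\<dots> = lsum (\<lambda>x. if snd x = c then adj (fst x) else \<zero>\<^bsub>M\<^esub>) xs"
  proof (rule lsum_cong)
    fix z assume z: "z \<in> set xs"
    have "adj c \<otimes>\<^bsub>M\<^esub> (snd z \<otimes>\<^bsub>M\<^esub> adj (fst z)) = adj c \<otimes>\<^bsub>M\<^esub> snd z \<otimes>\<^bsub>M\<^esub> adj (fst z)"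
      using x[OF z] cW by (intro M.m_assoc[symmetric]) auto
    then show "adj c \<otimes>\<^bsub>M\<^esub> (snd z \<otimes>\<^bsub>M\<^esub> adj (fst z)) = (if snd z = c then adj (fst z) else \<zero>\<^bsub>M\<^esub>)"
      unfolding sel(2)[OF z] using x[OF z] e_adj by simp
  qed
  also have "\<dots> = lsum (\<lambda>x. if snd x = c then adj (fst x) else \<zero>\<^bsub>M\<^esub>) ?ys"
    by (rule lsum_filter) (use x in auto)
  also have "\<dots> = lsum adj ?as"
    unfolding lsum_map by (rule lsum_cong) simp
  finally have cU: "adj c \<otimes>\<^bsub>M\<^esub> adj U = lsum adj ?as" .
  \<comment> \<open>The Gram sum of the selected words collapses to \<open>adj c\<close> times
    \<open>c\<close>, since \<open>adj U\<close> cancels \<open>U\<close>.\<close>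
  have "lsum adj ?as \<otimes>\<^bsub>M\<^esub> lsum (\<lambda>a. a) ?as = adj c \<otimes>\<^bsub>M\<^esub> (adj U \<otimes>\<^bsub>M\<^esub> U) \<otimes>\<^bsub>M\<^esub> c"
    unfolding Uc[symmetric] cU[symmetric] using UM cW by (simp add: M.m_assoc)
  also have "\<dots> = e"
    using U(1) cW adj_self unfolding unitaries_def by simp
  finally have "\<exists>a. ?as = [a]"
    by (intro isometric_lsum_single) (use x in auto)
  then obtain a where a: "?as = [a]" ..
  have "a \<in> set ?as" unfolding a by simp
  then have aW: "a \<in> W" using x by auto
  then show ?thesis using Uc cU unfolding a by (intro bexI[of _ a]) simp_all
qed

text \<open>Replaces the hidden function by conditions on the graph, the form in which expansion,
  composition and converse preserve them.\<close>

lemma basis_bijections_iff: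
  "\<phi> \<in> basis_bijections r t m \<longleftrightarrow>
    frame_bij \<phi> \<and> Domain \<phi> \<in> bases r t m \<and> Range \<phi> \<in> bases r t m"
proof
  assume "\<phi> \<in> basis_bijections r t m"
  then obtain f A B where *: "\<phi> = (\<lambda>a. (a, f a)) ` A" "A \<in> bases r t m" "B \<in> bases r t m" "bij_betw f A B"
    unfolding basis_bijections_def by blast
  have D: "Domain \<phi> = A" unfolding *(1) by force
  have "Range \<phi> = f ` A" unfolding *(1) by force
  then have R: "Range \<phi> = B" using *(4) by (simp add: bij_betw_def)
  have "single_valued \<phi>" unfolding *(1) single_valued_def by blast
  moreover have "single_valued (\<phi>\<inverse>)"
    unfolding *(1) single_valued_def using bij_betw_imp_inj_on[OF *(4)] by (auto dest: inj_onD)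
  moreover have "finite \<phi>" unfolding *(1) using frameD(1)[OF bases_frame[OF *(2)]] by simp
  ultimately show "frame_bij \<phi> \<and> Domain \<phi> \<in> bases r t m \<and> Range \<phi> \<in> bases r t m"
    unfolding frame_bij_def D R using * bases_frame by blast
next
  assume *: "frame_bij \<phi> \<and> Domain \<phi> \<in> bases r t m \<and> Range \<phi> \<in> bases r t m"
  note f = frame_bijD[OF conjunct1[OF *]]
  have "\<forall>a. \<exists>b. a \<in> Domain \<phi> \<longrightarrow> (a, b) \<in> \<phi>" by blast
  from choice[OF this] obtain g where g: "\<And>a. a \<in> Domain \<phi> \<Longrightarrow> (a, g a) \<in> \<phi>" by blast
  have "\<phi> = (\<lambda>a. (a, g a)) ` Domain \<phi>"
  proof
    show "\<phi> \<subseteq> (\<lambda>a. (a, g a)) ` Domain \<phi>"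
    proof
      fix x assume x: "x \<in> \<phi>"
      then have d: "fst x \<in> Domain \<phi>" by (simp add: Domain_fst)
      have "snd x = g (fst x)" using f(4)[of "fst x" "snd x" "g (fst x)"] x g[OF d] by simp
      then show "x \<in> (\<lambda>a. (a, g a)) ` Domain \<phi>"
        using d by (intro image_eqI[of _ _ "fst x"]) (simp_all add: prod_eq_iff)
    qed
  qed (use g in auto)
  moreover have "bij_betw g (Domain \<phi>) (Range \<phi>)"
    unfolding bij_betw_def
  proof
    show "inj_on g (Domain \<phi>)"
    proof (rule inj_onI)
      fix x y assume "x \<in> Domain \<phi>" "y \<in> Domain \<phi>" "g x = g y"
      then show "x = y" using f(5)[of x "g x" y] g[of x] g[of y] by simp
    qed
    show "g ` Domain \<phi> = Range \<phi>"
    proof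
      show "Range \<phi> \<subseteq> g ` Domain \<phi>"
      proof
        fix b assume "b \<in> Range \<phi>"
        then obtain a where a: "(a, b) \<in> \<phi>" by blast
        then have "b = g a" using f(4)[OF a g] by blast
        then show "b \<in> g ` Domain \<phi>" using a by blast
      qed
    qed (use g in blast)
  qed
  ultimately show "\<phi> \<in> basis_bijections r t m"
    unfolding basis_bijections_def using * by blast
qed

lemma positive_unitary_is_Theta:
  assumes "U \<in> positive_cone r t m" "U \<in> unitaries r t m"
  shows "\<exists>\<phi>\<in>basis_bijections r t m. Theta \<phi> = U"
proof -
  obtain xs0 where xs0: "set xs0 \<subseteq> W \<times> W" "U = lsum outer xs0"
    using cone_lsum[OF assms(1)] by blast
  have "snd ` set xs0 \<subseteq> W" using xs0(1) by auto
  \<comment> \<open>Only the second words are made uniform; the first ones are settled by unitarity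
    and a later expansion.\<close>
  then obtain N where "snd ` set xs0 \<subseteq> (\<Union>d. lev N d)"
    using lev_exists_finite[of "snd ` set xs0"] by auto
  then have "snd x \<in> (\<Union>d. lev N d)" "fst x \<in> W" if "x \<in> set xs0" for x
    using that xs0(1) by (blast, auto)
  then have "set xs0 \<subseteq> W \<times> (\<Union>d. lev N d)"
    unfolding subset_iff mem_Times_iff by blast
  from refine_lsum[OF this] obtain xs where xs: "set xs \<subseteq> W \<times> lev N 0" "U = lsum outer xs"
    using xs0(2) by auto
  define C where "C = lev N 0"
  have CB: "C \<in> bases r t m" unfolding C_def by (rule level_basis)
  note C = frameD[OF bases_frame[OF CB]]
  have UM: "U \<in> carrier M" and UU: "U \<otimes>\<^bsub>M\<^esub> adj U = \<one>\<^bsub>M\<^esub>" "adj U \<otimes>\<^bsub>M\<^esub> U = \<one>\<^bsub>M\<^esub>"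
    using assms(2) unfolding unitaries_def by auto
  define f where "f c = U \<otimes>\<^bsub>M\<^esub> c" for c
  have fW: "f c \<in> W" and cU: "adj c \<otimes>\<^bsub>M\<^esub> adj U = adj (f c)" if "c \<in> C" for c
    using unitary_columns[OF assms(2) xs(2,1)] that unfolding f_def C_def by blast+
  \<comment> \<open>An isometry preserves all Gram products, so the image of \<open>C\<close> is
    orthogonal and \<open>f\<close> is injective.\<close>
  have orth: "adj (f c) \<otimes>\<^bsub>M\<^esub> f c' = adj c \<otimes>\<^bsub>M\<^esub> c'" if "c \<in> C" "c' \<in> C" for c c'
  proof -
    have "adj (f c) \<otimes>\<^bsub>M\<^esub> f c' = adj c \<otimes>\<^bsub>M\<^esub> (adj U \<otimes>\<^bsub>M\<^esub> U) \<otimes>\<^bsub>M\<^esub> c'"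
      unfolding cU[OF that(1), symmetric] unfolding f_def using UM C(3) that by (simp add: M.m_assoc)
    then show ?thesis unfolding UU using C(3) that by simp
  qed
  have ne: "f c \<noteq> f c'" if "c \<in> C" "c' \<in> C" "c \<noteq> c'" for c c'
    using orth[OF that(1,2)] C(4)[OF that] orthogonal_imp_neq[OF fW[OF that(1)]] by simp
  then have inj: "inj_on f C" unfolding inj_on_def by blast
  \<comment> \<open>The other half of unitarity: conjugating the completeness relation of
    \<open>C\<close> by \<open>U\<close> gives the one for the image.\<close>
  have "(\<Oplus>\<^bsub>M\<^esub>a\<in>f ` C. a \<otimes>\<^bsub>M\<^esub> adj a) = (\<Oplus>\<^bsub>M\<^esub>c\<in>C. f c \<otimes>\<^bsub>M\<^esub> adj (f c))"
    using fW by (intro M.finsum_reindex[OF _ inj]) auto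
  also have "\<dots> = (\<Oplus>\<^bsub>M\<^esub>c\<in>C. U \<otimes>\<^bsub>M\<^esub> (c \<otimes>\<^bsub>M\<^esub> adj c) \<otimes>\<^bsub>M\<^esub> adj U)"
  proof (intro M.finsum_cong' refl)
    fix c assume c: "c \<in> C"
    show "f c \<otimes>\<^bsub>M\<^esub> adj (f c) = U \<otimes>\<^bsub>M\<^esub> (c \<otimes>\<^bsub>M\<^esub> adj c) \<otimes>\<^bsub>M\<^esub> adj U"
      unfolding cU[OF c, symmetric] unfolding f_def using UM C(3)[OF c] by (simp add: M.m_assoc)
  qed (use UM C(3) in auto)
  also have "\<dots> = (\<Oplus>\<^bsub>M\<^esub>c\<in>C. U \<otimes>\<^bsub>M\<^esub> (c \<otimes>\<^bsub>M\<^esub> adj c)) \<otimes>\<^bsub>M\<^esub> adj U"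
    using UM C(1,3) by (intro M.finsum_ldistr[symmetric]) auto
  also have "(\<Oplus>\<^bsub>M\<^esub>c\<in>C. U \<otimes>\<^bsub>M\<^esub> (c \<otimes>\<^bsub>M\<^esub> adj c)) = U \<otimes>\<^bsub>M\<^esub> (\<Oplus>\<^bsub>M\<^esub>c\<in>C. c \<otimes>\<^bsub>M\<^esub> adj c)"
    using UM C(1,3) by (intro M.finsum_rdistr[symmetric]) auto
  finally have complete: "(\<Oplus>\<^bsub>M\<^esub>a\<in>f ` C. a \<otimes>\<^bsub>M\<^esub> adj a) = \<one>\<^bsub>M\<^esub>"
    unfolding C(5) using UM UU by simp
  have "adj a \<otimes>\<^bsub>M\<^esub> b = \<zero>\<^bsub>M\<^esub>" if "a \<in> f ` C" "b \<in> f ` C" "a \<noteq> b" for a b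
  proof -
    obtain c c' where "c \<in> C" "c' \<in> C" "a = f c" "b = f c'" using \<open>a \<in> f ` C\<close> \<open>b \<in> f ` C\<close> by blast
    then show ?thesis using orth[of c c'] C(4)[of c c'] \<open>a \<noteq> b\<close> by auto
  qed
  then have frame_img: "frame (f ` C)"
    unfolding frame_def using C(1) fW complete by blast
  \<comment> \<open>The image comes first, so that \<open>Theta\<close> is the sum of
    \<open>U c\<close> times \<open>adj c\<close>, which is \<open>U\<close>.\<close>
  define \<phi>0 where "\<phi>0 = (\<lambda>c. (f c, c)) ` C"
  have D0: "Domain \<phi>0 = f ` C" and R0: "Range \<phi>0 = C" unfolding \<phi>0_def by force+
  have "single_valued \<phi>0" unfolding \<phi>0_def single_valued_def using inj unfolding inj_on_def by blast
  moreover have "single_valued (\<phi>0\<inverse>)" unfolding \<phi>0_def single_valued_def by blast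
  moreover have "finite \<phi>0" unfolding \<phi>0_def using C(1) by simp
  ultimately have fb0: "frame_bij \<phi>0"
    unfolding frame_bij_def D0 R0 using frame_img bases_frame[OF CB] by blast
  have inj2: "inj_on (\<lambda>c. (f c, c)) C" by (auto simp: inj_on_def)
  have "Theta \<phi>0 = (\<Oplus>\<^bsub>M\<^esub>c\<in>C. f c \<otimes>\<^bsub>M\<^esub> adj c)"
    unfolding Theta_def \<phi>0_def using fW C(3) by (subst M.finsum_reindex[OF _ inj2]) auto
  also have "\<dots> = (\<Oplus>\<^bsub>M\<^esub>c\<in>C. U \<otimes>\<^bsub>M\<^esub> (c \<otimes>\<^bsub>M\<^esub> adj c))"
    unfolding f_def using UM C(3) by (intro M.finsum_cong') (auto simp: M.m_assoc)
  also have "\<dots> = U \<otimes>\<^bsub>M\<^esub> (\<Oplus>\<^bsub>M\<^esub>c\<in>C. c \<otimes>\<^bsub>M\<^esub> adj c)"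
    using UM C(1,3) by (intro M.finsum_rdistr[symmetric]) auto
  finally have Th0: "Theta \<phi>0 = U" unfolding C(5) using UM by simp
  \<comment> \<open>The domain is so far only a frame. Expanding it to a level turns it into a
    basis, while the range started as a basis and stays one.\<close>
  obtain N' where "f ` C \<subseteq> (\<Union>d. lev N' d)"
    using lev_exists_finite[of "f ` C"] frameD(1,2)[OF frame_img] by auto
  then obtain \<psi> where \<psi>: "step\<^sup>*\<^sup>* \<phi>0 \<psi>" "Domain \<psi> = lev N' 0"
    using expand_domain_to_level[OF fb0, of N'] unfolding D0 by blast
  have "frame_bij \<psi>" "Theta \<psi> = U" "Range \<psi> \<in> bases r t m"
    using steps_preserve[OF \<psi>(1) fb0] Th0 R0 CB by auto
  moreover have "Domain \<psi> \<in> bases r t m" unfolding \<psi>(2) by (rule level_basis)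
  ultimately show ?thesis using basis_bijections_iff by blast
qed


section \<open>The isomorphism\<close>

lemma expands_to_iff: "expands_to r t m \<phi> \<psi> \<longleftrightarrow> \<phi> \<in> basis_bijections r t m \<and> step \<phi> \<psi>"
  unfolding expands_to_def step_def ..

lemma expands_to_preserves:
  assumes "expands_to r t m \<phi> \<psi>"
  shows "\<phi> \<in> basis_bijections r t m" "\<psi> \<in> basis_bijections r t m" "Theta \<psi> = Theta \<phi>"
  using assms step_preserves[of \<phi> \<psi>] unfolding expands_to_iff basis_bijections_iff by auto

text \<open>\<open>equivclp\<close> relates arbitrary relations, but \<open>expands_to\<close> keeps
  both its ends among bijections of bases, so a zigzag that starts there never leaves.\<close>

lemma equiv_imp_Theta_eq:
  assumes "equivclp (expands_to r t m) \<phi> \<psi>" "\<phi> \<in> basis_bijections r t m"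
  shows "\<psi> \<in> basis_bijections r t m \<and> Theta \<psi> = Theta \<phi>"
  using assms(1)
proof (induction rule: equivclp_induct)
  case (step \<chi> \<psi>)
  then show ?case using expands_to_preserves by metis
qed (use assms(2) in auto)

lemma steps_imp_equiv:
  assumes "step\<^sup>*\<^sup>* \<phi> \<psi>" "\<phi> \<in> basis_bijections r t m"
  shows "\<psi> \<in> basis_bijections r t m \<and> equivclp (expands_to r t m) \<phi> \<psi>"
  using assms(1)
proof (induction rule: rtranclp_induct)
  case (step \<chi> \<psi>)
  then have "expands_to r t m \<chi> \<psi>" by (simp add: expands_to_iff)
  then show ?case
    using step.IH expands_to_preserves(2) by (meson equivclp_into_equivclp)
qed (use assms(2) in auto)

lemma common_level:
  assumes "frame A" "frame B"
  obtains N where "A \<subseteq> (\<Union>d. lev N d)" "B \<subseteq> (\<Union>d. lev N d)"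
proof -
  obtain N1 where N1: "\<forall>N\<ge>N1. A \<subseteq> (\<Union>d. lev N d)"
    using lev_exists_finite[OF frameD(1,2)[OF assms(1)]] ..
  obtain N2 where N2: "\<forall>N\<ge>N2. B \<subseteq> (\<Union>d. lev N d)"
    using lev_exists_finite[OF frameD(1,2)[OF assms(2)]] ..
  show ?thesis
    by (rule that[of "max N1 N2"]) (rule N1[rule_format] N2[rule_format], simp)+
qed

text \<open>Both bijections are expanded until their domains are the same level;
  \<open>Theta\<close> then forces the two expansions to be equal.\<close>

lemma Theta_eq_imp_equiv:
  assumes "\<phi> \<in> basis_bijections r t m" "\<psi> \<in> basis_bijections r t m" "Theta \<phi> = Theta \<psi>"
  shows "equivclp (expands_to r t m) \<phi> \<psi>"
proof -
  have fb: "frame_bij \<phi>" "frame_bij \<psi>" using assms basis_bijections_iff by blast+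
  have fr: "frame (Domain \<phi>)" "frame (Domain \<psi>)"
    using frame_bijD(2)[OF fb(1)] frame_bijD(2)[OF fb(2)] by simp_all
  obtain N where N: "Domain \<phi> \<subseteq> (\<Union>d. lev N d)" "Domain \<psi> \<subseteq> (\<Union>d. lev N d)"
    using fr by (rule common_level)
  obtain \<phi>' where \<phi>': "step\<^sup>*\<^sup>* \<phi> \<phi>'" "Domain \<phi>' = lev N 0"
    using expand_domain_to_level[OF fb(1) N(1)] by blast
  obtain \<psi>' where \<psi>': "step\<^sup>*\<^sup>* \<psi> \<psi>'" "Domain \<psi>' = lev N 0"
    using expand_domain_to_level[OF fb(2) N(2)] by blast
  have "\<phi>' = \<psi>'"
  proof (rule Theta_inject_same_Domain)
    show "frame_bij \<phi>'" "frame_bij \<psi>'"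
      using steps_preserve[OF \<phi>'(1) fb(1)] steps_preserve[OF \<psi>'(1) fb(2)] by blast+
    have "Theta \<phi>' = Theta \<phi>" "Theta \<psi>' = Theta \<psi>"
      using steps_preserve[OF \<phi>'(1) fb(1)] steps_preserve[OF \<psi>'(1) fb(2)] by blast+
    then show "Theta \<phi>' = Theta \<psi>'" using assms(3) by (simp only:)
    show "Domain \<phi>' = Domain \<psi>'" unfolding \<phi>'(2) \<psi>'(2) ..
  qed
  then show ?thesis
    using steps_imp_equiv[OF \<phi>'(1) assms(1)] steps_imp_equiv[OF \<psi>'(1) assms(2)]
    by (meson equivclp_sym equivclp_trans)
qed

text \<open>The isomorphism is given in the direction from matrices to classes, where no
  representative has to be chosen.\<close>

definition fiber :: "leavitt_matrix \<Rightarrow> basis_bij set" where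
  "fiber U = {\<phi> \<in> basis_bijections r t m. Theta \<phi> = U}"

lemma class_eq_fiber:
  assumes "\<phi> \<in> basis_bijections r t m"
  shows "expansion_equiv r t m `` {\<phi>} = fiber (Theta \<phi>)"
proof (rule Set.set_eqI)
  fix \<psi>
  have "\<psi> \<in> expansion_equiv r t m `` {\<phi>} \<longleftrightarrow> equivclp (expands_to r t m) \<phi> \<psi>"
    by (simp add: expansion_equiv_def)
  also have "\<dots> \<longleftrightarrow> \<psi> \<in> basis_bijections r t m \<and> Theta \<psi> = Theta \<phi>"
    using equiv_imp_Theta_eq[OF _ assms] Theta_eq_imp_equiv[OF assms, of \<psi>] by metis
  finally show "\<psi> \<in> expansion_equiv r t m `` {\<phi>} \<longleftrightarrow> \<psi> \<in> fiber (Theta \<phi>)"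
    by (simp only: fiber_def mem_Collect_eq)
qed

abbreviation "PU \<equiv> positive_unitary_group r t m"
abbreviation "BHT \<equiv> brin_higman_thompson_group r t m"

lemma PU_simps [simp]: "x \<otimes>\<^bsub>PU\<^esub> y = x \<otimes>\<^bsub>M\<^esub> y" "\<one>\<^bsub>PU\<^esub> = \<one>\<^bsub>M\<^esub>"
  by (simp_all add: positive_unitary_group_def)

lemma carrier_PU: "carrier PU = Theta ` basis_bijections r t m"
  using positive_unitary_is_Theta Theta_positive Theta_unitary
  unfolding positive_unitary_group_def by (auto simp: basis_bijections_iff)

lemma initial_bijection: "Id_on (initial_basis r t m) \<in> basis_bijections r t m"
  unfolding basis_bijections_iff using frame_bij_Id_on[OF frame_initial] initial_in_bases by simp

lemma relcomp_bijection:
  assumes "\<phi> \<in> basis_bijections r t m" "\<psi> \<in> basis_bijections r t m" "Range \<phi> = Domain \<psi>"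
  shows "\<phi> O \<psi> \<in> basis_bijections r t m" "Theta (\<phi> O \<psi>) = Theta \<phi> \<otimes>\<^bsub>M\<^esub> Theta \<psi>"
proof -
  have *: "frame_bij \<phi>" "Domain \<phi> \<in> bases r t m" "frame_bij \<psi>" "Range \<psi> \<in> bases r t m"
    using assms(1,2) basis_bijections_iff by blast+
  have D: "Domain (\<phi> O \<psi>) = Domain \<phi>" and R: "Range (\<phi> O \<psi>) = Range \<psi>"
    using assms(3) by blast+
  have "single_valued (\<phi> O \<psi>)" "single_valued ((\<phi> O \<psi>)\<inverse>)"
    using *(1,3) unfolding frame_bij_def converse_relcomp by (simp_all add: single_valued_relcomp)
  moreover have "finite (\<phi> O \<psi>)"
    using *(1,3) unfolding frame_bij_def by (simp add: finite_relcomp)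
  ultimately have "frame_bij (\<phi> O \<psi>)"
    unfolding frame_bij_def D R using bases_frame *(2,4) by blast
  then show "\<phi> O \<psi> \<in> basis_bijections r t m"
    unfolding basis_bijections_iff D R using *(2,4) by blast
  show "Theta (\<phi> O \<psi>) = Theta \<phi> \<otimes>\<^bsub>M\<^esub> Theta \<psi>" using *(1,3) assms(3) by (rule Theta_relcomp)
qed

text \<open>Range and domain are driven to the same level by separate expansions, which leave both
  values of \<open>Theta\<close> alone.\<close>

lemma composable_representatives:
  assumes "\<phi> \<in> basis_bijections r t m" "\<psi> \<in> basis_bijections r t m"
  obtains \<phi>' \<psi>' where "\<phi>' \<in> basis_bijections r t m" "\<psi>' \<in> basis_bijections r t m"
    "Theta \<phi>' = Theta \<phi>" "Theta \<psi>' = Theta \<psi>" "Range \<phi>' = Domain \<psi>'"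
proof -
  have fb: "frame_bij \<phi>" "frame_bij \<psi>" using assms basis_bijections_iff by blast+
  have fr: "frame (Range \<phi>)" "frame (Domain \<psi>)"
    using frame_bijD(3)[OF fb(1)] frame_bijD(2)[OF fb(2)] by simp_all
  obtain N where N: "Range \<phi> \<subseteq> (\<Union>d. lev N d)" "Domain \<psi> \<subseteq> (\<Union>d. lev N d)"
    using fr by (rule common_level)
  obtain \<phi>' where \<phi>': "step\<^sup>*\<^sup>* \<phi> \<phi>'" "Range \<phi>' = lev N 0"
    using expand_range_to_level[OF fb(1) N(1)] by blast
  obtain \<psi>' where \<psi>': "step\<^sup>*\<^sup>* \<psi> \<psi>'" "Domain \<psi>' = lev N 0"
    using expand_domain_to_level[OF fb(2) N(2)] by blast
  show ?thesis
  proof (rule that[of \<phi>' \<psi>'])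
    show "\<phi>' \<in> basis_bijections r t m" "\<psi>' \<in> basis_bijections r t m"
      using steps_imp_equiv[OF \<phi>'(1) assms(1)] steps_imp_equiv[OF \<psi>'(1) assms(2)] by blast+
    show "Theta \<phi>' = Theta \<phi>" "Theta \<psi>' = Theta \<psi>"
      using steps_preserve[OF \<phi>'(1) fb(1)] steps_preserve[OF \<psi>'(1) fb(2)] by blast+
    show "Range \<phi>' = Domain \<psi>'" unfolding \<phi>'(2) \<psi>'(2) ..
  qed
qed

text \<open>By \<open>carrier_PU\<close> every element comes from a bijection, so closure and
  inverses are inherited from composition and converse; associativity and the unit laws come from
  the matrix ring.\<close>

lemma PU_group: "group PU"
proof (rule groupI)
  fix x y assume "x \<in> carrier PU" "y \<in> carrier PU"
  then obtain \<phi> \<psi> where *: "\<phi> \<in> basis_bijections r t m" "\<psi> \<in> basis_bijections r t m"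
    "x = Theta \<phi>" "y = Theta \<psi>"
    unfolding carrier_PU by blast
  from *(1,2) obtain \<phi>' \<psi>' where "\<phi>' \<in> basis_bijections r t m" "\<psi>' \<in> basis_bijections r t m"
    "Theta \<phi>' = Theta \<phi>" "Theta \<psi>' = Theta \<psi>" "Range \<phi>' = Domain \<psi>'"
    by (rule composable_representatives)
  then show "x \<otimes>\<^bsub>PU\<^esub> y \<in> carrier PU"
    unfolding carrier_PU using relcomp_bijection[of \<phi>' \<psi>'] *(3,4)
    by (intro image_eqI[of _ _ "\<phi>' O \<psi>'"]) simp_all
next
  show "\<one>\<^bsub>PU\<^esub> \<in> carrier PU"
    unfolding carrier_PU using initial_bijection Theta_Id_on[OF frame_initial]
    by (intro image_eqI[of _ _ "Id_on (initial_basis r t m)"]) simp_all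
next
  have c: "x \<in> carrier M" if "x \<in> carrier PU" for x
  proof -
    obtain \<phi> where "\<phi> \<in> basis_bijections r t m" "x = Theta \<phi>"
      using \<open>x \<in> carrier PU\<close> unfolding carrier_PU by (elim imageE)
    then show ?thesis using Theta_closed unfolding basis_bijections_iff by simp
  qed
  show "x \<otimes>\<^bsub>PU\<^esub> y \<otimes>\<^bsub>PU\<^esub> z = x \<otimes>\<^bsub>PU\<^esub> (y \<otimes>\<^bsub>PU\<^esub> z)"
    if "x \<in> carrier PU" "y \<in> carrier PU" "z \<in> carrier PU" for x y z
    using c[OF that(1)] c[OF that(2)] c[OF that(3)] by (simp add: M.m_assoc)
  show "\<one>\<^bsub>PU\<^esub> \<otimes>\<^bsub>PU\<^esub> x = x" if "x \<in> carrier PU" for x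
    using c[OF that] by simp
next
  fix x assume x: "x \<in> carrier PU"
  then obtain \<phi> where \<phi>: "\<phi> \<in> basis_bijections r t m" "x = Theta \<phi>" unfolding carrier_PU by blast
  then have fb: "frame_bij \<phi>" using basis_bijections_iff by blast
  have "\<phi>\<inverse> \<in> basis_bijections r t m"
    using \<phi>(1) frame_bij_converse unfolding basis_bijections_iff by simp
  moreover have "Theta (\<phi>\<inverse>) \<otimes>\<^bsub>M\<^esub> Theta \<phi> = \<one>\<^bsub>M\<^esub>"
    using Theta_unitary[OF fb] unfolding Theta_converse[OF fb] unitaries_def by simp
  ultimately show "\<exists>y\<in>carrier PU. y \<otimes>\<^bsub>PU\<^esub> x = \<one>\<^bsub>PU\<^esub>"
    unfolding carrier_PU \<phi>(2) by (intro bexI[of _ "Theta (\<phi>\<inverse>)"]) simp_all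
qed

text \<open>All composites of composable representatives lie in one fibre. At least one composable
  pair exists, so the union defining the product is that whole fibre and not empty.\<close>

lemma BHT_mult_fiber:
  assumes "x \<in> carrier PU" "y \<in> carrier PU"
  shows "fiber x \<otimes>\<^bsub>BHT\<^esub> fiber y = fiber (x \<otimes>\<^bsub>M\<^esub> y)"
proof -
  have eq: "expansion_equiv r t m `` {\<phi> O \<psi>} = fiber (x \<otimes>\<^bsub>M\<^esub> y)"
    if "\<phi> \<in> fiber x" "\<psi> \<in> fiber y" "Range \<phi> = Domain \<psi>" for \<phi> \<psi>
    using that class_eq_fiber[of "\<phi> O \<psi>"] relcomp_bijection[of \<phi> \<psi>] unfolding fiber_def by simp
  obtain \<phi> where \<phi>: "\<phi> \<in> basis_bijections r t m" "x = Theta \<phi>"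
    using assms(1) unfolding carrier_PU by (elim imageE)
  obtain \<psi> where \<psi>: "\<psi> \<in> basis_bijections r t m" "y = Theta \<psi>"
    using assms(2) unfolding carrier_PU by (elim imageE)
  obtain \<phi>' \<psi>' where *: "\<phi>' \<in> fiber x" "\<psi>' \<in> fiber y" "Range \<phi>' = Domain \<psi>'"
    using \<phi>(1) \<psi>(1)
  proof (rule composable_representatives)
    fix \<phi>' \<psi>' assume "\<phi>' \<in> basis_bijections r t m" "\<psi>' \<in> basis_bijections r t m"
      "Theta \<phi>' = Theta \<phi>" "Theta \<psi>' = Theta \<psi>" "Range \<phi>' = Domain \<psi>'"
    then show thesis by (intro that[of \<phi>' \<psi>']) (simp_all add: fiber_def \<phi>(2) \<psi>(2))
  qed
  have "fiber x \<otimes>\<^bsub>BHT\<^esub> fiber y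
      = (\<Union>\<phi>\<in>fiber x. \<Union>\<psi>\<in>{\<psi>\<in>fiber y. Range \<phi> = Domain \<psi>}. expansion_equiv r t m `` {\<phi> O \<psi>})"
    by (simp add: brin_higman_thompson_group_def)
  also have "\<dots> = fiber (x \<otimes>\<^bsub>M\<^esub> y)"
  proof
    show "(\<Union>\<phi>\<in>fiber x. \<Union>\<psi>\<in>{\<psi>\<in>fiber y. Range \<phi> = Domain \<psi>}. expansion_equiv r t m `` {\<phi> O \<psi>})
        \<subseteq> fiber (x \<otimes>\<^bsub>M\<^esub> y)"
      using eq by blast
    show "fiber (x \<otimes>\<^bsub>M\<^esub> y)
        \<subseteq> (\<Union>\<phi>\<in>fiber x. \<Union>\<psi>\<in>{\<psi>\<in>fiber y. Range \<phi> = Domain \<psi>}. expansion_equiv r t m `` {\<phi> O \<psi>})"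
      unfolding eq[OF *, symmetric] using * by blast
  qed
  finally show ?thesis .
qed

lemma fiber_iso: "fiber \<in> iso PU BHT"
proof (rule isoI)
  have carrier: "carrier BHT = fiber ` carrier PU"
    unfolding carrier_PU
    by (auto simp: brin_higman_thompson_group_def quotient_def class_eq_fiber)
  show "fiber \<in> hom PU BHT"
    using BHT_mult_fiber carrier by (intro homI) auto
  have "inj_on fiber (carrier PU)"
  proof (rule inj_onI)
    fix x y assume "x \<in> carrier PU" "y \<in> carrier PU" "fiber x = fiber y"
    \<comment> \<open>Fibres over the carrier are nonempty, and a common element has only one value
      of \<open>Theta\<close>.\<close>
    then show "x = y" unfolding carrier_PU fiber_def by blast
  qed
  then show "bij_betw fiber (carrier PU) (carrier BHT)"
    unfolding bij_betw_def using carrier by simp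
qed

lemma BHT_group: "group BHT"
proof -
  have "\<one>\<^bsub>BHT\<^esub> = fiber \<one>\<^bsub>PU\<^esub>"
    using class_eq_fiber[OF initial_bijection] Theta_Id_on[OF frame_initial]
    by (simp add: brin_higman_thompson_group_def)
  \<comment> \<open>Transport along an isomorphism overwrites the unit by the image of the unit;
    here the two agree, so the update changes nothing.\<close>
  then have "BHT\<lparr>one := fiber \<one>\<^bsub>PU\<^esub>\<rparr> = BHT"
    by (simp add: brin_higman_thompson_group_def)
  then show ?thesis
    using group.iso_imp_img_group[OF PU_group fiber_iso] by simp
qed

end

theorem theorem5p4:
  fixes r m t :: nat
  assumes "r \<ge> 2" and "m \<ge> 1" and "t \<ge> 1"
  shows "group (positive_unitary_group r t m) \<and>
    group (brin_higman_thompson_group r t m) \<and>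
    positive_unitary_group r t m \<cong> brin_higman_thompson_group r t m"
proof -
  interpret leavitt_matrix_algebra r t m
    by unfold_locales (use assms in auto)
  show ?thesis
    using PU_group BHT_group is_isoI[OF fiber_iso] by blast
qed


end
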